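(* Let $\omega$ satisfy the Diophantine condition: there are constants $\kappa>0$, $\tau\ge 1$ with $\inf_{p\in\mathbb{Z}}|n\omega-p|>\kappa|n|^{-\tau}$ for all $n\in\mathbb{Z}\setminus\{0\}$. Let $v:\mathbb{T}\to\mathbb{R}$ be $C^2$ with a unique minimum, which is non-degenerate. Then there is $\lambda_0=\lambda_0(\omega,v)>0$ such that for every $\lambda>\lambda_0$ the following holds, where $E_0$ denotes the lowest energy of the spectrum. For $E<E_0$ sufficiently close to $E_0$, the minimum $$\delta(E)=\min_{\theta\in\mathbb{T}}|\psi^u_E(\theta)-\psi^s_E(\theta)|$$ is attained at a unique point $\theta_c(E)\in\mathbb{T}$, and $$\delta(E)=C_1\,(E_0-E)+o(E_0-E)\qquad\text{as }E\nearrow E_0,$$ for some constant $C_1>0$ independent of $E$. Furthermore, there exist a function $\epsilon(E)>0$ with $\lim_{E\nearrow E_0}\epsilon(E)=0$ and a constant $C_2>0$ independent of $E$ such that $$\frac{1}{C_2}\Big(\frac{1}{\sqrt{\delta(E)}}\Big)^{1-\epsilon(E)}\le \|\psi^u_E\|_{C^1}\le C_2\,\frac{1}{\sqrt{\delta(E)}},$$ and the same two-sided inequality holds with $\|\psi^u_E\|_{C^1}$ replaced by $\|\psi^s_E\|_{C^1}$.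
   Context: $\mathbb{T}=\mathbb{R}/\mathbb{Z}$. For $\lambda>0$ and $E\in\mathbb{R}$ consider the quasi-periodic Schrödinger cocycle $(\theta,x)\mapsto(\theta+\omega,A_E(\theta)x)$ on $\mathbb{T}\times\mathbb{R}^2$ with $A_E(\theta)=\begin{pmatrix}0&1\\-1&\lambda^2v(\theta)-E\end{pmatrix}$. It is associated with the Schrödinger operator $(Hu)_n=-u_{n+1}-u_{n-1}+\lambda^2 v(\theta+n\omega)u_n$ on $\ell^2(\mathbb{Z})$, whose spectrum is independent of $\theta$; $E_0$ is the minimum of this spectrum. In projective coordinates, where $r\in\widehat{\mathbb{R}}=\mathbb{R}\cup\{\infty\}$ represents the direction of $(1,r)$, the cocycle induces $\Phi_E(\theta,r)=(\theta+\omega,\lambda^2v(\theta)-E-1/r)$. For $E<E_0$ the cocycle is uniformly hyperbolic, and its unstable and stable directions give continuous functions $\psi^u_E,\psi^s_E:\mathbb{T}\to\mathbb{R}$ (projective coordinates of the unstable and stable subspaces), which are invariant: $\psi(\theta+\omega)=\lambda^2v(\theta)-E-1/\psi(\theta)$, and satisfy $0<\psi^s_E<\psi^u_E$ with values in a bounded interval $[1/C,C]$. $\|\psi\|_{C^1}=\max|\psi|+\max|\psi'|$. *)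

theory Defs
  imports "HOL-Analysis.Analysis"
begin

text \<open>The circle T = R/Z is represented by 1-periodic functions on the reals.\<close>

definition diophantine :: "real \<Rightarrow> bool" where
  "diophantine \<omega> \<longleftrightarrow> (\<exists>\<kappa>>0. \<exists>\<tau>\<ge>1. \<forall>n::int. n \<noteq> 0 \<longrightarrow>
      (INF p::int. \<bar>of_int n * \<omega> - of_int p\<bar>) > \<kappa> * \<bar>of_int n\<bar> powr (-\<tau>))"

definition periodic1 :: "(real \<Rightarrow> real) \<Rightarrow> bool" where
  "periodic1 f \<longleftrightarrow> (\<forall>x. f (x + 1) = f x)"

definition C2_fun :: "(real \<Rightarrow> real) \<Rightarrow> bool" where
  "C2_fun f \<longleftrightarrow> (\<exists>f' f''. (\<forall>x. (f has_real_derivative f' x) (at x)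
       \<and> (f' has_real_derivative f'' x) (at x)) \<and> continuous_on UNIV f'')"

definition C1_fun :: "(real \<Rightarrow> real) \<Rightarrow> bool" where
  "C1_fun f \<longleftrightarrow> (\<exists>f'. (\<forall>x. (f has_real_derivative f' x) (at x)) \<and> continuous_on UNIV f')"

definition unique_nondeg_min :: "(real \<Rightarrow> real) \<Rightarrow> bool" where
  "unique_nondeg_min v \<longleftrightarrow> (\<exists>m. (\<forall>x. v m \<le> v x) \<and> (\<forall>x. v x = v m \<longrightarrow> x - m \<in> \<int>)
       \<and> deriv (deriv v) m > 0)"

definition l2Z :: "(int \<Rightarrow> real) set" where
  "l2Z = {u. (\<lambda>n. (u n)\<^sup>2) summable_on UNIV}"

definition schrod_op :: "real \<Rightarrow> real \<Rightarrow> (real \<Rightarrow> real) \<Rightarrow> real \<Rightarrow> (int \<Rightarrow> real) \<Rightarrow> (int \<Rightarrow> real)" where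
  "schrod_op \<omega> lam v \<theta> u = (\<lambda>n. - u (n + 1) - u (n - 1) + lam\<^sup>2 * v (\<theta> + of_int n * \<omega>) * u n)"

text \<open>Spectrum: E such that H - E is not a bijection of l^2(Z) onto itself
  (for bounded operators this is equivalent to non-invertibility by the open mapping theorem).\<close>
definition spec :: "real \<Rightarrow> real \<Rightarrow> (real \<Rightarrow> real) \<Rightarrow> real \<Rightarrow> real set" where
  "spec \<omega> lam v \<theta> = {E. \<not> bij_betw (\<lambda>u. (\<lambda>n. schrod_op \<omega> lam v \<theta> u n - E * u n)) l2Z l2Z}"

text \<open>Lowest energy of the spectrum (the spectrum does not depend on theta).\<close>
definition E0 :: "real \<Rightarrow> real \<Rightarrow> (real \<Rightarrow> real) \<Rightarrow> real" where
  "E0 \<omega> lam v = Inf (\<Union>\<theta>. spec \<omega> lam v \<theta>)"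

definition cocA :: "real \<Rightarrow> (real \<Rightarrow> real) \<Rightarrow> real \<Rightarrow> real \<Rightarrow> real \<times> real \<Rightarrow> real \<times> real" where
  "cocA lam v E \<theta> x = (snd x, - fst x + (lam\<^sup>2 * v \<theta> - E) * snd x)"

definition cocA_inv :: "real \<Rightarrow> (real \<Rightarrow> real) \<Rightarrow> real \<Rightarrow> real \<Rightarrow> real \<times> real \<Rightarrow> real \<times> real" where
  "cocA_inv lam v E \<theta> x = ((lam\<^sup>2 * v \<theta> - E) * fst x - snd x, fst x)"

fun coc_fwd :: "real \<Rightarrow> real \<Rightarrow> (real \<Rightarrow> real) \<Rightarrow> real \<Rightarrow> nat \<Rightarrow> real \<Rightarrow> real \<times> real \<Rightarrow> real \<times> real" where
  "coc_fwd \<omega> lam v E 0 \<theta> x = x"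
| "coc_fwd \<omega> lam v E (Suc n) \<theta> x = cocA lam v E (\<theta> + real n * \<omega>) (coc_fwd \<omega> lam v E n \<theta> x)"

fun coc_bwd :: "real \<Rightarrow> real \<Rightarrow> (real \<Rightarrow> real) \<Rightarrow> real \<Rightarrow> nat \<Rightarrow> real \<Rightarrow> real \<times> real \<Rightarrow> real \<times> real" where
  "coc_bwd \<omega> lam v E 0 \<theta> x = x"
| "coc_bwd \<omega> lam v E (Suc n) \<theta> x = cocA_inv lam v E (\<theta> - real (Suc n) * \<omega>) (coc_bwd \<omega> lam v E n \<theta> x)"

text \<open>Projective coordinates of the stable and unstable directions: the direction (1,r)
  whose forward (resp. backward) iterates tend to zero.\<close>
definition psi_s :: "real \<Rightarrow> real \<Rightarrow> (real \<Rightarrow> real) \<Rightarrow> real \<Rightarrow> real \<Rightarrow> real" where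
  "psi_s \<omega> lam v E \<theta> = (THE r. (\<lambda>n. coc_fwd \<omega> lam v E n \<theta> (1, r)) \<longlonglongrightarrow> 0)"

definition psi_u :: "real \<Rightarrow> real \<Rightarrow> (real \<Rightarrow> real) \<Rightarrow> real \<Rightarrow> real \<Rightarrow> real" where
  "psi_u \<omega> lam v E \<theta> = (THE r. (\<lambda>n. coc_bwd \<omega> lam v E n \<theta> (1, r)) \<longlonglongrightarrow> 0)"

definition C1_norm :: "(real \<Rightarrow> real) \<Rightarrow> real" where
  "C1_norm f = (SUP \<theta>\<in>{0..1}. \<bar>f \<theta>\<bar>) + (SUP \<theta>\<in>{0..1}. \<bar>deriv f \<theta>\<bar>)"

definition delta :: "real \<Rightarrow> real \<Rightarrow> (real \<Rightarrow> real) \<Rightarrow> real \<Rightarrow> real" where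
  "delta \<omega> lam v E = (INF \<theta>\<in>{0..1}. \<bar>psi_u \<omega> lam v E \<theta> - psi_s \<omega> lam v E \<theta>\<bar>)"

end

theory Submission
  imports Defs "HOL-Real_Asymp.Real_Asymp"
begin

text \<open>
  Write \<open>V = \<lambda>\<^sup>2 v\<close>. The unstable and stable directions are infinite continued fractions in \<open>V - E\<close>,
  and \<open>\<psi>\<^sup>u(\<theta> + \<omega>) - \<psi>\<^sup>s(\<theta> + \<omega>) = D(\<theta>)\<close>, where \<open>1 / D(\<theta>)\<close> is the diagonal entry at the origin of the resolvent
  of the operator with phase \<open>\<theta>\<close>. So \<open>\<delta>(E)\<close> is the minimum of \<open>D\<close>.

  As a function of the potential a continued fraction is convex, with an explicit tangent inequality
  whose weights are the squares of the decaying solution. In the direction of \<open>E\<close> it shows that \<open>D\<close> is concave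
  in \<open>E\<close>, so that \<open>\<delta>(E) / (E\<^sub>0 - E)\<close> increases; in the direction of \<open>V'\<close> it gives the upper bound
  \<open>|\<psi>'| \<le> C (E\<^sub>0 - E)\<^sup>-\<^sup>1\<^sup>/\<^sup>2\<close>. What remains is to see that the decaying solutions at a minimum point \<open>\<theta>\<^sub>c\<close> of
  \<open>D\<close> are bounded in \<open>\<ell>\<^sup>2\<close> uniformly in \<open>E\<close>.

  This is proved by induction over scales. A phase \<open>\<theta>\<close> near the minimum of \<open>V\<close> at distance \<open>s > 0\<close> from \<open>\<theta>\<^sub>c\<close>
  satisfies \<open>D\<^sub>N(\<theta>) \<ge> \<delta> + s\<^sup>2\<close>, where \<open>D\<^sub>N\<close> only sees the window of radius \<open>N = s\<^sup>-\<^sup>1\<^sup>/\<^sup>2\<^sup>\<tau>\<close>: inside this window the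
  Diophantine condition only allows returns to the minimum of \<open>V\<close> at larger distances from \<open>\<theta>\<^sub>c\<close>, the induction hypothesis
  and a maximum principle give exponential decay there, hence \<open>D\<^sub>N\<close> inherits the strong convexity of \<open>V\<close>, and at the midpoint
  of \<open>\<theta>\<close> and \<open>\<theta>\<^sub>c\<close> it is at least \<open>\<delta>\<close>. (The bound fails for \<open>D\<close> itself, which tends to \<open>0\<close> along the whole orbit
  of \<open>\<theta>\<^sub>c\<close> as \<open>E\<close> tends to \<open>E\<^sub>0\<close>.)

  For the lower bound on \<open>\<psi>'\<close>, a shift of \<open>\<theta>\<^sub>c\<close> by \<open>4 \<delta>\<^sup>1\<^sup>/\<^sup>2\<close> multiplies \<open>D\<close> by at least 9. Along the backward orbit \<open>D\<close> grows to
  order 1 in \<open>O(log (1 / \<delta>))\<close> steps, and the ratio persists unless the slope is of order \<open>\<delta>\<^sup>-\<^sup>1\<^sup>/\<^sup>2 / log (1 / \<delta>)\<close>.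
\<close>

section \<open>Finite continued fractions\<close>

text \<open>Spectral theory stays outside the estimates: the working threshold \<open>Es\<close> is
  the supremum of the energies at which all finite fractions have positive denominators. Below it
  \<open>H - E\<close> is inverted by an explicit factorization; at it an eigenvector is glued from
  two half-line limits. The gluing needs the linear bound D <= 2 (Es - E), so the identification of
  \<open>Es\<close> with \<open>E0\<close> also rests on large coupling. The linear bound in turn
  combines the uniform norm bound at minimum points of D with the soft fact that min D tends to 0: a
  separation uniform in the phase would allow the energy to be raised. In the induction, returns to
  the well at distance t from \<theta>c make the local resolvent as large as t^-2. Decay is
  therefore measured by a weight of about half the rate available off the wells, and each resonant
  window repays the loss from the other half. Convexity along a midpoint needs, besides decay, that
  the decaying solutions depend on the phase in a Lipschitz way; this comes from the same maximum
  principle, with the weight halved once more.\<close>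

abbreviation shift :: "(nat \<Rightarrow> real) \<Rightarrow> nat \<Rightarrow> real" where
  "shift a \<equiv> (\<lambda>n. a (Suc n))"

fun cf :: "nat \<Rightarrow> (nat \<Rightarrow> real) \<Rightarrow> real" where
  "cf 0 a = 0"
| "cf (Suc N) a = 1 / (a 0 - cf N (shift a))"

fun cfpos :: "nat \<Rightarrow> (nat \<Rightarrow> real) \<Rightarrow> bool" where
  "cfpos 0 a = True"
| "cfpos (Suc N) a = (cfpos N (shift a) \<and> cf N (shift a) < a 0)"

text \<open>The solution of the three-term recursion with diagonal \<open>a\<close> that equals 1 at
  site 0 and 0 at site \<open>N + 1\<close>. From index 1 on it is the first column of the inverse
  Jacobi matrix.\<close>

fun cfprod :: "nat \<Rightarrow> (nat \<Rightarrow> real) \<Rightarrow> nat \<Rightarrow> real" where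
  "cfprod N a 0 = 1"
| "cfprod N a (Suc k) = cf N a * cfprod (N - 1) (shift a) k"

lemma cf_nonneg: "cfpos N a \<Longrightarrow> 0 \<le> cf N a"
  by (cases N) auto

lemma cf_antimono:
  assumes "cfpos N a" "\<And>n. a n \<le> b n"
  shows "cfpos N b \<and> cf N b \<le> cf N a"
  using assms
proof (induction N arbitrary: a b)
  case (Suc N)
  have IH: "cfpos N (shift b)" "cf N (shift b) \<le> cf N (shift a)"
    using Suc.IH[of "shift a" "shift b"] Suc.prems by auto
  have "a 0 \<le> b 0" using Suc.prems by blast
  then have "a 0 - cf N (shift a) \<le> b 0 - cf N (shift b)" "0 < a 0 - cf N (shift a)"
    using IH(2) Suc.prems(1) by (linarith, simp)
  then show ?case using IH by (auto intro!: divide_left_mono mult_pos_pos)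
qed auto

lemma cfpos_Suc_mono:
  assumes "cfpos (Suc N) a"
  shows "cfpos N a \<and> cf N a \<le> cf (Suc N) a"
  using assms
proof (induction N arbitrary: a)
  case (Suc N)
  have IH: "cfpos N (shift a)" "cf N (shift a) \<le> cf (Suc N) (shift a)"
    using Suc.IH[of "shift a"] Suc.prems by auto
  have p: "cf (Suc N) (shift a) < a 0" using Suc.prems by simp
  have pos: "0 < a 0 - cf (Suc N) (shift a)" "a 0 - cf (Suc N) (shift a) \<le> a 0 - cf N (shift a)"
    using IH p by linarith+
  have "cf (Suc N) a = 1 / (a 0 - cf N (shift a))" by simp
  also have "\<dots> \<le> 1 / (a 0 - cf (Suc N) (shift a))"
    using pos by (intro divide_left_mono) auto
  finally have "cf (Suc N) a \<le> cf (Suc (Suc N)) a" by (subst cf.simps(2))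
  moreover have "cfpos (Suc N) a" using IH pos by auto
  ultimately show ?case by blast
qed auto

lemma cf_mono_nat:
  assumes "M \<le> N" "cfpos N a"
  shows "cfpos M a \<and> cf M a \<le> cf N a"
  using assms
proof (induction rule: dec_induct)
  case (step n)
  then show ?case using cfpos_Suc_mono[of n a] by force
qed auto

lemma cfprod_nonneg: "cfpos N a \<Longrightarrow> 0 \<le> cfprod N a k"
proof (induction k arbitrary: N a)
  case (Suc k)
  then show ?case by (cases N) (auto simp: cfprod.simps(1))
qed auto

lemma cfprod_beyond: "N < k \<Longrightarrow> cfprod N a k = 0"
proof (induction k arbitrary: N a)
  case (Suc k)
  then show ?case by (cases N) auto
qed auto

text \<open>As a function of the coefficients \<open>a\<close>, the continued fraction is a diagonal entry of the
  inverse of a Jacobi matrix, hence convex; this is its tangent inequality.\<close>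

lemma cf_tangent:
  assumes "cfpos N a" "cfpos N b"
  shows "cf N a - (\<Sum>k<N. (cfprod N a (Suc k))\<^sup>2 * (b k - a k)) \<le> cf N b"
  using assms
proof (induction N arbitrary: a b)
  case (Suc N)
  define x where "x = a 0 - cf N (shift a)"
  define y where "y = b 0 - cf N (shift b)"
  define S where "S = (\<Sum>k<N. (cfprod N (shift a) (Suc k))\<^sup>2 * (shift b k - shift a k))"
  have xy: "x > 0" "y > 0" using Suc.prems by (auto simp: x_def y_def)
  have IH: "cf N (shift a) - S \<le> cf N (shift b)"
    using Suc.IH[of "shift a" "shift b"] Suc.prems unfolding S_def by auto
  have "(\<Sum>k<Suc N. (cfprod (Suc N) a (Suc k))\<^sup>2 * (b k - a k))
      = (1/x)\<^sup>2 * (b 0 - a 0) + (\<Sum>k<N. (cfprod (Suc N) a (Suc (Suc k)))\<^sup>2 * (b (Suc k) - a (Suc k)))"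
    unfolding sum.lessThan_Suc_shift by (simp add: x_def)
  also have "(\<Sum>k<N. (cfprod (Suc N) a (Suc (Suc k)))\<^sup>2 * (b (Suc k) - a (Suc k))) = (1/x)\<^sup>2 * S"
    unfolding S_def sum_distrib_left
    by (intro sum.cong refl) (simp add: x_def power_mult_distrib power_divide mult.assoc)
  finally have *: "(\<Sum>k<Suc N. (cfprod (Suc N) a (Suc k))\<^sup>2 * (b k - a k)) = (1/x)\<^sup>2 * (b 0 - a 0 + S)"
    by (simp add: algebra_simps)
  have "y - x \<le> b 0 - a 0 + S" using IH by (simp add: x_def y_def)
  then have "1/x - (1/x)\<^sup>2 * (b 0 - a 0 + S) \<le> 1/x - (1/x)\<^sup>2 * (y - x)"
    by (intro diff_left_mono mult_left_mono) auto
  \<comment> \<open>The tangent to the convex function 1/x at \<open>x\<close> lies below its value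
    at \<open>y\<close>.\<close>
  also have "\<dots> \<le> 1/y"
  proof -
    have "1/y - (1/x - (1/x)\<^sup>2 * (y - x)) = (x - y)\<^sup>2 / (x\<^sup>2 * y)"
      using xy by (simp add: field_simps power2_eq_square)
    also have "\<dots> \<ge> 0" using xy by auto
    finally show ?thesis by linarith
  qed
  finally show ?case using * by (simp add: x_def y_def)
qed auto

text \<open>A discrete Green formula for an arbitrary sequence \<open>h\<close>: the bracket is the
  residual of \<open>h\<close> in the three-term recursion, and the inverse matrix expresses the
  value next to the boundary by the residuals and the two boundary values. It later localises an
  equation to a window.\<close>

lemma cf_green_identity:
  assumes "cfpos N a"
  shows "h 1 = cf N a * h 0 + cfprod N a N * h (Suc N)
     + (\<Sum>i<N. cfprod N a (Suc i) * (a i * h (Suc i) - h (Suc (Suc i)) - h i))"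
  using assms
proof (induction N arbitrary: a h)
  case (Suc N)
  define x where "x = a 0 - cf N (shift a)"
  have x: "x > 0" using Suc.prems by (auto simp: x_def)
  define S where "S = (\<Sum>i<N. cfprod N (shift a) (Suc i) * (shift a i * h (Suc (Suc i)) - h (Suc (Suc (Suc i))) - h (Suc i)))"
  have IH: "h 2 = cf N (shift a) * h 1 + cfprod N (shift a) N * h (Suc (Suc N)) + S"
    using Suc.IH[of "shift a" "\<lambda>n. h (Suc n)"] Suc.prems by (simp add: S_def numeral_2_eq_2)
  have "(\<Sum>i<Suc N. cfprod (Suc N) a (Suc i) * (a i * h (Suc i) - h (Suc (Suc i)) - h i))
     = (1/x) * (a 0 * h 1 - h 2 - h 0) + (1/x) * S"
    unfolding sum.lessThan_Suc_shift S_def sum_distrib_left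
    by (simp add: x_def numeral_2_eq_2)
  moreover have "cf (Suc N) a = 1 / x" "cfprod (Suc N) a (Suc N) = (1 / x) * cfprod N (shift a) N"
    by (simp_all add: x_def)
  ultimately have "cf (Suc N) a * h 0 + cfprod (Suc N) a (Suc N) * h (Suc (Suc N))
     + (\<Sum>i<Suc N. cfprod (Suc N) a (Suc i) * (a i * h (Suc i) - h (Suc (Suc i)) - h i))
    = (1/x) * (h 0 + cfprod N (shift a) N * h (Suc (Suc N)) + (a 0 * h 1 - h 2 - h 0) + S)"
    by (simp only: algebra_simps)
  also have "\<dots> = (1/x) * (x * h 1)"
    unfolding IH by (simp add: x_def algebra_simps)
  also have "\<dots> = h 1" using x by simp
  finally show ?case by simp
qed auto

lemma cfprod_rec:
  assumes "cfpos N a" "i < N"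
  shows "a i * cfprod N a (Suc i) = cfprod N a (Suc (Suc i)) + cfprod N a i"
  using assms
proof (induction i arbitrary: N a)
  case 0
  then obtain M where N: "N = Suc M" by (cases N) auto
  have "a 0 - cf M (shift a) > 0" using 0 N by auto
  then show ?case using N by (simp add: field_simps)
next
  case (Suc i)
  then obtain M where N: "N = Suc M" by (cases N) auto
  have "shift a i * cfprod M (shift a) (Suc i) = cfprod M (shift a) (Suc (Suc i)) + cfprod M (shift a) i"
    using Suc N by (intro Suc.IH) auto
  then have "cf N a * (shift a i * cfprod M (shift a) (Suc i))
     = cf N a * (cfprod M (shift a) (Suc (Suc i)) + cfprod M (shift a) i)" by simp
  then show ?case using N by (simp only: cfprod.simps diff_Suc_1 algebra_simps)
qed

text \<open>A positive supersolution of the Riccati recursion is a barrier for fractions of every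
  length. This is how an energy is certified to lie below the threshold.\<close>

lemma cf_supersolution:
  assumes "\<And>n. 0 < z n" "\<And>n. 1 / z n \<le> a n - z (Suc n)"
  shows "cfpos N a \<and> cf N a \<le> z 0"
  using assms
proof (induction N arbitrary: a z)
  case 0
  then show ?case by (auto simp: less_imp_le)
next
  case (Suc N)
  have IH: "cfpos N (shift a)" "cf N (shift a) \<le> z 1"
    using Suc.IH[of "shift z" "shift a"] Suc.prems by auto
  have z0: "z 0 > 0" "1 / z 0 \<le> a 0 - z 1" using Suc.prems(1)[of 0] Suc.prems(2)[of 0] by auto
  have "0 < 1 / z 0" using z0 by simp
  then have p: "0 < a 0 - cf N (shift a)" "1 / z 0 \<le> a 0 - cf N (shift a)" using IH z0 by linarith+
  have "1 / (a 0 - cf N (shift a)) \<le> 1 / (1 / z 0)"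
    using p z0 by (intro divide_left_mono) auto
  then show ?case using IH p by auto
qed

section \<open>Continued fractions along the rotation\<close>

text \<open>With \<open>\<sigma> = \<omega>\<close> the fractions look to the right of the site \<open>\<theta>\<close>, with \<open>\<sigma> = -\<omega>\<close> to the left:
  \<open>\<psi>\<^sup>s(\<theta>) = ff V \<omega> E (\<theta> - \<omega>)\<close> and \<open>\<psi>\<^sup>u(\<theta>) = 1 / ff V (-\<omega>) E \<theta>\<close>. The solution decaying in the direction \<open>\<sigma>\<close>,
  normalised to 1 at \<open>\<theta>\<close>, is \<open>gg\<close>, and \<open>pp\<close> is its version with a zero boundary value at distance \<open>N + 1\<close>.
  Energies are compared with \<open>Estar\<close>, which turns out to be the bottom of the spectrum for large coupling.\<close>

definition ap :: "(real \<Rightarrow> real) \<Rightarrow> real \<Rightarrow> real \<Rightarrow> real \<Rightarrow> nat \<Rightarrow> real" where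
  "ap V \<sigma> E \<theta> n = V (\<theta> + \<sigma> * real (Suc n)) - E"

definition kf :: "(real \<Rightarrow> real) \<Rightarrow> real \<Rightarrow> real \<Rightarrow> nat \<Rightarrow> real \<Rightarrow> real" where
  "kf V \<sigma> E N \<theta> = cf N (ap V \<sigma> E \<theta>)"

definition ff :: "(real \<Rightarrow> real) \<Rightarrow> real \<Rightarrow> real \<Rightarrow> real \<Rightarrow> real" where
  "ff V \<sigma> E \<theta> = (SUP N. kf V \<sigma> E N \<theta>)"

definition good :: "(real \<Rightarrow> real) \<Rightarrow> real \<Rightarrow> real \<Rightarrow> bool" where
  "good V \<sigma> E \<longleftrightarrow> (\<forall>\<theta> N. cfpos N (ap V \<sigma> E \<theta>))"

definition Estar :: "(real \<Rightarrow> real) \<Rightarrow> real \<Rightarrow> real" where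
  "Estar V \<sigma> = Sup {E. good V \<sigma> E}"

definition gg :: "(real \<Rightarrow> real) \<Rightarrow> real \<Rightarrow> real \<Rightarrow> real \<Rightarrow> nat \<Rightarrow> real" where
  "gg V \<sigma> E \<theta> k = (\<Prod>i<k. ff V \<sigma> E (\<theta> + \<sigma> * real i))"

definition pp :: "(real \<Rightarrow> real) \<Rightarrow> real \<Rightarrow> real \<Rightarrow> nat \<Rightarrow> real \<Rightarrow> nat \<Rightarrow> real" where
  "pp V \<sigma> E N \<theta> k = cfprod N (ap V \<sigma> E \<theta>) k"

definition DD :: "(real \<Rightarrow> real) \<Rightarrow> real \<Rightarrow> real \<Rightarrow> real \<Rightarrow> real" where
  "DD V \<sigma> E \<theta> = V \<theta> - E - ff V \<sigma> E \<theta> - ff V (-\<sigma>) E \<theta>"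

definition DN :: "(real \<Rightarrow> real) \<Rightarrow> real \<Rightarrow> real \<Rightarrow> nat \<Rightarrow> real \<Rightarrow> real" where
  "DN V \<sigma> E N \<theta> = V \<theta> - E - kf V \<sigma> E N \<theta> - kf V (-\<sigma>) E N \<theta>"

lemma shift_ap: "shift (ap V \<sigma> E \<theta>) = ap V \<sigma> E (\<theta> + \<sigma>)"
  by (auto simp: ap_def algebra_simps)

lemma ap_0: "ap V \<sigma> E \<theta> 0 = V (\<theta> + \<sigma>) - E"
  by (simp add: ap_def)

lemma kf_0: "kf V \<sigma> E 0 \<theta> = 0"
  by (simp add: kf_def)

lemma kf_Suc: "kf V \<sigma> E (Suc N) \<theta> = 1 / (V (\<theta> + \<sigma>) - E - kf V \<sigma> E N (\<theta> + \<sigma>))"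
  by (simp add: kf_def shift_ap ap_0)

lemma pp_0: "pp V \<sigma> E N \<theta> 0 = 1"
  by (simp add: pp_def)

lemma pp_Suc: "pp V \<sigma> E N \<theta> (Suc k) = kf V \<sigma> E N \<theta> * pp V \<sigma> E (N - 1) (\<theta> + \<sigma>) k"
  by (simp add: pp_def kf_def shift_ap)

lemma gg_0: "gg V \<sigma> E \<theta> 0 = 1"
  by (simp add: gg_def)

lemma gg_Suc: "gg V \<sigma> E \<theta> (Suc k) = ff V \<sigma> E \<theta> * gg V \<sigma> E (\<theta> + \<sigma>) k"
  unfolding gg_def prod.lessThan_Suc_shift by (simp add: algebra_simps)

lemma gg_Suc': "gg V \<sigma> E \<theta> (Suc k) = gg V \<sigma> E \<theta> k * ff V \<sigma> E (\<theta> + \<sigma> * real k)"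
  unfolding gg_def by simp

lemma gg_add: "gg V \<sigma> E \<theta> (j + k) = gg V \<sigma> E \<theta> j * gg V \<sigma> E (\<theta> + \<sigma> * real j) k"
proof (induction j arbitrary: \<theta>)
  case (Suc j)
  then show ?case by (simp add: gg_Suc algebra_simps)
qed (simp add: gg_0)

text \<open>The induction moves the origin: M + 1 sites to the left and N to the right of \<theta>
  are M sites to the left and N + 1 to the right of \<theta> - \<sigma>, and for positive x, y the
  inequality 1/y < x is 1/x < y.\<close>

lemma good_neg_aux:
  assumes "good V \<sigma> E"
  shows "cfpos M (ap V (-\<sigma>) E \<theta>) \<and> kf V (-\<sigma>) E M \<theta> + kf V \<sigma> E N \<theta> < V \<theta> - E"
proof (induction M arbitrary: \<theta> N)
  case 0
  have "cfpos (Suc N) (ap V \<sigma> E (\<theta> - \<sigma>))" using assms by (auto simp: good_def)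
  then show ?case by (simp add: kf_0 shift_ap ap_0) (simp add: kf_def)
next
  case (Suc M)
  have IH: "cfpos M (ap V (-\<sigma>) E (\<theta> - \<sigma>))"
    "kf V (-\<sigma>) E M (\<theta> - \<sigma>) + kf V \<sigma> E (Suc N) (\<theta> - \<sigma>) < V (\<theta> - \<sigma>) - E"
    using Suc.IH by auto
  have "cfpos (Suc N) (ap V \<sigma> E (\<theta> - \<sigma>))" using assms by (auto simp: good_def)
  then have y: "0 < V \<theta> - E - kf V \<sigma> E N \<theta>" (is "0 < ?y") by (simp add: shift_ap ap_0 kf_def)
  define x where "x = V (\<theta> - \<sigma>) - E - kf V (-\<sigma>) E M (\<theta> - \<sigma>)"
  have "1 / ?y < x" using IH(2) by (simp add: kf_Suc x_def)
  moreover have "0 < 1 / ?y" using y by simp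
  ultimately have x0: "x > 0" by linarith
  have "1 < x * ?y" using \<open>1 / ?y < x\<close> y by (simp only: pos_divide_less_eq)
  then have x: "x > 0" "1 / x < ?y" using x0 by (simp_all only: pos_divide_less_eq mult.commute)
  then have "kf V (-\<sigma>) E (Suc M) \<theta> < ?y" by (simp add: kf_Suc x_def)
  moreover have "cfpos (Suc M) (ap V (-\<sigma>) E \<theta>)"
    using IH(1) x(1) by (simp add: shift_ap ap_0 x_def kf_def)
  ultimately show ?case by simp
qed

lemma good_neg: "good V (-\<sigma>) E \<longleftrightarrow> good V \<sigma> E"
  using good_neg_aux[of V \<sigma> E] good_neg_aux[of V "-\<sigma>" E] unfolding good_def by auto

lemma Estar_neg: "Estar V (-\<sigma>) = Estar V \<sigma>"
  by (simp add: Estar_def good_neg)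

lemma DD_neg: "DD V (-\<sigma>) E \<theta> = DD V \<sigma> E \<theta>"
  by (simp add: DD_def)

lemma DN_neg: "DN V (-\<sigma>) E N \<theta> = DN V \<sigma> E N \<theta>"
  by (simp add: DN_def)

lemma good_mono: "good V \<sigma> E \<Longrightarrow> E' \<le> E \<Longrightarrow> good V \<sigma> E'"
  unfolding good_def using cf_antimono[of _ "ap V \<sigma> E \<theta>" "ap V \<sigma> E' \<theta>" for \<theta>]
  by (auto simp: ap_def)

lemma continuous_on_suminf_M:
  fixes g :: "nat \<Rightarrow> real \<Rightarrow> real"
  assumes "\<And>k. continuous_on UNIV (g k)" "\<And>k x. \<bar>g k x\<bar> \<le> M k" "summable M"
  shows "continuous_on UNIV (\<lambda>x. \<Sum>k. g k x)"
proof (rule uniform_limit_theorem)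
  show "uniform_limit UNIV (\<lambda>n x. \<Sum>i<n. g i x) (\<lambda>x. \<Sum>k. g k x) sequentially"
    using assms(2,3) by (intro Weierstrass_m_test) auto
  show "\<forall>\<^sub>F n in sequentially. continuous_on UNIV (\<lambda>x. \<Sum>i<n. g i x)"
    using assms(1) by (intro always_eventually allI continuous_on_sum) auto
qed auto

section \<open>Potentials on the circle and the infinite fractions below the threshold\<close>

locale hill =
  fixes V V' :: "real \<Rightarrow> real" and \<omega> m B0 B1 B2 :: real
  assumes V_periodic: "V (x + 1) = V x"
    and V_deriv: "(V has_real_derivative V' x) (at x)"
    and V'_cont: "continuous_on UNIV V'"
    and V'_bound: "\<bar>V' x\<bar> \<le> B1"
    and V_taylor: "\<bar>V (x + h) - V x - h * V' x\<bar> \<le> B2 * h\<^sup>2"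
    and V_min: "V m \<le> V x"
    and V_max: "V x \<le> V m + B0"
    and B0: "0 < B0" and B1: "0 < B1" and B2: "0 < B2"
    and \<omega>_nz: "\<omega> \<noteq> 0"
begin

text \<open>The assumptions do not see the direction of the rotation, so everything proved for
  fractions looking to the right transfers to those looking to the left.\<close>

lemma hill_neg: "hill V V' (-\<omega>) m B0 B1 B2"
  using hill_axioms by (simp add: hill_def)

abbreviation "Es \<equiv> Estar V \<omega>"

lemma V_int: "V (x + of_int j) = V x"
proof -
  have *: "V (x + real n) = V x" for x n
  proof (induction n)
    case (Suc n)
    then show ?case using V_periodic[of "x + real n"] by (simp add: algebra_simps)
  qed auto
  show ?thesis
  proof (cases "j \<ge> 0")
    case True then show ?thesis using *[of x "nat j"] by simp
  next
    case False then show ?thesis using *[of "x + of_int j" "nat (-j)"] by simp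
  qed
qed

lemma V_lipschitz: "\<bar>V x - V y\<bar> \<le> B1 * \<bar>x - y\<bar>"
proof -
  have "norm (V x - V y) \<le> B1 * norm (x - y)"
    using V_deriv V'_bound
    by (intro field_differentiable_bound[where S=UNIV and f'=V'])
       (auto intro: has_field_derivative_at_within)
  then show ?thesis by simp
qed

lemma V_cont: "continuous_on UNIV V"
  using V_deriv by (meson DERIV_isCont continuous_at_imp_continuous_on)

text \<open>The constant 1 is a supersolution once V - E >= 2; the 2 is the norm of the hopping
  term.\<close>

lemma good_low: "good V \<omega> (V m - 2)"
  unfolding good_def
proof (intro allI)
  fix \<theta> N
  have "1 / 1 \<le> ap V \<omega> (V m - 2) \<theta> n - 1" for n
    using V_min[of "\<theta> + \<omega> * real (Suc n)"] by (simp add: ap_def)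
  then show "cfpos N (ap V \<omega> (V m - 2) \<theta>)"
    using cf_supersolution[of "\<lambda>_. 1" "ap V \<omega> (V m - 2) \<theta>" N] by auto
qed

lemma good_less_min: "good V \<omega> E \<Longrightarrow> E < V m"
  using good_neg_aux[of V \<omega> E 0 m 0] by (simp add: kf_0)

lemma good_bdd: "bdd_above {E. good V \<omega> E}"
  using good_less_min by (intro bdd_aboveI[of _ "V m"]) (auto simp: less_imp_le)

lemma good_less_Es: "E < Es \<Longrightarrow> good V \<omega> E"
  using good_low good_bdd good_mono less_cSup_iff[of "{E. good V \<omega> E}" E]
  unfolding Estar_def by (metis (no_types, lifting) empty_iff mem_Collect_eq order_less_imp_le)

lemma good_le_Es: "good V \<omega> E \<Longrightarrow> E \<le> Es"
  unfolding Estar_def using good_bdd by (intro cSup_upper) auto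

lemma Es_ge: "V m - 2 \<le> Es"
  using good_low good_le_Es by blast

lemma Es_le: "Es \<le> V m"
  unfolding Estar_def using good_low good_less_min
  by (intro cSup_least) (auto simp: less_imp_le)

lemma kf_cfpos: "E < Es \<Longrightarrow> cfpos N (ap V \<omega> E \<theta>)"
  using good_less_Es by (auto simp: good_def)

lemma kf_sum_less:
  assumes "E < Es" shows "kf V \<omega> E N \<theta> + kf V (-\<omega>) E M \<theta> < V \<theta> - E"
  using good_neg_aux[OF good_less_Es[OF assms]] by (simp add: add.commute)

lemma kf_nonneg: "E < Es \<Longrightarrow> 0 \<le> kf V \<omega> E N \<theta>"
  unfolding kf_def by (intro cf_nonneg kf_cfpos)

lemma kf_less: "E < Es \<Longrightarrow> kf V \<omega> E N \<theta> < V \<theta> - E"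
  using kf_sum_less[of E N \<theta> 0] by (simp add: kf_0)

lemma kf_mono: "E < Es \<Longrightarrow> M \<le> N \<Longrightarrow> kf V \<omega> E M \<theta> \<le> kf V \<omega> E N \<theta>"
  unfolding kf_def using cf_mono_nat kf_cfpos by blast

lemma kf_bdd: "E < Es \<Longrightarrow> bdd_above (range (\<lambda>N. kf V \<omega> E N \<theta>))"
  using kf_less by (intro bdd_aboveI[of _ "V \<theta> - E"]) (auto simp: less_imp_le)

lemma kf_tendsto: "E < Es \<Longrightarrow> (\<lambda>N. kf V \<omega> E N \<theta>) \<longlonglongrightarrow> ff V \<omega> E \<theta>"
  unfolding ff_def using kf_bdd kf_mono
  by (intro LIMSEQ_incseq_SUP) (auto simp: incseq_def)

lemma kf_tendsto': "E < Es \<Longrightarrow> (\<lambda>N. kf V (-\<omega>) E N \<theta>) \<longlonglongrightarrow> ff V (-\<omega>) E \<theta>"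
  using hill.kf_tendsto[OF hill_neg] by (simp add: Estar_neg)

lemma kf_le_ff: "E < Es \<Longrightarrow> kf V \<omega> E N \<theta> \<le> ff V \<omega> E \<theta>"
  unfolding ff_def using kf_bdd by (intro cSUP_upper) auto

lemma kf_le_ff': "E < Es \<Longrightarrow> kf V (-\<omega>) E N \<theta> \<le> ff V (-\<omega>) E \<theta>"
  using hill.kf_le_ff[OF hill_neg] by (simp add: Estar_neg)

lemma ff_nonneg: "E < Es \<Longrightarrow> 0 \<le> ff V \<omega> E \<theta>"
  using kf_le_ff[of E 0] kf_0 by metis

lemma ff_nonneg': "E < Es \<Longrightarrow> 0 \<le> ff V (-\<omega>) E \<theta>"
  using hill.ff_nonneg[OF hill_neg] by (simp add: Estar_neg)

lemma kf_mono_E: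
  assumes "E < E'" "E' < Es" shows "kf V \<omega> E N \<theta> \<le> kf V \<omega> E' N \<theta>"
  unfolding kf_def using assms
  cf_antimono[of N "ap V \<omega> E' \<theta>" "ap V \<omega> E \<theta>"] by (auto simp: ap_def kf_cfpos)

lemma ff_mono_E:
  assumes "E < E'" "E' < Es" shows "ff V \<omega> E \<theta> \<le> ff V \<omega> E' \<theta>"
  using assms by (intro LIMSEQ_le[OF kf_tendsto kf_tendsto]) (auto intro: kf_mono_E)

lemma ff_mono_E':
  assumes "E < E'" "E' < Es" shows "ff V (-\<omega>) E \<theta> \<le> ff V (-\<omega>) E' \<theta>"
  using hill.ff_mono_E[OF hill_neg] assms by (simp add: Estar_neg)

lemma DD_nonneg: assumes "E < Es" shows "0 \<le> DD V \<omega> E \<theta>"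
proof -
  have "ff V \<omega> E \<theta> + ff V (-\<omega>) E \<theta> \<le> V \<theta> - E"
    using assms
    by (intro LIMSEQ_le_const2[OF tendsto_add[OF kf_tendsto kf_tendsto']])
       (auto intro!: less_imp_le kf_sum_less)
  then show ?thesis by (simp add: DD_def)
qed

text \<open>Raising the energy by \<open>d\<close> lowers V - E by \<open>d\<close> and does not
  lower the fractions, yet D stays nonnegative up to the threshold; so D was at least
  \<open>d\<close> before.\<close>

lemma DD_ge: assumes "E < Es" shows "Es - E \<le> DD V \<omega> E \<theta>"
proof (rule dense_le_bounded[of 0])
  fix d assume d: "0 < d" "d < Es - E"
  have "0 \<le> DD V \<omega> (E + d) \<theta>" using d by (intro DD_nonneg) auto
  moreover have "ff V \<omega> E \<theta> \<le> ff V \<omega> (E+d) \<theta>" "ff V (-\<omega>) E \<theta> \<le> ff V (-\<omega>) (E+d) \<theta>"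
    using d by (auto intro: ff_mono_E ff_mono_E')
  ultimately show "d \<le> DD V \<omega> E \<theta>" by (simp add: DD_def)
qed (use assms in auto)

lemma DD_pos: "E < Es \<Longrightarrow> 0 < DD V \<omega> E \<theta>"
  using DD_ge[of E \<theta>] by auto

lemma DD_le_DN: "E < Es \<Longrightarrow> DD V \<omega> E \<theta> \<le> DN V \<omega> E N \<theta>"
  using kf_le_ff[of E N \<theta>] kf_le_ff'[of E N \<theta>] by (simp add: DD_def DN_def)

lemma ff_denominator: "E < Es \<Longrightarrow> 0 < V \<theta> - E - ff V \<omega> E \<theta>"
  using DD_pos[of E \<theta>] ff_nonneg'[of E \<theta>] by (simp add: DD_def)

lemma ff_rec: assumes "E < Es" shows "ff V \<omega> E \<theta> = 1 / (V (\<theta> + \<omega>) - E - ff V \<omega> E (\<theta> + \<omega>))"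
proof (rule LIMSEQ_unique)
  show "(\<lambda>N. kf V \<omega> E (Suc N) \<theta>) \<longlonglongrightarrow> ff V \<omega> E \<theta>"
    using kf_tendsto[OF assms] by (rule LIMSEQ_Suc)
  show "(\<lambda>N. kf V \<omega> E (Suc N) \<theta>) \<longlonglongrightarrow> 1 / (V (\<theta> + \<omega>) - E - ff V \<omega> E (\<theta> + \<omega>))"
    unfolding kf_Suc using ff_denominator[OF assms, of "\<theta> + \<omega>"]
    by (intro tendsto_intros kf_tendsto assms) auto
qed

lemma ff_rec': assumes "E < Es" shows "ff V (-\<omega>) E \<theta> = 1 / (V (\<theta> - \<omega>) - E - ff V (-\<omega>) E (\<theta> - \<omega>))"
  using hill.ff_rec[OF hill_neg, of E \<theta>] assms by (simp add: Estar_neg)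

lemma ff_pos: "E < Es \<Longrightarrow> 0 < ff V \<omega> E \<theta>"
  using ff_rec[of E \<theta>] ff_denominator[of E "\<theta> + \<omega>"] by simp

lemma ff_pos': "E < Es \<Longrightarrow> 0 < ff V (-\<omega>) E \<theta>"
  using hill.ff_pos[OF hill_neg] by (simp add: Estar_neg)

abbreviation "Cb E \<equiv> V m + B0 - E"

lemma Cb_pos: "E < Es \<Longrightarrow> 0 < Cb E"
  using Es_le B0 by linarith

lemma ff_le: "E < Es \<Longrightarrow> ff V \<omega> E \<theta> \<le> Cb E"
  using ff_denominator[of E \<theta>] V_max[of \<theta>] by linarith

lemma ff_le': "E < Es \<Longrightarrow> ff V (-\<omega>) E \<theta> \<le> Cb E"
  using hill.ff_le[OF hill_neg] by (simp add: Estar_neg)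

lemma ff_ge: assumes "E < Es" shows "1 / Cb E \<le> ff V \<omega> E \<theta>"
proof -
  have "V (\<theta> + \<omega>) - E - ff V \<omega> E (\<theta> + \<omega>) \<le> Cb E"
    using ff_nonneg[OF assms, of "\<theta>+\<omega>"] V_max[of "\<theta>+\<omega>"] by linarith
  then show ?thesis
    unfolding ff_rec[OF assms, of \<theta>] using ff_denominator[OF assms, of "\<theta> + \<omega>"]
    by (intro divide_left_mono) auto
qed

lemma ff_ge': "E < Es \<Longrightarrow> 1 / Cb E \<le> ff V (-\<omega>) E \<theta>"
  using hill.ff_ge[OF hill_neg] by (simp add: Estar_neg)

lemma gg_pos: "E < Es \<Longrightarrow> 0 < gg V \<omega> E \<theta> k"
  unfolding gg_def by (intro prod_pos) (auto intro: ff_pos)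

lemma pp_nonneg: "E < Es \<Longrightarrow> 0 \<le> pp V \<omega> E N \<theta> k"
  unfolding pp_def by (intro cfprod_nonneg kf_cfpos)

lemma pp_le_gg: "E < Es \<Longrightarrow> pp V \<omega> E N \<theta> k \<le> gg V \<omega> E \<theta> k"
proof (induction k arbitrary: N \<theta>)
  case (Suc k)
  then show ?case unfolding pp_Suc gg_Suc
    by (intro mult_mono kf_le_ff Suc.IH ff_nonneg pp_nonneg) auto
qed (simp add: pp_0 gg_0)

lemma pp_tendsto: "E < Es \<Longrightarrow> (\<lambda>N. pp V \<omega> E N \<theta> k) \<longlonglongrightarrow> gg V \<omega> E \<theta> k"
proof (induction k arbitrary: \<theta>)
  case (Suc k)
  have "(\<lambda>N. pp V \<omega> E (N - 1) (\<theta> + \<omega>) k) \<longlonglongrightarrow> gg V \<omega> E (\<theta> + \<omega>) k"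
    using Suc.IH[OF Suc.prems, of "\<theta>+\<omega>"] by (subst filterlim_sequentially_Suc[symmetric]) simp
  then show ?case unfolding pp_Suc gg_Suc
    by (intro tendsto_mult kf_tendsto Suc.prems)
qed (simp add: pp_0 gg_0)

text \<open>The resolvent identity for cutting the bond beyond site \<open>N\<close>: the error is
  the infinite solution just outside times the truncated solution just inside.\<close>

lemma truncation_error:
  assumes "E < Es"
  shows "ff V \<omega> E \<theta> - kf V \<omega> E N \<theta> = gg V \<omega> E \<theta> (Suc N) * pp V \<omega> E N \<theta> N"
proof (induction N arbitrary: \<theta>)
  case 0
  then show ?case by (simp add: gg_Suc gg_0 kf_0 pp_0)
next
  case (Suc N)
  define x where "x = V (\<theta> + \<omega>) - E - ff V \<omega> E (\<theta> + \<omega>)"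
  define y where "y = V (\<theta> + \<omega>) - E - kf V \<omega> E N (\<theta> + \<omega>)"
  have xy: "x > 0" "y > 0"
    using ff_denominator[OF assms, of "\<theta>+\<omega>"] kf_le_ff[OF assms, of N "\<theta>+\<omega>"] by (auto simp: x_def y_def)
  have "ff V \<omega> E \<theta> - kf V \<omega> E (Suc N) \<theta> = (1/x) * (1/y) * (y - x)"
    using xy unfolding ff_rec[OF assms, of \<theta>] kf_Suc x_def[symmetric] y_def[symmetric]
    by (simp add: field_simps)
  also have "y - x = gg V \<omega> E (\<theta>+\<omega>) (Suc N) * pp V \<omega> E N (\<theta>+\<omega>) N"
    using Suc.IH[of "\<theta>+\<omega>"] by (simp add: x_def y_def)
  also have "1/x = ff V \<omega> E \<theta>" using ff_rec[OF assms, of \<theta>] by (simp add: x_def)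
  also have "1/y = kf V \<omega> E (Suc N) \<theta>" by (simp add: kf_Suc y_def)
  finally show ?case by (simp add: gg_Suc[of V \<omega> E \<theta> "Suc N"] pp_Suc)
qed

section \<open>Convexity in the coefficients, square summability and decay of the half-line
  solutions\<close>

lemma tangent_N:
  assumes "E < Es" "E' < Es"
  shows "kf V \<omega> E N \<theta> - (\<Sum>k<N. (pp V \<omega> E N \<theta> (Suc k))\<^sup>2 * (ap V \<omega> E' \<theta>' k - ap V \<omega> E \<theta> k)) \<le> kf V \<omega> E' N \<theta>'"
  unfolding kf_def pp_def using assms by (intro cf_tangent kf_cfpos)

text \<open>The sum is the slope in the energy of the tangent at \<open>E\<close>. The tangent stays
  below the fraction for all energies up to \<open>Es\<close>, and the fraction stays below V - E',
  so the slope cannot be steeper than this.\<close>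

lemma sum_pp_le:
  assumes "E < Es" shows "(\<Sum>k<N. (pp V \<omega> E N \<theta> (Suc k))\<^sup>2) * (Es - E) \<le> Cb E"
proof -
  define S where "S = (\<Sum>k<N. (pp V \<omega> E N \<theta> (Suc k))\<^sup>2)"
  have S0: "S \<ge> 0" by (auto simp: S_def intro: sum_nonneg)
  have "Es \<le> E + Cb E / S" if "S > 0"
  proof (rule dense_le_bounded[OF assms])
    fix E' assume E': "E < E'" "E' < Es"
    have "kf V \<omega> E N \<theta> - (\<Sum>k<N. (pp V \<omega> E N \<theta> (Suc k))\<^sup>2 * (ap V \<omega> E' \<theta> k - ap V \<omega> E \<theta> k)) \<le> kf V \<omega> E' N \<theta>"
      using tangent_N assms E' by blast
    also have "(\<Sum>k<N. (pp V \<omega> E N \<theta> (Suc k))\<^sup>2 * (ap V \<omega> E' \<theta> k - ap V \<omega> E \<theta> k)) = - ((E' - E) * S)"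
      unfolding S_def sum_distrib_left sum_negf[symmetric] by (intro sum.cong) (auto simp: ap_def algebra_simps)
    finally have "(E' - E) * S \<le> kf V \<omega> E' N \<theta>" using kf_nonneg[OF assms, of N \<theta>] by linarith
    also have "\<dots> \<le> Cb E" using kf_less[OF E'(2), of N \<theta>] V_max[of \<theta>] E' by linarith
    finally show "E' \<le> E + Cb E / S" using that by (simp add: field_simps)
  qed
  then have "S * (Es - E) \<le> Cb E" using S0 Cb_pos[OF assms] by (cases "S = 0") (auto simp: field_simps)
  then show ?thesis by (simp add: S_def)
qed

text \<open>Uniform bound for the squared norm of \<open>gg\<close>; the leading 1 is the site k =
  0.\<close>

definition "G E = 1 + Cb E / (Es - E)"

lemma G_gt: "E < Es \<Longrightarrow> 1 < G E"
  using Cb_pos[of E] by (simp add: G_def)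

lemma sum_gg_le:
  assumes "E < Es" shows "(\<Sum>k<n. (gg V \<omega> E \<theta> (Suc k))\<^sup>2) \<le> Cb E / (Es - E)"
proof (rule LIMSEQ_le_const2)
  show "(\<lambda>N. \<Sum>k<n. (pp V \<omega> E N \<theta> (Suc k))\<^sup>2) \<longlonglongrightarrow> (\<Sum>k<n. (gg V \<omega> E \<theta> (Suc k))\<^sup>2)"
    by (intro tendsto_sum tendsto_power pp_tendsto assms)
  have "(\<Sum>k<n. (pp V \<omega> E N \<theta> (Suc k))\<^sup>2) \<le> Cb E / (Es - E)" if "N \<ge> n" for N
  proof -
    have "(\<Sum>k<n. (pp V \<omega> E N \<theta> (Suc k))\<^sup>2) \<le> (\<Sum>k<N. (pp V \<omega> E N \<theta> (Suc k))\<^sup>2)"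
      using that by (intro sum_mono2) auto
    also have "\<dots> \<le> Cb E / (Es - E)" using sum_pp_le[OF assms, of N \<theta>] assms by (simp add: field_simps)
    finally show ?thesis .
  qed
  then show "\<exists>N. \<forall>M\<ge>N. (\<Sum>k<n. (pp V \<omega> E M \<theta> (Suc k))\<^sup>2) \<le> Cb E / (Es - E)" by blast
qed

lemma sum_gg0_le:
  assumes "E < Es" shows "(\<Sum>k<n. (gg V \<omega> E \<theta> k)\<^sup>2) \<le> G E"
proof (cases n)
  case 0
  then show ?thesis using G_gt[OF assms] by simp
next
  case (Suc n')
  have "(\<Sum>k<n. (gg V \<omega> E \<theta> k)\<^sup>2) = 1 + (\<Sum>k<n'. (gg V \<omega> E \<theta> (Suc k))\<^sup>2)"
    unfolding Suc sum.lessThan_Suc_shift by (simp add: gg_0)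
  then show ?thesis using sum_gg_le[OF assms, of \<theta> n'] by (simp add: G_def)
qed

lemma gg_summable: "E < Es \<Longrightarrow> summable (\<lambda>k. (gg V \<omega> E \<theta> k)\<^sup>2)"
  using sum_gg0_le[of E]
  by (intro bounded_imp_summable[of _ "G E"]) (auto simp: lessThan_Suc_atMost[symmetric] simp del: sum.lessThan_Suc)

lemma gg_suminf_le: "E < Es \<Longrightarrow> (\<Sum>k. (gg V \<omega> E \<theta> k)\<^sup>2) \<le> G E"
  using sum_gg0_le by (intro suminf_le_const gg_summable)

text \<open>The tail sums \<open>T j\<close> satisfy \<open>T j \<le> G (T j - T (Suc j))\<close>, which forces exponential decay.\<close>

lemma gg_decay:
  assumes "E < Es" shows "(gg V \<omega> E \<theta> k)\<^sup>2 \<le> G E * (1 - 1 / G E) ^ k"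
proof -
  define T where "T j = (\<Sum>k. (gg V \<omega> E \<theta> (k + j))\<^sup>2)" for j
  have sm: "summable (\<lambda>k. (gg V \<omega> E \<theta> (k + j))\<^sup>2)" for j
    using gg_summable[OF assms, of \<theta>] by (subst summable_iff_shift)
  have G: "G E > 1" using G_gt[OF assms] .
  have T1: "T j \<le> G E * (gg V \<omega> E \<theta> j)\<^sup>2" for j
  proof -
    have "T j = (gg V \<omega> E \<theta> j)\<^sup>2 * (\<Sum>k. (gg V \<omega> E (\<theta> + \<omega> * real j) k)\<^sup>2)"
      unfolding T_def
      by (subst suminf_mult[symmetric]) (auto simp: add.commute[of _ j] gg_add power_mult_distrib intro: gg_summable assms)
    also have "\<dots> \<le> (gg V \<omega> E \<theta> j)\<^sup>2 * G E"
      using gg_suminf_le[OF assms] by (intro mult_left_mono) auto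
    finally show ?thesis by (simp add: mult.commute)
  qed
  have T2: "T j = (gg V \<omega> E \<theta> j)\<^sup>2 + T (Suc j)" for j
    unfolding T_def using suminf_split_head[OF sm[of j]] by simp
  have T3: "T (Suc j) \<le> (1 - 1 / G E) * T j" for j
    using T1[of j] T2[of j] G by (simp add: field_simps)
  have q: "0 \<le> 1 - 1 / G E" using G by simp
  have T4: "T k \<le> (1 - 1 / G E) ^ k * T 0" for k
  proof (induction k)
    case (Suc k)
    have "T (Suc k) \<le> (1 - 1 / G E) * T k" by (rule T3)
    also have "\<dots> \<le> (1 - 1 / G E) * ((1 - 1 / G E) ^ k * T 0)" using Suc q by (intro mult_left_mono)
    finally show ?case by simp
  qed auto
  have "0 \<le> T (Suc k)" unfolding T_def by (intro suminf_nonneg sm) auto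
  then have "(gg V \<omega> E \<theta> k)\<^sup>2 \<le> T k" using T2[of k] by simp
  also have "\<dots> \<le> (1 - 1 / G E) ^ k * T 0" by (rule T4)
  also have "\<dots> \<le> (1 - 1 / G E) ^ k * G E"
    using gg_suminf_le[OF assms, of \<theta>] q by (intro mult_left_mono) (auto simp: T_def)
  finally show ?thesis by (simp add: mult.commute)
qed

text \<open>Dominated convergence: extended by zero beyond \<open>N\<close>, the truncated weights
  are dominated by their limits.\<close>

lemma weighted_tendsto:
  assumes "E < Es" "\<And>k. \<bar>c k\<bar> \<le> \<beta>"
  shows "(\<lambda>N. \<Sum>k<N. (pp V \<omega> E N \<theta> (Suc k))\<^sup>2 * c k) \<longlonglongrightarrow> (\<Sum>k. (gg V \<omega> E \<theta> (Suc k))\<^sup>2 * c k)"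
proof -
  define t where "t N k = (if k < N then (pp V \<omega> E N \<theta> (Suc k))\<^sup>2 * c k else 0)" for N k
  have b: "\<bar>t N k\<bar> \<le> (gg V \<omega> E \<theta> (Suc k))\<^sup>2 * \<beta>" for N k
  proof -
    have "\<beta> \<ge> 0" using assms(2)[of 0] by simp
    then show ?thesis unfolding t_def using assms(2)[of k] pp_le_gg[OF assms(1), of N \<theta> "Suc k"] pp_nonneg[OF assms(1), of N \<theta> "Suc k"]
      by (auto simp: abs_mult intro!: mult_mono power_mono)
  qed
  have "summable (\<lambda>k. (gg V \<omega> E \<theta> (Suc k))\<^sup>2 * \<beta>)"
    using gg_summable[OF assms(1), of \<theta>] by (intro summable_mult2) (subst summable_Suc_iff)
  moreover have "(\<lambda>N. t N k) \<longlonglongrightarrow> (gg V \<omega> E \<theta> (Suc k))\<^sup>2 * c k" for k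
  proof (rule Lim_transform_eventually)
    show "(\<lambda>N. (pp V \<omega> E N \<theta> (Suc k))\<^sup>2 * c k) \<longlonglongrightarrow> (gg V \<omega> E \<theta> (Suc k))\<^sup>2 * c k"
      by (intro tendsto_intros pp_tendsto assms)
    show "\<forall>\<^sub>F N in sequentially. (pp V \<omega> E N \<theta> (Suc k))\<^sup>2 * c k = t N k"
      using eventually_gt_at_top[of k] by eventually_elim (auto simp: t_def)
  qed
  moreover have "\<forall>\<^sub>F (k, N) in at_top \<times>\<^sub>F sequentially. norm (t N k) \<le> (gg V \<omega> E \<theta> (Suc k))\<^sup>2 * \<beta>"
    using b by (intro always_eventually) auto
  ultimately have "(\<lambda>N. suminf (t N)) \<longlonglongrightarrow> (\<Sum>k. (gg V \<omega> E \<theta> (Suc k))\<^sup>2 * c k)"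
    using tannerys_theorem[of "\<lambda>k N. t N k" "\<lambda>k. (gg V \<omega> E \<theta> (Suc k))\<^sup>2 * c k" sequentially
      "\<lambda>k. (gg V \<omega> E \<theta> (Suc k))\<^sup>2 * \<beta>"] by simp
  moreover have "suminf (t N) = (\<Sum>k<N. (pp V \<omega> E N \<theta> (Suc k))\<^sup>2 * c k)" for N
    by (subst suminf_finite[of "{..<N}"]) (auto simp: t_def)
  ultimately show ?thesis by simp
qed

lemma tangent_inf:
  assumes "E < Es" "E' < Es" "\<And>k. \<bar>ap V \<omega> E' \<theta>' k - ap V \<omega> E \<theta> k\<bar> \<le> \<beta>"
  shows "ff V \<omega> E \<theta> - (\<Sum>k. (gg V \<omega> E \<theta> (Suc k))\<^sup>2 * (ap V \<omega> E' \<theta>' k - ap V \<omega> E \<theta> k)) \<le> ff V \<omega> E' \<theta>'"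
proof (rule LIMSEQ_le)
  show "(\<lambda>N. kf V \<omega> E N \<theta> - (\<Sum>k<N. (pp V \<omega> E N \<theta> (Suc k))\<^sup>2 * (ap V \<omega> E' \<theta>' k - ap V \<omega> E \<theta> k))) \<longlonglongrightarrow> ff V \<omega> E \<theta> - (\<Sum>k. (gg V \<omega> E \<theta> (Suc k))\<^sup>2 * (ap V \<omega> E' \<theta>' k - ap V \<omega> E \<theta> k))"
    by (intro tendsto_diff kf_tendsto weighted_tendsto[OF assms(1,3)] assms)
  show "(\<lambda>N. kf V \<omega> E' N \<theta>') \<longlonglongrightarrow> ff V \<omega> E' \<theta>'" by (intro kf_tendsto assms)
  show "\<exists>N. \<forall>n\<ge>N. kf V \<omega> E n \<theta> - (\<Sum>k<n. (pp V \<omega> E n \<theta> (Suc k))\<^sup>2 * (ap V \<omega> E' \<theta>' k - ap V \<omega> E \<theta> k)) \<le> kf V \<omega> E' n \<theta>'"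
    using tangent_N[OF assms(1,2)] by blast
qed

end

section \<open>Smoothness in the phase\<close>

context hill begin

lemma kf_int: "kf V \<omega> E N (\<theta> + of_int j) = kf V \<omega> E N \<theta>"
proof -
  have "ap V \<omega> E (\<theta> + of_int j) = ap V \<omega> E \<theta>"
  proof
    fix n
    have "V (\<theta> + \<omega> * real (Suc n) + of_int j) = V (\<theta> + \<omega> * real (Suc n))" by (rule V_int)
    then show "ap V \<omega> E (\<theta> + of_int j) n = ap V \<omega> E \<theta> n" by (simp add: ap_def algebra_simps)
  qed
  then show ?thesis by (simp add: kf_def)
qed

lemma pp_int: "pp V \<omega> E N (\<theta> + of_int j) k = pp V \<omega> E N \<theta> k"
proof (induction k arbitrary: N \<theta>)
  case (Suc k)
  then show ?case using Suc[of "N-1" "\<theta>+\<omega>"] by (simp add: pp_Suc kf_int algebra_simps)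
qed (simp add: pp_0)

lemma ff_int: "ff V \<omega> E (\<theta> + of_int j) = ff V \<omega> E \<theta>"
  by (simp add: ff_def kf_int)

lemma ff_int': "ff V (-\<omega>) E (\<theta> + of_int j) = ff V (-\<omega>) E \<theta>"
  by (rule hill.ff_int[OF hill_neg])

lemma DD_int: "DD V \<omega> E (\<theta> + of_int j) = DD V \<omega> E \<theta>"
  by (simp add: DD_def ff_int ff_int' V_int)

lemma DN_int: "DN V \<omega> E N (\<theta> + of_int j) = DN V \<omega> E N \<theta>"
  by (simp add: DN_def kf_int hill.kf_int[OF hill_neg] V_int)

lemma gg_Suc_summable: "E < Es \<Longrightarrow> summable (\<lambda>k. (gg V \<omega> E \<theta> (Suc k))\<^sup>2)"
  using gg_summable[of E \<theta>] by (subst summable_Suc_iff)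

lemma gg_Suc_suminf_le: "E < Es \<Longrightarrow> (\<Sum>k. (gg V \<omega> E \<theta> (Suc k))\<^sup>2) \<le> G E"
  using sum_gg_le[of E \<theta>] unfolding G_def
  by (intro suminf_le_const gg_Suc_summable) (auto intro: order_trans[of _ "Cb E / (Es - E)"])

lemma gg_weighted:
  assumes "E < Es" "\<And>k. \<bar>c k\<bar> \<le> \<beta>"
  shows "summable (\<lambda>k. (gg V \<omega> E \<theta> (Suc k))\<^sup>2 * c k)"
    and "\<bar>\<Sum>k. (gg V \<omega> E \<theta> (Suc k))\<^sup>2 * c k\<bar> \<le> G E * \<beta>"
proof -
  have b: "\<beta> \<ge> 0" using assms(2)[of 0] by simp
  have s: "summable (\<lambda>k. (gg V \<omega> E \<theta> (Suc k))\<^sup>2 * \<beta>)"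
    by (intro summable_mult2 gg_Suc_summable assms)
  have n: "norm ((gg V \<omega> E \<theta> (Suc k))\<^sup>2 * c k) \<le> (gg V \<omega> E \<theta> (Suc k))\<^sup>2 * \<beta>" for k
    using assms(2)[of k] by (auto simp: abs_mult intro!: mult_left_mono)
  show "summable (\<lambda>k. (gg V \<omega> E \<theta> (Suc k))\<^sup>2 * c k)"
    by (rule summable_comparison_test'[OF s n])
  have "\<bar>\<Sum>k. (gg V \<omega> E \<theta> (Suc k))\<^sup>2 * c k\<bar> \<le> (\<Sum>k. (gg V \<omega> E \<theta> (Suc k))\<^sup>2 * \<beta>)"
    using norm_suminf_le[of "\<lambda>k. (gg V \<omega> E \<theta> (Suc k))\<^sup>2 * c k", OF n s] by simp
  also have "\<dots> = (\<Sum>k. (gg V \<omega> E \<theta> (Suc k))\<^sup>2) * \<beta>"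
    using suminf_mult2[OF gg_Suc_summable[OF assms(1)], of \<theta> \<beta>] by simp
  also have "\<dots> \<le> G E * \<beta>" using gg_Suc_suminf_le[OF assms(1)] b by (intro mult_right_mono)
  finally show "\<bar>\<Sum>k. (gg V \<omega> E \<theta> (Suc k))\<^sup>2 * c k\<bar> \<le> G E * \<beta>" .
qed

lemma ap_diff_le: "\<bar>ap V \<omega> E \<theta>' k - ap V \<omega> E \<theta> k\<bar> \<le> B1 * \<bar>\<theta>' - \<theta>\<bar>"
  using V_lipschitz[of "\<theta>' + \<omega> * real (Suc k)" "\<theta> + \<omega> * real (Suc k)"] by (simp add: ap_def)

lemma ff_lipschitz: assumes "E < Es" shows "\<bar>ff V \<omega> E \<theta>' - ff V \<omega> E \<theta>\<bar> \<le> G E * B1 * \<bar>\<theta>' - \<theta>\<bar>"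
proof -
  have "ff V \<omega> E \<theta> - ff V \<omega> E \<theta>' \<le> G E * B1 * \<bar>\<theta>' - \<theta>\<bar>" for \<theta> \<theta>'
    using tangent_inf[OF assms assms, OF ap_diff_le, of \<theta> \<theta>']
      gg_weighted(2)[OF assms, of "\<lambda>k. ap V \<omega> E \<theta>' k - ap V \<omega> E \<theta> k", OF ap_diff_le, of \<theta>] by (simp add: mult.assoc)
  from this[of \<theta> \<theta>'] this[of \<theta>' \<theta>] show ?thesis by (simp add: abs_minus_commute abs_le_iff)
qed

lemma ff_cont: assumes "E < Es" shows "continuous_on UNIV (ff V \<omega> E)"
proof (rule lipschitz_on_continuous_on)
  show "(G E * B1)-lipschitz_on UNIV (ff V \<omega> E)"
    using ff_lipschitz[OF assms] G_gt[OF assms] B1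
    by (intro lipschitz_onI) (auto simp: dist_real_def abs_minus_commute)
qed

lemma DD_cont: assumes "E < Es" shows "continuous_on UNIV (DD V \<omega> E)"
  unfolding DD_def using ff_cont[OF assms] hill.ff_cont[OF hill_neg, of E] assms V_cont
  by (intro continuous_intros) (auto simp: Estar_neg)

lemma gg_cont: assumes "E < Es" shows "continuous_on UNIV (\<lambda>\<theta>. gg V \<omega> E \<theta> k)"
  unfolding gg_def
  by (intro continuous_on_prod continuous_on_compose2[OF ff_cont[OF assms]] continuous_intros) auto

text \<open>First-order perturbation theory: the derivative of the fraction in its k-th coefficient
  is minus the square of \<open>gg\<close> at k + 1, and this coefficient moves at speed V'.\<close>

definition "Fd E \<theta> = - (\<Sum>k. (gg V \<omega> E \<theta> (Suc k))\<^sup>2 * V' (\<theta> + \<omega> * real (Suc k)))"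

lemma summable_majorant: "E < Es \<Longrightarrow> summable (\<lambda>k. G E * (1 - 1 / G E) ^ Suc k * B1)"
  using G_gt[of E] by (intro summable_mult2 summable_mult) (auto simp del: power_Suc simp: summable_Suc_iff)

lemma gg_majorant:
  assumes "E < Es" "\<bar>c\<bar> \<le> B1" shows "\<bar>(gg V \<omega> E \<theta> (Suc k))\<^sup>2 * c\<bar> \<le> G E * (1 - 1 / G E) ^ Suc k * B1"
  using gg_decay[OF assms(1), of \<theta> "Suc k"] assms(2) G_gt[OF assms(1)]
  unfolding abs_mult by (intro mult_mono) auto

lemma Fd_cont: assumes "E < Es" shows "continuous_on UNIV (Fd E)"
  unfolding Fd_def
proof (rule continuous_on_minus[OF continuous_on_suminf_M])
  show "continuous_on UNIV (\<lambda>\<theta>. (gg V \<omega> E \<theta> (Suc k))\<^sup>2 * V' (\<theta> + \<omega> * real (Suc k)))" for k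
    by (intro continuous_intros gg_cont assms continuous_on_compose2[OF V'_cont]) auto
qed (use gg_majorant[OF assms V'_bound] summable_majorant[OF assms] in blast)+

text \<open>Convexity replaces differentiation of the limit: tangent inequalities at \<theta> and at
  \<theta> + h enclose the increment, and the two bounds agree to first order because the weights
  are continuous in the phase.\<close>

lemma ff_deriv:
  assumes "E < Es" shows "(ff V \<omega> E has_real_derivative Fd E \<theta>) (at \<theta>)"
proof -
  \<comment> \<open>Only the weights move with \<eta>, the slopes V' stay at \<theta>; both tangents
    are then values of one continuous function.\<close>
  define A where "A \<eta> = (\<Sum>k. (gg V \<omega> E \<eta> (Suc k))\<^sup>2 * V' (\<theta> + \<omega> * real (Suc k)))" for \<eta>
  have Acont: "continuous_on UNIV A"
    unfolding A_def
  proof (rule continuous_on_suminf_M)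
    show "continuous_on UNIV (\<lambda>\<eta>. (gg V \<omega> E \<eta> (Suc k))\<^sup>2 * V' (\<theta> + \<omega> * real (Suc k)))" for k
      by (intro continuous_intros gg_cont assms)
  qed (use gg_majorant[OF assms V'_bound] summable_majorant[OF assms] in blast)+
  have FA: "Fd E \<theta> = - A \<theta>" by (simp add: Fd_def A_def)
  have key: "\<bar>(\<Sum>k. (gg V \<omega> E \<eta> (Suc k))\<^sup>2 * (ap V \<omega> E (\<theta>+h) k - ap V \<omega> E \<theta> k)) - h * A \<eta>\<bar> \<le> G E * (B2 * h\<^sup>2)" for \<eta> h
  proof -
    let ?c = "\<lambda>k. ap V \<omega> E (\<theta>+h) k - ap V \<omega> E \<theta> k"
    have s1: "summable (\<lambda>k. (gg V \<omega> E \<eta> (Suc k))\<^sup>2 * ?c k)"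
      using ap_diff_le by (rule gg_weighted(1)[OF assms])
    have s2: "summable (\<lambda>k. (gg V \<omega> E \<eta> (Suc k))\<^sup>2 * V' (\<theta> + \<omega> * real (Suc k)))"
      using V'_bound by (rule gg_weighted(1)[OF assms])
    have "(\<Sum>k. (gg V \<omega> E \<eta> (Suc k))\<^sup>2 * ?c k) - h * A \<eta>
        = (\<Sum>k. (gg V \<omega> E \<eta> (Suc k))\<^sup>2 * ?c k - h * ((gg V \<omega> E \<eta> (Suc k))\<^sup>2 * V' (\<theta> + \<omega> * real (Suc k))))"
      unfolding A_def using suminf_diff[OF s1 summable_mult[OF s2, of h]] suminf_mult[OF s2, of h] by simp
    also have "\<dots> = (\<Sum>k. (gg V \<omega> E \<eta> (Suc k))\<^sup>2 * (?c k - h * V' (\<theta> + \<omega> * real (Suc k))))"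
      by (simp add: algebra_simps)
    also have "\<bar>\<dots>\<bar> \<le> G E * (B2 * h\<^sup>2)"
    proof (rule gg_weighted(2)[OF assms])
      fix k
      have e: "\<theta> + h + \<omega> * real (Suc k) = \<theta> + \<omega> * real (Suc k) + h" by simp
      show "\<bar>?c k - h * V' (\<theta> + \<omega> * real (Suc k))\<bar> \<le> B2 * h\<^sup>2"
        using V_taylor[of "\<theta> + \<omega> * real (Suc k)" h] unfolding ap_def e by simp
    qed
    finally show ?thesis .
  qed
  have lo: "ff V \<omega> E (\<theta>+h) - ff V \<omega> E \<theta> \<ge> - h * A \<theta> - G E * (B2 * h\<^sup>2)" for h
    using tangent_inf[OF assms assms, OF ap_diff_le, of \<theta> "\<theta>+h"] key[of \<theta> h] by (simp add: abs_le_iff)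
  have up: "ff V \<omega> E (\<theta>+h) - ff V \<omega> E \<theta> \<le> - h * A (\<theta>+h) + G E * (B2 * h\<^sup>2)" for h
  proof -
    have "(\<Sum>k. (gg V \<omega> E (\<theta>+h) (Suc k))\<^sup>2 * (ap V \<omega> E \<theta> k - ap V \<omega> E (\<theta>+h) k))
       = - (\<Sum>k. (gg V \<omega> E (\<theta>+h) (Suc k))\<^sup>2 * (ap V \<omega> E (\<theta>+h) k - ap V \<omega> E \<theta> k))"
      using suminf_minus[OF gg_weighted(1)[OF assms, of "\<lambda>k. ap V \<omega> E (\<theta>+h) k - ap V \<omega> E \<theta> k", OF ap_diff_le, of "\<theta>+h"]] by (simp add: algebra_simps)
    then show ?thesis
      using tangent_inf[OF assms assms, OF ap_diff_le, of "\<theta>+h" \<theta>] key[of "\<theta>+h" h] by (simp add: abs_le_iff)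
  qed
  have "(\<lambda>h. (ff V \<omega> E (\<theta>+h) - ff V \<omega> E \<theta>) / h) \<midarrow>0\<rightarrow> - A \<theta>"
  proof (rule tendsto_sandwich[where f="\<lambda>h. - A \<theta> - \<bar>A (\<theta>+h) - A \<theta>\<bar> - G E * B2 * \<bar>h\<bar>"
        and h="\<lambda>h. - A \<theta> + \<bar>A (\<theta>+h) - A \<theta>\<bar> + G E * B2 * \<bar>h\<bar>"])
    have Al: "(\<lambda>h. A (\<theta> + h)) \<midarrow>0\<rightarrow> A \<theta>"
      using Acont by (simp add: continuous_on_eq_continuous_at isCont_def LIM_offset_zero)
    have "(\<lambda>h. - A \<theta> - \<bar>A (\<theta>+h) - A \<theta>\<bar> - G E * B2 * \<bar>h\<bar>) \<midarrow>0\<rightarrow> - A \<theta> - \<bar>A \<theta> - A \<theta>\<bar> - G E * B2 * \<bar>0\<bar>"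
      by (intro tendsto_intros Al)
    then show "(\<lambda>h. - A \<theta> - \<bar>A (\<theta>+h) - A \<theta>\<bar> - G E * B2 * \<bar>h\<bar>) \<midarrow>0\<rightarrow> - A \<theta>" by simp
    have "(\<lambda>h. - A \<theta> + \<bar>A (\<theta>+h) - A \<theta>\<bar> + G E * B2 * \<bar>h\<bar>) \<midarrow>0\<rightarrow> - A \<theta> + \<bar>A \<theta> - A \<theta>\<bar> + G E * B2 * \<bar>0\<bar>"
      by (intro tendsto_intros Al)
    then show "(\<lambda>h. - A \<theta> + \<bar>A (\<theta>+h) - A \<theta>\<bar> + G E * B2 * \<bar>h\<bar>) \<midarrow>0\<rightarrow> - A \<theta>" by simp
    have dif: "\<bar>ff V \<omega> E (\<theta>+h) - ff V \<omega> E \<theta> - h * (- A \<theta>)\<bar> \<le> \<bar>h\<bar> * (\<bar>A (\<theta>+h) - A \<theta>\<bar> + G E * B2 * \<bar>h\<bar>)" for h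
    proof -
      have h2: "G E * (B2 * h\<^sup>2) = \<bar>h\<bar> * (G E * B2 * \<bar>h\<bar>)" 
        unfolding power2_eq_square abs_mult_self_eq[of h, symmetric] by (simp only: ac_simps)
      have "- h * A (\<theta>+h) + h * A \<theta> = - (h * (A (\<theta>+h) - A \<theta>))" by (simp add: algebra_simps)
      also have "\<dots> \<le> \<bar>h\<bar> * \<bar>A (\<theta>+h) - A \<theta>\<bar>" by (metis abs_ge_minus_self abs_mult)
      finally have "- h * A (\<theta>+h) + h * A \<theta> \<le> \<bar>h\<bar> * \<bar>A (\<theta>+h) - A \<theta>\<bar>" .
      moreover have "0 \<le> \<bar>h\<bar> * \<bar>A (\<theta>+h) - A \<theta>\<bar>" by simp
      ultimately show ?thesis using lo[of h] up[of h]
        unfolding h2 abs_le_iff distrib_left mult_minus_left mult_minus_right by linarith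
    qed
    have dif': "\<bar>(ff V \<omega> E (\<theta>+h) - ff V \<omega> E \<theta>) / h - (- A \<theta>)\<bar> \<le> \<bar>A (\<theta>+h) - A \<theta>\<bar> + G E * B2 * \<bar>h\<bar>" if "h \<noteq> 0" for h
    proof -
      have "\<bar>(ff V \<omega> E (\<theta>+h) - ff V \<omega> E \<theta>) / h - (- A \<theta>)\<bar> = \<bar>ff V \<omega> E (\<theta>+h) - ff V \<omega> E \<theta> - h * (- A \<theta>)\<bar> / \<bar>h\<bar>"
        unfolding abs_divide[symmetric] using that by (intro arg_cong[where f=abs]) (simp add: field_simps)
      also have "\<dots> \<le> (\<bar>h\<bar> * (\<bar>A (\<theta>+h) - A \<theta>\<bar> + G E * B2 * \<bar>h\<bar>)) / \<bar>h\<bar>"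
        by (intro divide_right_mono dif) auto
      finally show ?thesis using that by simp
    qed
    show "\<forall>\<^sub>F h in at 0. - A \<theta> - \<bar>A (\<theta>+h) - A \<theta>\<bar> - G E * B2 * \<bar>h\<bar> \<le> (ff V \<omega> E (\<theta>+h) - ff V \<omega> E \<theta>) / h"
      unfolding eventually_at_filter
    proof (intro always_eventually allI impI)
      fix h :: real assume "h \<noteq> 0" from dif'[OF this]
      show "- A \<theta> - \<bar>A (\<theta>+h) - A \<theta>\<bar> - G E * B2 * \<bar>h\<bar> \<le> (ff V \<omega> E (\<theta>+h) - ff V \<omega> E \<theta>) / h" by linarith
    qed
    show "\<forall>\<^sub>F h in at 0. (ff V \<omega> E (\<theta>+h) - ff V \<omega> E \<theta>) / h \<le> - A \<theta> + \<bar>A (\<theta>+h) - A \<theta>\<bar> + G E * B2 * \<bar>h\<bar>"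
      unfolding eventually_at_filter
    proof (intro always_eventually allI impI)
      fix h :: real assume "h \<noteq> 0" from dif'[OF this]
      show "(ff V \<omega> E (\<theta>+h) - ff V \<omega> E \<theta>) / h \<le> - A \<theta> + \<bar>A (\<theta>+h) - A \<theta>\<bar> + G E * B2 * \<bar>h\<bar>" by linarith
    qed
  qed
  then show ?thesis by (simp add: DERIV_def FA)
qed

text \<open>By convexity \<open>s * f' \<le> f[V + s V']\<close>, and \<open>V + s V'\<close> dominates the translate of \<open>V\<close> by \<open>s\<close>
  up to \<open>B2 s\<^sup>2\<close>, so it stays below threshold as long as \<open>B2 s\<^sup>2 < Es - E\<close>.\<close>

lemma Fd_bound:
  assumes "E < Es" shows "\<bar>Fd E \<theta>\<bar> \<le> Cb E * sqrt (2 * B2) / sqrt (Es - E)"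
proof -
  \<comment> \<open>With this \<open>s\<close>, the error B2 s^2 is half the distance to the
    threshold, and \<open>E'\<close> below is the midpoint of \<open>E\<close> and
    \<open>Es\<close>.\<close>
  define s where "s = sqrt ((Es - E) / (2 * B2))"
  have s: "s > 0" using assms B2 by (simp add: s_def)
  have s2: "B2 * s\<^sup>2 = (Es - E) / 2" using assms B2 by (simp add: s_def)
  define E' where "E' = E + B2 * s\<^sup>2"
  have E': "E' < Es" "E < E'" using assms s2 by (auto simp: E'_def field_simps)
  have main: "\<tau> * Fd E \<theta> \<le> Cb E" if \<tau>: "\<bar>\<tau>\<bar> = s" for \<tau>
  proof -
    define b where "b k = ap V \<omega> E \<theta> k + \<tau> * V' (\<theta> + \<omega> * real (Suc k))" for k
    have *: "kf V \<omega> E N \<theta> - (\<Sum>k<N. (pp V \<omega> E N \<theta> (Suc k))\<^sup>2 * (\<tau> * V' (\<theta> + \<omega> * real (Suc k)))) \<le> Cb E" for N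
    proof -
      have pos: "cfpos N (ap V \<omega> E' (\<theta>+\<tau>))" using kf_cfpos E' by blast
      have "ap V \<omega> E' (\<theta>+\<tau>) k \<le> b k" for k
      proof -
        have e: "\<theta> + \<tau> + \<omega> * real (Suc k) = \<theta> + \<omega> * real (Suc k) + \<tau>" by simp
        have "\<tau>\<^sup>2 = s\<^sup>2" using \<tau> by (metis power2_abs)
        then show ?thesis
          using V_taylor[of "\<theta> + \<omega> * real (Suc k)" \<tau>] unfolding b_def ap_def E'_def e by (simp add: abs_le_iff)
      qed
      then have b: "cfpos N b" "cf N b \<le> kf V \<omega> E' N (\<theta>+\<tau>)"
        using cf_antimono[OF pos, of b] by (auto simp: kf_def)
      have "cf N (ap V \<omega> E \<theta>) - (\<Sum>k<N. (cfprod N (ap V \<omega> E \<theta>) (Suc k))\<^sup>2 * (b k - ap V \<omega> E \<theta> k)) \<le> cf N b"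
        by (intro cf_tangent kf_cfpos assms b)
      also note b(2)
      also have "kf V \<omega> E' N (\<theta>+\<tau>) \<le> Cb E"
        using kf_less[OF E'(1), of N "\<theta>+\<tau>"] V_max[of "\<theta>+\<tau>"] E' by linarith
      finally show ?thesis by (simp add: b_def pp_def kf_def)
    qed
    have bd: "\<bar>\<tau> * V' (\<theta> + \<omega> * real (Suc k))\<bar> \<le> \<bar>\<tau>\<bar> * B1" for k
      using V'_bound by (auto simp: abs_mult intro!: mult_left_mono)
    have "ff V \<omega> E \<theta> - (\<Sum>k. (gg V \<omega> E \<theta> (Suc k))\<^sup>2 * (\<tau> * V' (\<theta> + \<omega> * real (Suc k)))) \<le> Cb E"
      using * by (intro LIMSEQ_le_const2[OF tendsto_diff[OF kf_tendsto[OF assms] weighted_tendsto[OF assms bd]]]) auto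
    moreover have "(\<Sum>k. (gg V \<omega> E \<theta> (Suc k))\<^sup>2 * (\<tau> * V' (\<theta> + \<omega> * real (Suc k)))) = - (\<tau> * Fd E \<theta>)"
      using suminf_mult[OF gg_weighted(1)[OF assms V'_bound], of \<tau> \<theta> "\<lambda>k. \<theta> + \<omega> * real (Suc k)"]
      by (simp add: Fd_def algebra_simps)
    ultimately show ?thesis using ff_nonneg[OF assms, of \<theta>] by linarith
  qed
  have "s * \<bar>Fd E \<theta>\<bar> \<le> Cb E" using main[of s] main[of "-s"] s by (auto simp: abs_if)
  then have "\<bar>Fd E \<theta>\<bar> \<le> Cb E / s" using s by (simp add: field_simps)
  also have "\<dots> = Cb E * sqrt (2 * B2) / sqrt (Es - E)" by (simp add: s_def real_sqrt_divide)
  finally show ?thesis .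
qed

end

section \<open>The separation of the invariant graphs\<close>

context hill begin

lemma ff_left_shift: "E < Es \<Longrightarrow> ff V (-\<omega>) E (\<theta> + \<omega>) = 1 / (V \<theta> - E - ff V (-\<omega>) E \<theta>)"
  using ff_rec'[of E "\<theta>+\<omega>"] by simp

lemma DD_eq_left: "E < Es \<Longrightarrow> DD V \<omega> E \<theta> = 1 / ff V (-\<omega>) E (\<theta> + \<omega>) - ff V \<omega> E \<theta>"
  by (simp add: ff_left_shift DD_def)

lemma DD_eq_right: "E < Es \<Longrightarrow> DD V \<omega> E (\<theta> + \<omega>) = 1 / ff V \<omega> E \<theta> - ff V (-\<omega>) E (\<theta> + \<omega>)"
  by (simp add: ff_rec[of E \<theta>] DD_def)

text \<open>Symmetry of the resolvent: divided by both values of D, the two sides are the entry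
  between \<theta> and \<theta> + \<omega>, computed from either end.\<close>

lemma DD_step:
  assumes "E < Es"
  shows "DD V \<omega> E (\<theta> + \<omega>) * ff V \<omega> E \<theta> = DD V \<omega> E \<theta> * ff V (-\<omega>) E (\<theta> + \<omega>)"
  using ff_pos[OF assms, of \<theta>] ff_pos'[OF assms, of "\<theta>+\<omega>"]
  unfolding DD_eq_left[OF assms, of \<theta>] DD_eq_right[OF assms, of \<theta>] by (simp add: field_simps)

lemma ff_ff_less: assumes "E < Es" shows "ff V \<omega> E \<theta> * ff V (-\<omega>) E (\<theta> + \<omega>) < 1"
  using DD_pos[OF assms, of \<theta>] ff_pos'[OF assms, of "\<theta>+\<omega>"]
  unfolding DD_eq_left[OF assms, of \<theta>] by (simp add: field_simps)

text \<open>The Cauchy-Schwarz inequality for resolvent entries: the diagonal ones are the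
  reciprocals of D, the off-diagonal one is \<open>gg\<close> divided by D at \<theta>. Site by site
  it reduces to \<open>ff_ff_less\<close>.\<close>

lemma gg_sq_DD:
  assumes "E < Es" shows "(gg V \<omega> E \<theta> k)\<^sup>2 * DD V \<omega> E (\<theta> + \<omega> * real k) \<le> DD V \<omega> E \<theta>"
proof (induction k)
  case (Suc k)
  let ?f = "ff V \<omega> E (\<theta> + \<omega> * real k)" and ?D = "DD V \<omega> E (\<theta> + \<omega> * real k)"
  have e: "\<theta> + \<omega> * real (Suc k) = \<theta> + \<omega> * real k + \<omega>" by (simp add: algebra_simps)
  have "(gg V \<omega> E \<theta> (Suc k))\<^sup>2 * DD V \<omega> E (\<theta> + \<omega> * real (Suc k))
      = (gg V \<omega> E \<theta> k)\<^sup>2 * ?f * (DD V \<omega> E (\<theta> + \<omega> * real k + \<omega>) * ?f)"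
    unfolding gg_Suc' e by (simp add: power2_eq_square)
  also have "\<dots> = ((gg V \<omega> E \<theta> k)\<^sup>2 * ?D) * (?f * ff V (-\<omega>) E (\<theta> + \<omega> * real k + \<omega>))"
    unfolding DD_step[OF assms] by simp
  also have "\<dots> \<le> ((gg V \<omega> E \<theta> k)\<^sup>2 * ?D) * 1"
    using ff_ff_less[OF assms, of "\<theta> + \<omega> * real k"] DD_nonneg[OF assms, of "\<theta> + \<omega> * real k"]
    by (intro mult_left_mono) auto
  finally show ?case using Suc by simp
qed (simp add: gg_0)

lemma gg_le_1:
  assumes "E < Es" "\<And>\<eta>. DD V \<omega> E \<theta> \<le> DD V \<omega> E \<eta>" shows "gg V \<omega> E \<theta> k \<le> 1"
proof -
  have "(gg V \<omega> E \<theta> k)\<^sup>2 * DD V \<omega> E \<theta> \<le> (gg V \<omega> E \<theta> k)\<^sup>2 * DD V \<omega> E (\<theta> + \<omega> * real k)"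
    using assms(2) by (intro mult_left_mono) auto
  also have "\<dots> \<le> DD V \<omega> E \<theta>" by (rule gg_sq_DD[OF assms(1)])
  finally have "(gg V \<omega> E \<theta> k)\<^sup>2 \<le> 1" using DD_pos[OF assms(1), of \<theta>] by simp
  then show ?thesis using power2_le_imp_le[of "gg V \<omega> E \<theta> k" 1] by simp
qed

lemma gg_rec:
  assumes "E < Es"
  shows "(V (\<theta> + \<omega> * real (Suc n)) - E) * gg V \<omega> E \<theta> (Suc n) = gg V \<omega> E \<theta> (Suc (Suc n)) + gg V \<omega> E \<theta> n"
proof -
  let ?t = "\<theta> + \<omega> * real n"
  have e: "\<theta> + \<omega> * real (Suc n) = ?t + \<omega>" by (simp add: algebra_simps)
  have "ff V \<omega> E ?t * (V (?t + \<omega>) - E) = 1 + ff V \<omega> E ?t * ff V \<omega> E (?t + \<omega>)"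
    using ff_rec[OF assms, of ?t] ff_denominator[OF assms, of "?t+\<omega>"] by (simp add: field_simps)
  then have "gg V \<omega> E \<theta> n * (ff V \<omega> E ?t * (V (?t + \<omega>) - E)) = gg V \<omega> E \<theta> n * (1 + ff V \<omega> E ?t * ff V \<omega> E (?t + \<omega>))" by simp
  then show ?thesis unfolding gg_Suc' e by (simp add: algebra_simps)
qed

text \<open>Squared norm of the resolvent column at \<theta> after normalising its diagonal entry to
  1; minus \<open>J\<close> is the slope of the energy tangent of D.\<close>

definition "J E \<theta> = 1 + (\<Sum>k. (gg V \<omega> E \<theta> (Suc k))\<^sup>2) + (\<Sum>k. (gg V (-\<omega>) E \<theta> (Suc k))\<^sup>2)"

lemma ff_energy:
  assumes "E < Es" "E' < Es"
  shows "ff V \<omega> E \<theta> + (E' - E) * (\<Sum>k. (gg V \<omega> E \<theta> (Suc k))\<^sup>2) \<le> ff V \<omega> E' \<theta>"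
proof -
  have d: "ap V \<omega> E' \<theta> k - ap V \<omega> E \<theta> k = E - E'" for k by (simp add: ap_def)
  have "ff V \<omega> E \<theta> - (\<Sum>k. (gg V \<omega> E \<theta> (Suc k))\<^sup>2 * (E - E')) \<le> ff V \<omega> E' \<theta>"
    using tangent_inf[OF assms, of \<theta> \<theta> "\<bar>E - E'\<bar>"] unfolding d by simp
  also have "(\<Sum>k. (gg V \<omega> E \<theta> (Suc k))\<^sup>2 * (E - E')) = (\<Sum>k. (gg V \<omega> E \<theta> (Suc k))\<^sup>2) * (E - E')"
    by (rule suminf_mult2[OF gg_Suc_summable[OF assms(1)], symmetric])
  finally show ?thesis by (simp add: algebra_simps)
qed

lemma DD_energy:
  assumes "E < Es" "E' < Es" shows "DD V \<omega> E' \<theta> \<le> DD V \<omega> E \<theta> - (E' - E) * J E \<theta>"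
  using ff_energy[OF assms, of \<theta>] hill.ff_energy[OF hill_neg, of E E' \<theta>] assms
  by (simp add: DD_def J_def Estar_neg algebra_simps)

text \<open>The tangent at \<open>E\<close> lies above the concave function D of the energy, which
  is nonnegative up to \<open>Es\<close>; the tangent cannot reach zero earlier.\<close>

lemma J_bound: assumes "E < Es" shows "(Es - E) * J E \<theta> \<le> DD V \<omega> E \<theta>"
proof -
  have J: "J E \<theta> \<ge> 1" unfolding J_def
    using suminf_nonneg[OF gg_Suc_summable[OF assms, of \<theta>]]
      suminf_nonneg[OF hill.gg_Suc_summable[OF hill_neg, of E \<theta>]] assms by (simp add: Estar_neg)
  have "Es \<le> E + DD V \<omega> E \<theta> / J E \<theta>"
  proof (rule dense_le_bounded[OF assms])
    fix E' assume E': "E < E'" "E' < Es"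
    have "0 \<le> DD V \<omega> E \<theta> - (E' - E) * J E \<theta>"
      using DD_energy[OF assms E'(2), of \<theta>] DD_nonneg[OF E'(2), of \<theta>] by linarith
    then show "E' \<le> E + DD V \<omega> E \<theta> / J E \<theta>" using J by (simp add: field_simps)
  qed
  then show ?thesis using J by (simp add: field_simps)
qed

text \<open>The tangent at the higher energy \<open>E'\<close> bounds D at \<open>E\<close> from
  above, and \<open>J_bound\<close> controls its slope: at a fixed phase, D / (Es - E) increases
  with the energy.\<close>

lemma DD_ratio:
  assumes "E < E'" "E' < Es" shows "DD V \<omega> E \<theta> * (Es - E') \<le> DD V \<omega> E' \<theta> * (Es - E)"
proof -
  have "DD V \<omega> E \<theta> \<le> DD V \<omega> E' \<theta> + (E' - E) * J E' \<theta>"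
    using DD_energy[of E' E \<theta>] assms by (simp add: algebra_simps)
  then have "DD V \<omega> E \<theta> * (Es - E') \<le> (DD V \<omega> E' \<theta> + (E' - E) * J E' \<theta>) * (Es - E')"
    using assms by (intro mult_right_mono) auto
  also have "\<dots> = DD V \<omega> E' \<theta> * (Es - E') + (E' - E) * ((Es - E') * J E' \<theta>)" by (simp add: algebra_simps)
  also have "\<dots> \<le> DD V \<omega> E' \<theta> * (Es - E') + (E' - E) * DD V \<omega> E' \<theta>"
    using assms by (intro add_left_mono mult_left_mono J_bound) auto
  finally show ?thesis by (simp add: algebra_simps)
qed

text \<open>The gap is exactly (u - s)^2 / (2 s u (s + u)), and s u (s + u) <= 2 C^3.\<close>

lemma harmonic_arith_gap:
  fixes s u d C :: real
  assumes "0 < s" "s + d \<le> u" "u \<le> C" "0 \<le> d"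
  shows "1 / ((s + u) / 2) \<le> (1/s + 1/u) / 2 - d\<^sup>2 / (4 * C ^ 3)"
proof -
  have u: "0 < u" "s \<le> u" "0 < C" using assms by auto
  have "(1/s + 1/u) / 2 - 1 / ((s + u) / 2) = (u - s)\<^sup>2 / (2 * (s * u * (s + u)))"
    using assms(1) u by (simp add: divide_simps power2_eq_square) (simp add: algebra_simps)
  also have "\<dots> \<ge> d\<^sup>2 / (4 * C ^ 3)"
  proof (rule frac_le)
    have "s * u * (s + u) \<le> C * C * (C + C)"
      using assms u by (intro mult_mono) auto
    then show "2 * (s * u * (s + u)) \<le> 4 * C ^ 3" by (simp add: power3_eq_cube)
  qed (use assms u in \<open>auto intro!: power_mono mult_pos_pos\<close>)
  finally show ?thesis by linarith
qed

text \<open>The mean of the two invariant graphs is a strict supersolution wherever they are separated,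
  so a uniform separation \<open>d\<close> leaves room to raise the energy.\<close>

lemma separation_below_threshold:
  assumes "E < Es" "0 \<le> d" "\<And>\<theta>. d \<le> DD V \<omega> E \<theta>"
  shows "E + d\<^sup>2 / (4 * Cb E ^ 3) \<le> Es"
proof (rule good_le_Es, unfold good_def, intro allI)
  fix \<theta> N
  define e where "e = d\<^sup>2 / (4 * Cb E ^ 3)"
  define t where "t n = \<theta> + \<omega> * real n" for n
  define s where "s n = ff V \<omega> E (t n)" for n
  define u where "u n = 1 / ff V (-\<omega>) E (t n + \<omega>)" for n
  define z where "z n = (s n + u n) / 2" for n
  have tS: "t n + \<omega> = t (Suc n)" for n by (simp add: t_def algebra_simps)
  have s0: "s n > 0" for n by (simp add: s_def ff_pos[OF assms(1)])
  have su: "s n + d \<le> u n" for n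
    using assms(3)[of "t n"] unfolding DD_eq_left[OF assms(1)] by (simp add: s_def u_def)
  have uC: "u n \<le> Cb E" for n
    using ff_ge'[OF assms(1), of "t n + \<omega>"] ff_pos'[OF assms(1), of "t n + \<omega>"] Cb_pos[OF assms(1)]
    by (simp add: u_def field_simps)
  have r1: "1 / s n = V (t (Suc n)) - E - s (Suc n)" for n
    using ff_rec[OF assms(1), of "t n"] by (simp add: s_def tS)
  have r2: "1 / u n = V (t (Suc n)) - E - u (Suc n)" for n
    using ff_left_shift[OF assms(1), of "t (Suc n)"] by (simp add: u_def tS)
  have "cfpos N (ap V \<omega> (E + e) \<theta>) \<and> cf N (ap V \<omega> (E + e) \<theta>) \<le> z 0"
  proof (rule cf_supersolution)
    show "0 < z n" for n using s0[of n] su[of n] assms(2) by (simp add: z_def)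
    fix n
    have "1 / z n \<le> (1 / s n + 1 / u n) / 2 - e"
      unfolding z_def e_def by (rule harmonic_arith_gap[OF s0 su uC assms(2)])
    also have "\<dots> = ap V \<omega> (E + e) \<theta> n - z (Suc n)"
      unfolding r1 r2 by (simp add: ap_def z_def t_def field_simps)
    finally show "1 / z n \<le> ap V \<omega> (E + e) \<theta> n - z (Suc n)" .
  qed
  then show "cfpos N (ap V \<omega> (E + d\<^sup>2 / (4 * Cb E ^ 3)) \<theta>)" by (simp add: e_def)
qed

lemma DD_minimizer:
  assumes "E < Es" shows "\<exists>\<theta>\<in>{a..a+1}. \<forall>\<eta>. DD V \<omega> E \<theta> \<le> DD V \<omega> E \<eta>"
proof -
  obtain \<theta> where \<theta>: "\<theta> \<in> {a..a+1}" "\<And>\<eta>. \<eta> \<in> {a..a+1} \<Longrightarrow> DD V \<omega> E \<theta> \<le> DD V \<omega> E \<eta>"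
    using continuous_attains_inf[of "{a..a+1}" "DD V \<omega> E"] continuous_on_subset[OF DD_cont[OF assms]] by auto
  have "DD V \<omega> E \<theta> \<le> DD V \<omega> E \<eta>" for \<eta>
  proof -
    have "DD V \<omega> E \<theta> \<le> DD V \<omega> E (\<eta> + of_int (- \<lfloor>\<eta> - a\<rfloor>))"
      by (rule \<theta>(2)) (auto; linarith)
    then show ?thesis unfolding DD_int .
  qed
  then show ?thesis using \<theta>(1) by blast
qed

section \<open>Identification of the fractions with the stable and unstable directions of the
  cocycle\<close>

context
  fixes lam :: real and v :: "real \<Rightarrow> real"
  assumes V_eq: "\<And>x. lam\<^sup>2 * v x = V x"
begin

text \<open>The cocycle vector at phase \<theta> carries the values at \<theta> - \<omega> and at
  \<theta>, so the decaying solution has to be based at \<theta> - \<omega>.\<close>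

lemma coc_fwd_eq:
  assumes "E < Es"
  shows "coc_fwd \<omega> lam v E n \<theta> (1, ff V \<omega> E (\<theta> - \<omega>)) = (gg V \<omega> E (\<theta> - \<omega>) n, gg V \<omega> E (\<theta> - \<omega>) (Suc n))"
proof (induction n)
  case 0 then show ?case by (simp add: gg_Suc gg_0)
next
  case (Suc n)
  have e: "\<theta> - \<omega> + \<omega> * real (Suc n) = \<theta> + real n * \<omega>" by (simp add: algebra_simps)
  show ?case using Suc gg_rec[OF assms, of "\<theta> - \<omega>" n] unfolding e
    by (simp add: cocA_def V_eq)
qed

lemma coc_bwd_eq:
  assumes "E < Es"
  shows "coc_bwd \<omega> lam v E n \<theta> (1, 1 / ff V (-\<omega>) E \<theta>)
    = ((1 / ff V (-\<omega>) E \<theta>) * gg V (-\<omega>) E \<theta> (Suc n), (1 / ff V (-\<omega>) E \<theta>) * gg V (-\<omega>) E \<theta> n)"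
proof (induction n)
  case 0 then show ?case using ff_pos'[OF assms, of \<theta>] by (simp add: gg_Suc gg_0)
next
  case (Suc n)
  have e: "\<theta> + (-\<omega>) * real (Suc n) = \<theta> - real (Suc n) * \<omega>" by (simp add: algebra_simps)
  have "(V (\<theta> - real (Suc n) * \<omega>) - E) * gg V (-\<omega>) E \<theta> (Suc n) = gg V (-\<omega>) E \<theta> (Suc (Suc n)) + gg V (-\<omega>) E \<theta> n"
    using hill.gg_rec[OF hill_neg, of E \<theta> n] assms unfolding e by (simp add: Estar_neg)
  moreover have "x * (c * g1) - c * g0 = c * g2" if "x * g1 = g2 + g0" for x c g0 g1 g2 :: real
    using arg_cong[OF that, of "\<lambda>y. c * y"] by (simp add: algebra_simps)
  ultimately have "(V (\<theta> - real (Suc n) * \<omega>) - E) * ((1 / ff V (-\<omega>) E \<theta>) * gg V (-\<omega>) E \<theta> (Suc n)) - (1 / ff V (-\<omega>) E \<theta>) * gg V (-\<omega>) E \<theta> n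
     = (1 / ff V (-\<omega>) E \<theta>) * gg V (-\<omega>) E \<theta> (Suc (Suc n))" by blast
  then show ?case by (simp only: coc_bwd.simps Suc cocA_inv_def fst_conv snd_conv V_eq)
qed

lemma gg_tendsto_0: assumes "E < Es" shows "(\<lambda>n. gg V \<omega> E \<theta> n) \<longlonglongrightarrow> 0"
proof -
  have "(\<lambda>n. (gg V \<omega> E \<theta> n)\<^sup>2) \<longlonglongrightarrow> 0" using gg_summable[OF assms] by (rule summable_LIMSEQ_zero)
  then have "(\<lambda>n. sqrt ((gg V \<omega> E \<theta> n)\<^sup>2)) \<longlonglongrightarrow> sqrt 0" by (rule tendsto_real_sqrt)
  then show ?thesis using gg_pos[OF assms] by (simp add: less_imp_le)
qed

lemma wronskian_fwd:
  "fst (coc_fwd \<omega> lam v E n \<theta> x) * snd (coc_fwd \<omega> lam v E n \<theta> y) - snd (coc_fwd \<omega> lam v E n \<theta> x) * fst (coc_fwd \<omega> lam v E n \<theta> y)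
    = fst x * snd y - snd x * fst y"
  by (induction n) (auto simp: cocA_def algebra_simps)

lemma wronskian_bwd:
  "fst (coc_bwd \<omega> lam v E n \<theta> x) * snd (coc_bwd \<omega> lam v E n \<theta> y) - snd (coc_bwd \<omega> lam v E n \<theta> x) * fst (coc_bwd \<omega> lam v E n \<theta> y)
    = fst x * snd y - snd x * fst y"
  by (induction n) (auto simp: cocA_inv_def algebra_simps)

text \<open>The cocycle has determinant one, so the Wronskian of two orbits is constant, and it
  vanishes if both tend to zero. This gives the uniqueness behind \<open>psi_s\<close> and
  \<open>psi_u\<close>.\<close>

lemma wronskian_unique:
  fixes X Y :: "nat \<Rightarrow> real \<times> real" and r s :: real
  assumes "X \<longlonglongrightarrow> 0" "Y \<longlonglongrightarrow> 0" "\<And>n. fst (X n) * snd (Y n) - snd (X n) * fst (Y n) = s - r"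
  shows "s = r"
proof -
  have "(\<lambda>n. fst (X n) * snd (Y n) - snd (X n) * fst (Y n)) \<longlonglongrightarrow> fst (0::real\<times>real) * snd (0::real\<times>real) - snd (0::real\<times>real) * fst (0::real\<times>real)"
    by (intro tendsto_intros assms)
  then have "(\<lambda>n. s - r) \<longlonglongrightarrow> 0" unfolding assms(3) by simp
  then show ?thesis by (simp add: LIMSEQ_const_iff)
qed

lemma psi_s_eq: assumes "E < Es" shows "psi_s \<omega> lam v E \<theta> = ff V \<omega> E (\<theta> - \<omega>)"
  unfolding psi_s_def
proof (rule the_equality)
  show *: "(\<lambda>n. coc_fwd \<omega> lam v E n \<theta> (1, ff V \<omega> E (\<theta> - \<omega>))) \<longlonglongrightarrow> 0"
    unfolding coc_fwd_eq[OF assms] zero_prod_def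
    by (intro tendsto_Pair LIMSEQ_Suc gg_tendsto_0 assms)
  fix r assume "(\<lambda>n. coc_fwd \<omega> lam v E n \<theta> (1, r)) \<longlonglongrightarrow> 0"
  from wronskian_unique[OF * this] show "r = ff V \<omega> E (\<theta> - \<omega>)"
    unfolding wronskian_fwd by simp
qed

end

lemma psi_u_eq:
  assumes "\<And>x. lam\<^sup>2 * v x = V x" "E < Es" shows "psi_u \<omega> lam v E \<theta> = 1 / ff V (-\<omega>) E \<theta>"
  unfolding psi_u_def
proof (rule the_equality)
  have g: "(\<lambda>n. gg V (-\<omega>) E \<theta> n) \<longlonglongrightarrow> 0"
    using hill.gg_tendsto_0[OF hill_neg assms(1), of E \<theta>] assms(2) by (simp add: Estar_neg)
  show *: "(\<lambda>n. coc_bwd \<omega> lam v E n \<theta> (1, 1 / ff V (-\<omega>) E \<theta>)) \<longlonglongrightarrow> 0"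
    unfolding coc_bwd_eq[OF assms] zero_prod_def
    by (intro tendsto_Pair tendsto_mult_right_zero LIMSEQ_Suc g)
  fix r assume "(\<lambda>n. coc_bwd \<omega> lam v E n \<theta> (1, r)) \<longlonglongrightarrow> 0"
  from wronskian_unique[OF assms(1) * this] show "r = 1 / ff V (-\<omega>) E \<theta>"
    unfolding wronskian_bwd[OF assms(1)] by simp
qed

lemma psi_diff_eq:
  assumes "\<And>x. lam\<^sup>2 * v x = V x" "E < Es"
  shows "psi_u \<omega> lam v E \<theta> - psi_s \<omega> lam v E \<theta> = DD V \<omega> E (\<theta> - \<omega>)"
  unfolding psi_u_eq[OF assms] psi_s_eq[OF assms] DD_eq_left[OF assms(2)] by simp

end

section \<open>The spectrum\<close>

lemma l2Z_finite_bound: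
  assumes "\<And>F. finite F \<Longrightarrow> (\<Sum>n\<in>F. (u n)\<^sup>2) \<le> M" shows "u \<in> l2Z"
  unfolding l2Z_def mem_Collect_eq
  by (rule nonneg_bdd_above_summable_on) (auto intro!: bdd_aboveI[of _ M] assms)

lemma l2Z_bound:
  assumes "u \<in> l2Z" obtains M where "\<And>F. finite F \<Longrightarrow> (\<Sum>n\<in>F. (u n)\<^sup>2) \<le> M" "0 \<le> M"
proof -
  have s: "(\<lambda>n. (u n)\<^sup>2) summable_on UNIV" using assms by (simp add: l2Z_def)
  show ?thesis
    by (rule that[of "infsum (\<lambda>n. (u n)\<^sup>2) UNIV"])
       (auto intro!: finite_sum_le_infsum s infsum_nonneg)
qed

lemma l2Z_bounded:
  assumes "u \<in> l2Z" obtains M where "\<And>n. \<bar>u n\<bar> \<le> M" "0 \<le> M"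
proof -
  obtain M where M: "\<And>F. finite F \<Longrightarrow> (\<Sum>n\<in>F. (u n)\<^sup>2) \<le> M" "0 \<le> M" by (rule l2Z_bound[OF assms]) blast
  have "\<bar>u n\<bar> \<le> sqrt M" for n using M(1)[of "{n}"] by (intro real_le_rsqrt) auto
  then show ?thesis using that[of "sqrt M"] M(2) by auto
qed

lemma l2Z_add: assumes "u \<in> l2Z" "w \<in> l2Z" shows "(\<lambda>n. u n + w n) \<in> l2Z"
proof -
  obtain M where M: "\<And>F. finite F \<Longrightarrow> (\<Sum>n\<in>F. (u n)\<^sup>2) \<le> M" by (rule l2Z_bound[OF assms(1)]) blast
  obtain L where L: "\<And>F. finite F \<Longrightarrow> (\<Sum>n\<in>F. (w n)\<^sup>2) \<le> L" by (rule l2Z_bound[OF assms(2)]) blast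
  show ?thesis
  proof (rule l2Z_finite_bound)
    fix F :: "int set" assume F: "finite F"
    have "(\<Sum>n\<in>F. (u n + w n)\<^sup>2) \<le> (\<Sum>n\<in>F. 2 * (u n)\<^sup>2 + 2 * (w n)\<^sup>2)"
    proof (rule sum_mono)
      fix n
      have "0 \<le> (u n - w n)\<^sup>2" by simp
      then show "(u n + w n)\<^sup>2 \<le> 2 * (u n)\<^sup>2 + 2 * (w n)\<^sup>2" by (simp add: power2_sum power2_diff)
    qed
    also have "\<dots> = 2 * (\<Sum>n\<in>F. (u n)\<^sup>2) + 2 * (\<Sum>n\<in>F. (w n)\<^sup>2)"
      by (simp add: sum.distrib sum_distrib_left)
    finally show "(\<Sum>n\<in>F. (u n + w n)\<^sup>2) \<le> 2 * M + 2 * L" using M[OF F] L[OF F] by linarith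
  qed
qed

text \<open>Both weighted shifts and the solution operators below have this form: \<open>p\<close> selects the
  sites, and for fixed \<open>j\<close> it is injective in \<open>n\<close>.\<close>

lemma l2Z_kernel:
  fixes k :: "int \<Rightarrow> nat \<Rightarrow> real"
  assumes w: "w \<in> l2Z" and q: "0 \<le> q" "q < 1" and k: "\<And>n j. \<bar>k n j\<bar> \<le> C * q ^ j"
    and p: "\<And>j. inj (\<lambda>n. p n j)"
  shows "summable (\<lambda>j. k n j * w (p n j))" and "(\<lambda>n. \<Sum>j. k n j * w (p n j)) \<in> l2Z"
proof -
  obtain M where M: "\<And>F. finite F \<Longrightarrow> (\<Sum>n\<in>F. (w n)\<^sup>2) \<le> M" "0 \<le> M" by (rule l2Z_bound[OF w]) blast
  obtain W where W: "\<And>n. \<bar>w n\<bar> \<le> W" "0 \<le> W" by (rule l2Z_bounded[OF w]) blast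
  have C: "C \<ge> 0" using k[of 0 0] by simp
  have geo: "(\<Sum>j<N. q ^ j) \<le> 1 / (1 - q)" for N
    using q sum_le_suminf[of "\<lambda>j. q ^ j" "{..<N}"] suminf_geometric[of q] by (simp add: summable_geometric)
  show sm: "summable (\<lambda>j. k n j * w (p n j))" for n
  proof (rule summable_comparison_test'[of "\<lambda>j. C * q ^ j * W"])
    show "summable (\<lambda>j. C * q ^ j * W)" using q by (intro summable_mult summable_mult2 summable_geometric) auto
    show "norm (k n j * w (p n j)) \<le> C * q ^ j * W" for j
      unfolding real_norm_def abs_mult using k[of n j] W q C by (intro mult_mono) auto
  qed
  define K where "K = C\<^sup>2 / (1 - q) * (M / (1 - q))"
  show "(\<lambda>n. \<Sum>j. k n j * w (p n j)) \<in> l2Z"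
  proof (rule l2Z_finite_bound)
    fix F :: "int set" assume F: "finite F"
    show "(\<Sum>n\<in>F. (\<Sum>j. k n j * w (p n j))\<^sup>2) \<le> K"
    proof (rule LIMSEQ_le_const2)
      show "(\<lambda>N. \<Sum>n\<in>F. (\<Sum>j<N. k n j * w (p n j))\<^sup>2) \<longlonglongrightarrow> (\<Sum>n\<in>F. (\<Sum>j. k n j * w (p n j))\<^sup>2)"
        by (intro tendsto_intros summable_LIMSEQ sm)
      have "(\<Sum>n\<in>F. (\<Sum>j<N. k n j * w (p n j))\<^sup>2) \<le> K" for N
      proof -
        have 1: "(\<Sum>j<N. k n j * w (p n j))\<^sup>2 \<le> C\<^sup>2 / (1 - q) * (\<Sum>j<N. q ^ j * (w (p n j))\<^sup>2)" for n
        proof -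
          have "\<bar>\<Sum>j<N. k n j * w (p n j)\<bar> \<le> (\<Sum>j<N. \<bar>k n j\<bar> * \<bar>w (p n j)\<bar>)"
            by (rule order_trans[OF sum_abs]) (simp add: abs_mult)
          \<comment> \<open>Splitting q^j evenly prepares Cauchy-Schwarz: one half sums to 1 / (1 -
            q), the other still decays for the sum over \<open>j\<close> after the exchange of
            sums.\<close>
          also have "\<dots> \<le> (\<Sum>j<N. sqrt q ^ j * (C * sqrt q ^ j * \<bar>w (p n j)\<bar>))"
          proof (rule sum_mono)
            fix j
            have "\<bar>k n j\<bar> * \<bar>w (p n j)\<bar> \<le> (C * q ^ j) * \<bar>w (p n j)\<bar>" by (intro mult_right_mono k) auto
            also have "q ^ j = sqrt q ^ j * sqrt q ^ j" using q by (simp flip: power_mult_distrib)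
            finally show "\<bar>k n j\<bar> * \<bar>w (p n j)\<bar> \<le> sqrt q ^ j * (C * sqrt q ^ j * \<bar>w (p n j)\<bar>)" by (simp add: mult_ac)
          qed
          finally have "(\<Sum>j<N. k n j * w (p n j))\<^sup>2 \<le> (\<Sum>j<N. sqrt q ^ j * (C * sqrt q ^ j * \<bar>w (p n j)\<bar>))\<^sup>2"
            by (subst power2_abs[symmetric]) (intro power_mono, auto)
          also have "\<dots> \<le> (\<Sum>j<N. (sqrt q ^ j)\<^sup>2) * (\<Sum>j<N. (C * sqrt q ^ j * \<bar>w (p n j)\<bar>)\<^sup>2)"
            by (rule Cauchy_Schwarz_ineq_sum)
          also have "(\<Sum>j<N. (sqrt q ^ j)\<^sup>2) = (\<Sum>j<N. q ^ j)" using q by (simp add: power_even_eq[symmetric] power_mult[symmetric] mult.commute[of _ 2]) (simp add: power_mult)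
          also have "(\<Sum>j<N. (C * sqrt q ^ j * \<bar>w (p n j)\<bar>)\<^sup>2) = C\<^sup>2 * (\<Sum>j<N. q ^ j * (w (p n j))\<^sup>2)"
          proof -
            have "(sqrt q ^ j)\<^sup>2 = q ^ j" for j using q by (metis power_mult mult.commute real_sqrt_pow2)
            then show ?thesis unfolding sum_distrib_left by (simp add: power_mult_distrib mult.assoc)
          qed
          also have "(\<Sum>j<N. q ^ j) * (C\<^sup>2 * (\<Sum>j<N. q ^ j * (w (p n j))\<^sup>2)) \<le> 1 / (1 - q) * (C\<^sup>2 * (\<Sum>j<N. q ^ j * (w (p n j))\<^sup>2))"
            using geo q by (intro mult_right_mono mult_nonneg_nonneg sum_nonneg) auto
          finally show ?thesis by simp
        qed
        have "(\<Sum>n\<in>F. (\<Sum>j<N. k n j * w (p n j))\<^sup>2) \<le> (\<Sum>n\<in>F. C\<^sup>2 / (1 - q) * (\<Sum>j<N. q ^ j * (w (p n j))\<^sup>2))"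
          by (intro sum_mono 1)
        also have "\<dots> = C\<^sup>2 / (1 - q) * (\<Sum>j<N. q ^ j * (\<Sum>n\<in>F. (w (p n j))\<^sup>2))"
          unfolding sum_distrib_left[symmetric] by (subst sum.swap) (simp add: sum_distrib_left)
        also have "\<dots> \<le> C\<^sup>2 / (1 - q) * (\<Sum>j<N. q ^ j * M)"
        proof (intro mult_left_mono sum_mono)
          fix j
          have "(\<Sum>n\<in>F. (w (p n j))\<^sup>2) = (\<Sum>m\<in>(\<lambda>n. p n j) ` F. (w m)\<^sup>2)"
            by (rule sum.reindex_cong[symmetric, where l="\<lambda>n. p n j"]) (use p[of j] in \<open>auto simp: inj_on_def inj_def\<close>)
          also have "\<dots> \<le> M" using F by (intro M) auto
          finally show "(\<Sum>n\<in>F. (w (p n j))\<^sup>2) \<le> M" .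
        qed (use q in auto)
        also have "\<dots> \<le> C\<^sup>2 / (1 - q) * (1 / (1 - q) * M)"
          unfolding sum_distrib_right[symmetric] using q geo M(2)
          by (intro mult_left_mono mult_right_mono) auto
        finally show ?thesis by (simp add: K_def)
      qed
      then show "\<exists>N. \<forall>M\<ge>N. (\<Sum>n\<in>F. (\<Sum>j<M. k n j * w (p n j))\<^sup>2) \<le> K" by blast
    qed
  qed
qed

lemma l2Z_weighted_shift:
  assumes "w \<in> l2Z" "\<And>n. \<bar>c n\<bar> \<le> C" shows "(\<lambda>n. c n * w (n + s)) \<in> l2Z"
proof -
  \<comment> \<open>A kernel supported at j = 0, that is the case q = 0 with 0^0 = 1.\<close>
  have "(\<lambda>n. \<Sum>j. (if j = 0 then c n else 0) * w (n + s)) \<in> l2Z"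
    by (rule l2Z_kernel(2)[OF assms(1), of 0 _ C]) (use assms(2) in \<open>auto simp: inj_def power_0_left\<close>)
  moreover have "(\<Sum>j. (if j = 0 then c n else 0) * w (n + s)) = c n * w (n + s)" for n
    by (subst suminf_finite[of "{0}"]) auto
  ultimately show ?thesis by simp
qed

context hill begin

lemma gg_geometric:
  assumes "E < Es" obtains C q where "0 \<le> q" "q < 1" "0 \<le> C" "\<And>\<theta> k. gg V \<omega> E \<theta> k \<le> C * q ^ k"
proof -
  define q where "q = 1 - 1 / G E"
  have q: "0 \<le> q" "q < 1" using G_gt[OF assms] by (auto simp: q_def)
  show ?thesis
  proof (rule that[of "sqrt q" "sqrt (G E)"])
    fix \<theta> k
    have "gg V \<omega> E \<theta> k \<le> sqrt (G E * q ^ k)"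
      using gg_decay[OF assms, of \<theta> k] by (intro real_le_rsqrt) (simp add: q_def)
    then show "gg V \<omega> E \<theta> k \<le> sqrt (G E) * sqrt q ^ k" by (simp add: real_sqrt_mult real_sqrt_power)
  qed (use q G_gt[OF assms] in auto)
qed

context
  fixes lam :: real and v :: "real \<Rightarrow> real"
  assumes V_eq: "\<And>x. lam\<^sup>2 * v x = V x"
begin

lemma schrod_l2Z:
  assumes "u \<in> l2Z" shows "(\<lambda>n. schrod_op \<omega> lam v \<theta> u n - E * u n) \<in> l2Z"
proof -
  have a: "(\<lambda>n. (-1) * u (n + 1)) \<in> l2Z" "(\<lambda>n. (-1) * u (n + (-1))) \<in> l2Z"
    by (rule l2Z_weighted_shift[OF assms, of _ 1]; simp)+
  have "\<bar>V x - E\<bar> \<le> \<bar>V m\<bar> + B0 + \<bar>E\<bar>" for x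
    using V_min[of x] V_max[of x] B0 by linarith
  then have "(\<lambda>n. (V (\<theta> + of_int n * \<omega>) - E) * u (n + 0)) \<in> l2Z"
    by (intro l2Z_weighted_shift[OF assms])
  from l2Z_add[OF l2Z_add[OF a] this] show ?thesis
    by (simp add: schrod_op_def V_eq algebra_simps)
qed

text \<open>With \<open>c n = 1 / \<psi>\<^sup>u\<close> along the orbit, \<open>H - E\<close> factors into two first-order difference
  operators: \<open>y n = u (n-1) / c n - u n\<close> and \<open>((H - E) u) n = y (n+1) - c n * y n\<close>.\<close>

lemma spec_below:
  assumes "E < Es" shows "E \<notin> spec \<omega> lam v \<theta>"
proof -
  define c where "c n = ff V (-\<omega>) E (\<theta> + of_int n * \<omega>)" for n :: int
  define g where "g n k = gg V (-\<omega>) E (\<theta> + of_int n * \<omega>) k" for n :: int and k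
  obtain C q where Cq: "0 \<le> q" "q < 1" "0 \<le> C" "\<And>n k. g n k \<le> C * q ^ k"
    using hill.gg_geometric[OF hill_neg, of E] assms unfolding g_def by (metis Estar_neg)
  have g0: "0 < g n k" for n k
    unfolding g_def using hill.gg_pos[OF hill_neg] assms by (simp add: Estar_neg)
  have c0: "0 < c n" for n unfolding c_def by (rule ff_pos'[OF assms])
  have cC: "\<bar>1 / c n\<bar> \<le> Cb E" for n
    using c0[of n] ff_ge'[OF assms, of "\<theta> + of_int n * \<omega>"] Cb_pos[OF assms] by (simp add: c_def field_simps)
  have g00: "g n 0 = 1" for n by (simp add: g_def gg_0)
  have gS: "g n (Suc k) = c n * g (n - 1) k" for n k
    unfolding g_def c_def gg_Suc by (simp add: algebra_simps)
  have gS': "g n (Suc k) = g n k * c (n - int k)" for n k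
    unfolding g_def c_def gg_Suc' by (simp add: algebra_simps)
  have crec: "V (\<theta> + of_int n * \<omega>) - E = 1 / c (n + 1) + c n" for n
    using ff_left_shift[OF assms, of "\<theta> + of_int n * \<omega>"] by (simp add: c_def algebra_simps)
  define T where "T u = (\<lambda>n. schrod_op \<omega> lam v \<theta> u n - E * u n)" for u :: "int \<Rightarrow> real"
  have T: "T u n = - u (n + 1) - u (n - 1) + (1 / c (n + 1) + c n) * u n" for u n
    using crec[of n] by (simp add: T_def schrod_op_def V_eq algebra_simps)
  have geo0: "x = 0" if "\<And>k. \<bar>x\<bar> \<le> C * q ^ k * Y" for x Y
  proof -
    have "(\<lambda>k. C * q ^ k * Y) \<longlonglongrightarrow> C * 0 * Y" using Cq by (intro tendsto_intros LIMSEQ_power_zero) auto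
    then have "\<bar>x\<bar> \<le> 0" using that by (intro LIMSEQ_le_const[of _ 0]) auto
    then show ?thesis by simp
  qed
  \<comment> \<open>Both factors are injective on bounded sequences: \<open>y\<close> is followed k
    steps to the left and \<open>u\<close> k steps to the right, which shows each value to be a
    geometrically small multiple of a bounded one.\<close>
  have ker: "u = (\<lambda>_. 0)" if u: "u \<in> l2Z" and Tu: "\<And>n. T u n = 0" for u
  proof -
    obtain U where U: "\<And>n. \<bar>u n\<bar> \<le> U" "0 \<le> U" by (rule l2Z_bounded[OF u]) blast
    define y where "y n = u (n - 1) / c n - u n" for n
    have yb: "\<bar>y n\<bar> \<le> Cb E * U + U" for n
    proof -
      have "\<bar>y n\<bar> \<le> \<bar>1 / c n\<bar> * \<bar>u (n - 1)\<bar> + \<bar>u n\<bar>" by (simp add: y_def) (metis abs_divide abs_triangle_ineq4)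
      also have "\<dots> \<le> Cb E * U + U" using U cC[of n] Cb_pos[OF assms] by (intro add_mono mult_mono) auto
      finally show ?thesis .
    qed
    have yrec: "y (n + 1) = c n * y n" for n
    proof -
      have "c n * y n = u (n - 1) - c n * u n" using c0[of n] by (simp add: y_def right_diff_distrib)
      then show ?thesis using Tu[of n] by (simp add: T y_def algebra_simps)
    qed
    have yk: "y (n + 1) = g n k * y (n + 1 - int k)" for n k
    proof (induction k)
      case (Suc k)
      have "y (n + 1 - int k) = c (n - int k) * y (n - int k)" using yrec[of "n - int k"] by (simp add: algebra_simps)
      then show ?case using Suc by (simp add: gS')
    qed (simp add: g00)
    have y0: "y n = 0" for n
    proof (rule geo0)
      fix k
      have "\<bar>y n\<bar> = g (n - 1) k * \<bar>y (n - int k)\<bar>" using yk[of "n - 1" k] g0[of "n - 1" k] by (simp add: abs_mult)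
      also have "\<dots> \<le> C * q ^ k * (Cb E * U + U)"
        using Cq(4)[of "n - 1" k] yb g0[of "n - 1" k] Cq(1,3) by (intro mult_mono) auto
      finally show "\<bar>y n\<bar> \<le> C * q ^ k * (Cb E * U + U)" .
    qed
    have urec: "u (n - 1) = c n * u n" for n using y0[of n] c0[of n] by (simp add: y_def field_simps)
    have uk: "u n = g (n + int k) k * u (n + int k)" for n k
    proof (induction k)
      case (Suc k)
      have "u (n + int k) = c (n + int (Suc k)) * u (n + int (Suc k))" using urec[of "n + int (Suc k)"] by (simp add: algebra_simps)
      moreover have "g (n + int (Suc k)) (Suc k) = c (n + int (Suc k)) * g (n + int k) k" by (simp add: gS algebra_simps)
      ultimately show ?case using Suc by simp
    qed (simp add: g00)
    have "u n = 0" for n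
    proof (rule geo0)
      fix k
      have "\<bar>u n\<bar> = g (n + int k) k * \<bar>u (n + int k)\<bar>" using uk[of n k] g0[of "n + int k" k] by (metis abs_mult abs_of_pos)
      also have "\<dots> \<le> C * q ^ k * U"
        using Cq(4)[of "n + int k" k] U g0[of "n + int k" k] Cq(1,3) by (intro mult_mono) auto
      finally show "\<bar>u n\<bar> \<le> C * q ^ k * U" .
    qed
    then show ?thesis by auto
  qed
  have "bij_betw T l2Z l2Z"
    unfolding bij_betw_def
  proof
    show "inj_on T l2Z"
    proof (rule inj_onI)
      fix u w assume uw: "u \<in> l2Z" "w \<in> l2Z" "T u = T w"
      have "(\<lambda>n. (-1) * w (n + 0)) \<in> l2Z" by (rule l2Z_weighted_shift[OF uw(2), of _ 1]) simp
      from l2Z_add[OF uw(1) this] have d: "(\<lambda>n. u n - w n) \<in> l2Z" by simp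
      have "T (\<lambda>n. u n - w n) n = 0" for n
        using fun_cong[OF uw(3), of n] by (simp add: T algebra_simps diff_divide_distrib)
      from ker[OF d this] show "u = w" by (auto simp: fun_eq_iff)
    qed
    show "T ` l2Z = l2Z"
    proof
      show "T ` l2Z \<subseteq> l2Z" unfolding T_def using schrod_l2Z by auto
      show "l2Z \<subseteq> T ` l2Z"
      proof
        fix w assume w: "w \<in> l2Z"
        have kb: "\<bar>g n j\<bar> \<le> C * q ^ j" for n j using Cq(4)[of n j] g0[of n j] by simp
        have kb': "\<bar>g n (Suc j)\<bar> \<le> C * q ^ j" for n j
        proof -
          have "q ^ Suc j \<le> q ^ j" using Cq by (intro power_decreasing) auto
          then have "C * q ^ Suc j \<le> C * q ^ j" using Cq by (intro mult_left_mono)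
          then show ?thesis using kb[of n "Suc j"] by linarith
        qed
        \<comment> \<open>The first factor is solved by a Neumann series over the sites to the left;
          \<open>u\<close> below solves the second one by a series over the sites to the
          right.\<close>
        define y where "y n = (\<Sum>j. g (n - 1) j * w (n - 1 - int j))" for n
        have ys: "summable (\<lambda>j. g (n - 1) j * w (n - 1 - int j))" and yl: "y \<in> l2Z" for n
          unfolding y_def using l2Z_kernel[OF w Cq(1,2), of "\<lambda>n j. g (n - 1) j" C "\<lambda>n j. n - 1 - int j"] kb
          by (auto simp: inj_def)
        have yrec: "y (n + 1) = w n + c n * y n" for n
        proof -
          have "y (n + 1) = g n 0 * w n + (\<Sum>j. g n (Suc j) * w (n - int (Suc j)))"
            unfolding y_def using suminf_split_head[OF ys[of "n + 1"]] by simp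
          also have "(\<Sum>j. g n (Suc j) * w (n - int (Suc j))) = (\<Sum>j. c n * (g (n - 1) j * w (n - 1 - int j)))"
            by (simp add: gS algebra_simps)
          also have "\<dots> = c n * y n" unfolding y_def by (rule suminf_mult[OF ys])
          finally show ?thesis by (simp add: g00)
        qed
        define u where "u n = (\<Sum>j. g (n + 1 + int j) (Suc j) * y (n + 1 + int j))" for n
        have us: "summable (\<lambda>j. g (n + 1 + int j) (Suc j) * y (n + 1 + int j))" and ul: "u \<in> l2Z" for n
          unfolding u_def using l2Z_kernel[OF yl Cq(1,2), of "\<lambda>n j. g (n + 1 + int j) (Suc j)" C "\<lambda>n j. n + 1 + int j"] kb'
          by (auto simp: inj_def)
        have urec: "u (n - 1) = c n * (y n + u n)" for n
        proof -
          have "u (n - 1) = g n 1 * y n + (\<Sum>j. g (n + int (Suc j)) (Suc (Suc j)) * y (n + int (Suc j)))"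
            unfolding u_def using suminf_split_head[OF us[of "n - 1"]] by simp
          also have "g n 1 = c n" using gS'[of n 0] by (simp add: g00)
          also have "(\<Sum>j. g (n + int (Suc j)) (Suc (Suc j)) * y (n + int (Suc j))) = (\<Sum>j. c n * (g (n + 1 + int j) (Suc j) * y (n + 1 + int j)))"
          proof (intro arg_cong[where f=suminf] ext)
            fix j
            have "g (n + int (Suc j)) (Suc (Suc j)) = g (n + int (Suc j)) (Suc j) * c n" using gS'[of "n + int (Suc j)" "Suc j"] by simp
            then show "g (n + int (Suc j)) (Suc (Suc j)) * y (n + int (Suc j)) = c n * (g (n + 1 + int j) (Suc j) * y (n + 1 + int j))"
              by (simp add: algebra_simps)
          qed
          also have "\<dots> = c n * u n" unfolding u_def by (rule suminf_mult[OF us])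
          finally show ?thesis by (simp add: algebra_simps)
        qed
        have "T u n = w n" for n
        proof -
          have "u n = c (n + 1) * (y (n + 1) + u (n + 1))" using urec[of "n + 1"] by simp
          then have "u n / c (n + 1) = y (n + 1) + u (n + 1)" using c0[of "n + 1"] by (simp add: field_simps)
          then show ?thesis using urec[of n] yrec[of n] by (simp add: T algebra_simps)
        qed
        then have "T u = w" by auto
        then show "w \<in> T ` l2Z" using ul by blast
      qed
    qed
  qed
  then show ?thesis by (simp add: spec_def T_def[abs_def])
qed

end

text \<open>The minimum point of D moves with the energy, but an eigenvector needs one phase.
  Minimum points at energies tending to \<open>Es\<close> accumulate at some \<theta>;
  \<open>DD_ratio\<close> carries the bound down to a given \<open>E\<close> at the same phase, and
  continuity carries it to \<theta>.\<close>

lemma common_resonant_phase: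
  assumes "\<And>E. Es - 1 < E \<Longrightarrow> E < Es \<Longrightarrow> \<exists>\<theta>. DD V \<omega> E \<theta> \<le> K * (Es - E)"
  shows "\<exists>\<theta>. \<forall>E. Es - 1 < E \<longrightarrow> E < Es \<longrightarrow> DD V \<omega> E \<theta> \<le> K * (Es - E)"
proof -
  define e where "e n = Es - 1 / real (n + 2)" for n
  have e: "Es - 1 < e n" "e n < Es" for n by (auto simp: e_def field_simps)
  have "\<exists>\<theta>\<in>{0..1}. DD V \<omega> (e n) \<theta> \<le> K * (Es - e n)" for n
  proof -
    obtain \<eta> where \<eta>: "DD V \<omega> (e n) \<eta> \<le> K * (Es - e n)" using assms[OF e] by blast
    obtain \<theta> where "\<theta> \<in> {0..0+1}" "\<forall>\<eta>. DD V \<omega> (e n) \<theta> \<le> DD V \<omega> (e n) \<eta>" using DD_minimizer[OF e(2), of 0] by blast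
    then show ?thesis using \<eta> by (intro bexI[of _ \<theta>]) (auto intro: order_trans)
  qed
  then obtain t where t: "\<And>n. t n \<in> {0..1}" "\<And>n. DD V \<omega> (e n) (t n) \<le> K * (Es - e n)" by metis
  obtain \<theta> r where r: "strict_mono r" "(t \<circ> r) \<longlonglongrightarrow> \<theta>"
    using compact_Icc[of "0::real" 1, unfolded compact_def] t(1) by blast
  have "DD V \<omega> E \<theta> \<le> K * (Es - E)" if E: "Es - 1 < E" "E < Es" for E
  proof (rule LIMSEQ_le_const2)
    have "isCont (DD V \<omega> E) \<theta>" using DD_cont[OF E(2)] by (simp add: continuous_on_eq_continuous_at)
    then show "(\<lambda>n. DD V \<omega> E ((t \<circ> r) n)) \<longlonglongrightarrow> DD V \<omega> E \<theta>" using r(2) by (rule isCont_tendsto_compose)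
    obtain N :: nat where N: "1 / (Es - E) < real N" using reals_Archimedean2 by blast
    have "DD V \<omega> E (t (r n)) \<le> K * (Es - E)" if "n \<ge> N" for n
    proof -
      have "N \<le> r n" using that seq_suble[OF r(1), of n] by linarith
      then have "1 / (Es - E) < real (r n + 2)" using N by linarith
      then have Ee: "E < e (r n)" using E by (simp add: e_def field_simps)
      have "DD V \<omega> E (t (r n)) * (Es - e (r n)) \<le> DD V \<omega> (e (r n)) (t (r n)) * (Es - E)"
        by (rule DD_ratio[OF Ee e(2)])
      also have "\<dots> \<le> K * (Es - e (r n)) * (Es - E)"
        using t(2) E by (intro mult_right_mono) auto
      finally have "DD V \<omega> E (t (r n)) * (Es - e (r n)) \<le> (K * (Es - E)) * (Es - e (r n))" by (simp add: mult_ac)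
      then show ?thesis using e(2)[of "r n"] by (simp add: mult_le_cancel_right)
    qed
    then show "\<exists>N. \<forall>n\<ge>N. DD V \<omega> E ((t \<circ> r) n) \<le> K * (Es - E)" by auto
  qed
  then show ?thesis by blast
qed

lemma ff_convergent_E:
  assumes "\<And>n. e n < Es" "incseq e" 
  shows "convergent (\<lambda>n. ff V \<omega> (e n) \<theta>)"
proof (rule Bseq_mono_convergent)
  have "ff V \<omega> (e n) \<theta> \<le> Cb (e 0)" for n
    using ff_le[OF assms(1), of n \<theta>] incseqD[OF assms(2), of 0 n] by auto
  then show "Bseq (\<lambda>n. ff V \<omega> (e n) \<theta>)"
    using ff_nonneg[OF assms(1)] by (intro BseqI'[of _ "Cb (e 0)"]) auto
  show "\<forall>m n. m \<le> n \<longrightarrow> ff V \<omega> (e m) \<theta> \<le> ff V \<omega> (e n) \<theta>"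
  proof (intro allI impI)
    fix m n :: nat assume "m \<le> n"
    then show "ff V \<omega> (e m) \<theta> \<le> ff V \<omega> (e n) \<theta>"
      using incseqD[OF assms(2), of m n] ff_mono_E[of "e m" "e n" \<theta>] assms(1)[of n] by (cases "e m = e n") auto
  qed
qed

text \<open>The fractions increase with the energy and are bounded, so the solutions converge at
  every site; the recursion and the bounds on partial sums pass to the limit.\<close>

lemma half_line_solution_limit:
  assumes e: "\<And>n. e n < Es" "incseq e" "e \<longlonglongrightarrow> Es"
    and K: "\<And>n. (\<Sum>k. (gg V \<omega> (e n) \<theta> (Suc k))\<^sup>2) \<le> K"
  obtains h where "h 0 = 1" "(\<lambda>n. ff V \<omega> (e n) \<theta>) \<longlonglongrightarrow> h 1"
    "\<And>n. (V (\<theta> + \<omega> * real (Suc n)) - Es) * h (Suc n) = h (Suc (Suc n)) + h n"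
    "\<And>n. (\<Sum>k<n. (h (Suc k))\<^sup>2) \<le> K"
proof -
  define h where "h k = lim (\<lambda>n. gg V \<omega> (e n) \<theta> k)" for k
  have c: "convergent (\<lambda>n. gg V \<omega> (e n) \<theta> k)" for k
    unfolding gg_def
  proof (induction k)
    case (Suc k)
    then show ?case using ff_convergent_E[OF e(1,2)] unfolding prod.lessThan_Suc by (intro convergent_mult)
  qed (simp add: convergent_const)
  have hl: "(\<lambda>n. gg V \<omega> (e n) \<theta> k) \<longlonglongrightarrow> h k" for k
    using c[of k] by (simp add: h_def convergent_LIMSEQ_iff)
  show ?thesis
  proof (rule that[of h])
    have "(\<lambda>n. gg V \<omega> (e n) \<theta> 0) \<longlonglongrightarrow> 1" by (simp add: gg_0)
    then show "h 0 = 1" using hl[of 0] LIMSEQ_unique by blast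
    show "(\<lambda>n. ff V \<omega> (e n) \<theta>) \<longlonglongrightarrow> h 1" using hl[of 1] by (simp add: gg_Suc gg_0)
    show "(V (\<theta> + \<omega> * real (Suc n)) - Es) * h (Suc n) = h (Suc (Suc n)) + h n" for n
    proof (rule LIMSEQ_unique)
      show "(\<lambda>i. (V (\<theta> + \<omega> * real (Suc n)) - e i) * gg V \<omega> (e i) \<theta> (Suc n)) \<longlonglongrightarrow> (V (\<theta> + \<omega> * real (Suc n)) - Es) * h (Suc n)"
        by (intro tendsto_intros hl e)
      show "(\<lambda>i. (V (\<theta> + \<omega> * real (Suc n)) - e i) * gg V \<omega> (e i) \<theta> (Suc n)) \<longlonglongrightarrow> h (Suc (Suc n)) + h n"
        unfolding gg_rec[OF e(1)] by (intro tendsto_intros hl)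
    qed
    show "(\<Sum>k<n. (h (Suc k))\<^sup>2) \<le> K" for n
    proof (rule LIMSEQ_le_const2)
      show "(\<lambda>i. \<Sum>k<n. (gg V \<omega> (e i) \<theta> (Suc k))\<^sup>2) \<longlonglongrightarrow> (\<Sum>k<n. (h (Suc k))\<^sup>2)"
        by (intro tendsto_intros hl)
      have "(\<Sum>k<n. (gg V \<omega> (e i) \<theta> (Suc k))\<^sup>2) \<le> K" for i
        using sum_le_suminf[OF gg_Suc_summable[OF e(1)[of i], of \<theta>], of "{..<n}"] K[of i] by auto
      then show "\<exists>N. \<forall>i\<ge>N. (\<Sum>k<n. (gg V \<omega> (e i) \<theta> (Suc k))\<^sup>2) \<le> K" by blast
    qed
  qed
qed

text \<open>The bound on D keeps \<open>J\<close> bounded, so both half-line solutions survive at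
  \<open>Es\<close> as square-summable sequences, and D -> 0 is the matching condition at \<theta>.
  The glued sequence is a nonzero element of the kernel of H - Es.\<close>

lemma threshold_in_spec:
  assumes V_eq: "\<And>x. lam\<^sup>2 * v x = V x"
    and res: "\<And>E. Es - 1 < E \<Longrightarrow> E < Es \<Longrightarrow> DD V \<omega> E \<theta> \<le> K * (Es - E)"
  shows "Es \<in> spec \<omega> lam v \<theta>"
proof -
  define e where "e n = Es - 1 / real (n + 2)" for n
  have e: "Es - 1 < e n" "e n < Es" for n by (auto simp: e_def field_simps)
  have inc: "incseq e" by (auto simp: incseq_def e_def field_simps)
  have el: "e \<longlonglongrightarrow> Es"
  proof -
    have "(\<lambda>n. 1 / real (n + 2)) \<longlonglongrightarrow> 0"
      using LIMSEQ_ignore_initial_segment[OF lim_1_over_n, of 2] by simp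
    from tendsto_diff[OF tendsto_const[of Es] this] show ?thesis by (simp add: e_def[abs_def])
  qed
  have JK: "J (e n) \<theta> \<le> K" for n
  proof -
    have "(Es - e n) * J (e n) \<theta> \<le> (Es - e n) * K"
      using order_trans[OF J_bound[OF e(2)] res[OF e]] by (simp add: mult.commute)
    then show ?thesis using e(2)[of n] by (simp add: mult_le_cancel_left)
  qed
  have nn: "0 \<le> (\<Sum>k. (gg V \<omega> (e n) \<theta> (Suc k))\<^sup>2)" "0 \<le> (\<Sum>k. (gg V (-\<omega>) (e n) \<theta> (Suc k))\<^sup>2)" for n
    using suminf_nonneg[OF gg_Suc_summable[OF e(2), of n \<theta>]]
      suminf_nonneg[OF hill.gg_Suc_summable[OF hill_neg, of "e n" \<theta>]] e(2)[of n] by (auto simp: Estar_neg)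
  have SK: "(\<Sum>k. (gg V \<omega> (e n) \<theta> (Suc k))\<^sup>2) \<le> K" "(\<Sum>k. (gg V (-\<omega>) (e n) \<theta> (Suc k))\<^sup>2) \<le> K" for n
    using JK[of n] nn[of n] by (auto simp: J_def)
  obtain h where h: "h 0 = 1" "(\<lambda>n. ff V \<omega> (e n) \<theta>) \<longlonglongrightarrow> h 1"
    "\<And>n. (V (\<theta> + \<omega> * real (Suc n)) - Es) * h (Suc n) = h (Suc (Suc n)) + h n"
    "\<And>n. (\<Sum>k<n. (h (Suc k))\<^sup>2) \<le> K"
    using half_line_solution_limit[OF e(2) inc el SK(1)] by blast
  obtain l where l: "l 0 = 1" "(\<lambda>n. ff V (-\<omega>) (e n) \<theta>) \<longlonglongrightarrow> l 1"
    "\<And>n. (V (\<theta> - \<omega> * real (Suc n)) - Es) * l (Suc n) = l (Suc (Suc n)) + l n"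
    "\<And>n. (\<Sum>k<n. (l (Suc k))\<^sup>2) \<le> K"
    using hill.half_line_solution_limit[OF hill_neg, of e \<theta> K] e(2) inc el SK(2)
    by (simp add: Estar_neg) blast
  have center: "V \<theta> - Es - h 1 - l 1 = 0"
  proof (rule LIMSEQ_unique)
    show "(\<lambda>n. DD V \<omega> (e n) \<theta>) \<longlonglongrightarrow> V \<theta> - Es - h 1 - l 1"
      unfolding DD_def by (intro tendsto_intros h l el)
    have "(\<lambda>n. K * (Es - e n)) \<longlonglongrightarrow> K * (Es - Es)" by (intro tendsto_intros el)
    then have lim0: "(\<lambda>n. K * (Es - e n)) \<longlonglongrightarrow> 0" by simp
    show "(\<lambda>n. DD V \<omega> (e n) \<theta>) \<longlonglongrightarrow> 0"
    proof (rule tendsto_sandwich[OF _ _ tendsto_const lim0])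
      show "\<forall>\<^sub>F n in sequentially. 0 \<le> DD V \<omega> (e n) \<theta>" by (intro always_eventually allI DD_nonneg e)
      show "\<forall>\<^sub>F n in sequentially. DD V \<omega> (e n) \<theta> \<le> K * (Es - e n)" by (intro always_eventually allI res e)
    qed
  qed
  define u where "u n = (if n \<ge> 0 then h (nat n) else l (nat (- n)))" for n :: int
  have u_pos: "u (int n) = h n" for n by (simp add: u_def)
  have u_neg: "u (- int n) = l n" for n using h(1) l(1) by (cases "n = 0") (auto simp: u_def)
  have "u \<in> l2Z"
  proof (rule l2Z_finite_bound)
    fix F :: "int set" assume F: "finite F"
    define N where "N = Suc (nat (Max (insert 0 (abs ` F))))"
    have sub: "F \<subseteq> int ` {..<Suc N} \<union> (\<lambda>k. - int k) ` {..<Suc N}"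
    proof
      fix n assume "n \<in> F"
      then have "\<bar>n\<bar> \<le> Max (insert 0 (abs ` F))" using F by (intro Max_ge) auto
      then have "nat \<bar>n\<bar> < Suc N" by (simp add: N_def)
      then show "n \<in> int ` {..<Suc N} \<union> (\<lambda>k. - int k) ` {..<Suc N}"
        by (cases "n \<ge> 0") (auto intro: image_eqI[of _ _ "nat \<bar>n\<bar>"])
    qed
    have "(\<Sum>n\<in>F. (u n)\<^sup>2) \<le> (\<Sum>n\<in>int ` {..<Suc N} \<union> (\<lambda>k. - int k) ` {..<Suc N}. (u n)\<^sup>2)"
      using sub by (intro sum_mono2) auto
    also have "\<dots> \<le> (\<Sum>n\<in>int ` {..<Suc N}. (u n)\<^sup>2) + (\<Sum>n\<in>(\<lambda>k. - int k) ` {..<Suc N}. (u n)\<^sup>2)"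
      using sum.union_inter[of "int ` {..<Suc N}" "(\<lambda>k. - int k) ` {..<Suc N}" "\<lambda>n. (u n)\<^sup>2"]
        sum_nonneg[of "int ` {..<Suc N} \<inter> (\<lambda>k. - int k) ` {..<Suc N}" "\<lambda>n. (u n)\<^sup>2"] by simp
    also have "\<dots> = (\<Sum>k<Suc N. (h k)\<^sup>2) + (\<Sum>k<Suc N. (l k)\<^sup>2)"
      by (subst (1 2) sum.reindex) (auto simp: inj_on_def u_pos u_neg simp del: sum.lessThan_Suc)
    also have "\<dots> \<le> (1 + K) + (1 + K)"
      unfolding sum.lessThan_Suc_shift using h(1,4) l(1,4) by (intro add_mono) auto
    finally show "(\<Sum>n\<in>F. (u n)\<^sup>2) \<le> (1 + K) + (1 + K)" .
  qed
  moreover have "(\<lambda>n. schrod_op \<omega> lam v \<theta> u n - Es * u n) = (\<lambda>n. schrod_op \<omega> lam v \<theta> (\<lambda>_. 0) n - Es * 0)"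
  proof
    fix n :: int
    consider "n = 0" | k where "n = int (Suc k)" | k where "n = - int (Suc k)"
      by (metis int_cases2 of_nat_0 nat.exhaust minus_zero)
    then have "- u (n + 1) - u (n - 1) + (V (\<theta> + of_int n * \<omega>) - Es) * u n = 0"
    proof cases
      case 1
      have "u 1 = h 1" "u (-1) = l 1" "u 0 = 1" using u_pos[of 1] u_neg[of 1] u_pos[of 0] h(1) by auto
      then show ?thesis using center 1 by simp
    next
      case (2 k)
      have i: "n + 1 = int (Suc (Suc k))" "n - 1 = int k" using 2 by simp_all
      have "u n = h (Suc k)" "u (n + 1) = h (Suc (Suc k))" "u (n - 1) = h k"
        using u_pos[of "Suc k"] u_pos[of "Suc (Suc k)"] u_pos[of k] i 2 by (simp_all only: i)
      moreover have e: "\<theta> + of_int n * \<omega> = \<theta> + \<omega> * real (Suc k)" using 2 by (simp add: algebra_simps)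
      ultimately show ?thesis using h(3)[of k] unfolding e by simp
    next
      case (3 k)
      have i: "n - 1 = - int (Suc (Suc k))" "n + 1 = - int k" using 3 by simp_all
      have "u n = l (Suc k)" "u (n - 1) = l (Suc (Suc k))" "u (n + 1) = l k"
        using u_neg[of "Suc k"] u_neg[of "Suc (Suc k)"] u_neg[of k] i 3 by (simp_all only: i)
      moreover have e: "\<theta> + of_int n * \<omega> = \<theta> - \<omega> * real (Suc k)" by (subst 3) (simp add: algebra_simps)
      ultimately show ?thesis using l(3)[of k] unfolding e by simp
    qed
    then show "schrod_op \<omega> lam v \<theta> u n - Es * u n = schrod_op \<omega> lam v \<theta> (\<lambda>_. 0) n - Es * 0"
      by (simp add: schrod_op_def V_eq algebra_simps)
  qed
  moreover have "(\<lambda>_. 0) \<in> l2Z" by (simp add: l2Z_def)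
  moreover have "u \<noteq> (\<lambda>_. 0)" using u_pos[of 0] h(1) by (auto simp: fun_eq_iff intro!: exI[of _ 0])
  ultimately have "\<not> inj_on (\<lambda>u. (\<lambda>n. schrod_op \<omega> lam v \<theta> u n - Es * u n)) l2Z"
    unfolding inj_on_def by (metis (no_types, lifting))
  then show ?thesis by (auto simp: spec_def bij_betw_def)
qed

lemma E0_eq_Es:
  assumes V_eq: "\<And>x. lam\<^sup>2 * v x = V x"
    and "\<And>E. Es - 1 < E \<Longrightarrow> E < Es \<Longrightarrow> \<exists>\<theta>. DD V \<omega> E \<theta> \<le> K * (Es - E)"
  shows "E0 \<omega> lam v = Es"
proof -
  obtain \<theta> where "\<And>E. Es - 1 < E \<Longrightarrow> E < Es \<Longrightarrow> DD V \<omega> E \<theta> \<le> K * (Es - E)"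
    using common_resonant_phase[OF assms(2)] by blast
  from threshold_in_spec[OF V_eq this] have "Es \<in> (\<Union>\<theta>. spec \<omega> lam v \<theta>)" by blast
  moreover have "Es \<le> x" if "x \<in> (\<Union>\<theta>. spec \<omega> lam v \<theta>)" for x
    using that spec_below[OF V_eq, of x] by (meson UN_E not_le)
  ultimately show ?thesis unfolding E0_def by (intro cInf_eq_minimum)
qed

end

section \<open>The maximum principle on resonant windows\<close>

text \<open>Exponent of the decay weight: slope about 1/2 plus a concave correction. A unit step
  changes it by at most 1 (\<open>wx_step\<close>), which the recursion off the wells can
  afford.\<close>

definition wx :: "nat \<Rightarrow> real" where
  "wx k = (real k + sqrt (real k)) / 2"

lemma wx_0: "wx 0 = 0" by (simp add: wx_def)

lemma wx_mono: "i \<le> j \<Longrightarrow> wx i \<le> wx j"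
  by (simp add: wx_def add_mono)

lemma wx_ge_1: "1 \<le> k \<Longrightarrow> (real k + 1) / 2 \<le> wx k"
  by (simp add: wx_def)

lemma wx_step: "wx (Suc k) - wx k \<le> 1"
proof -
  have "sqrt (real (Suc k)) \<le> sqrt (real k) + sqrt 1"
    using sqrt_add_le_add_sqrt[of "real k" 1] by (simp add: add.commute)
  then show ?thesis by (simp add: wx_def field_simps)
qed

text \<open>The square root term of \<open>wx\<close> is what pays for the loss \<open>4 / d\<close> at a resonant window.\<close>

lemma wx_window:
  assumes "1 \<le> r" "16 * r \<le> l"
  shows "sqrt (real r) / 4 - 1 / 2 \<le> wx r + wx (l - r - 1) - wx l"
proof -
  define y where "y = real l - real r - 1"
  have y0: "y \<ge> 0" using assms by (simp add: y_def)
  have ry: "real (l - r - 1) = y" using assms by (simp add: y_def of_nat_diff)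
  have l0: "sqrt (real l) > 0" using assms by simp
  have "sqrt (16 * real r) \<le> sqrt (real l)" using assms by (intro real_sqrt_le_mono) simp
  then have l4: "4 * sqrt (real r) \<le> sqrt (real l)" by (simp add: real_sqrt_mult)
  have "(sqrt (real l) - sqrt y) * sqrt (real l) \<le> (sqrt (real l) - sqrt y) * (sqrt (real l) + sqrt y)"
    using y0 by (intro mult_left_mono) (auto simp: y_def)
  also have "\<dots> = real l - y" using y0 by (simp add: algebra_simps)
  also have "\<dots> \<le> 2 * real r" using assms by (simp add: y_def)
  also have "\<dots> = 2 * sqrt (real r) * sqrt (real r)" by simp
  also have "\<dots> \<le> 2 * sqrt (real r) * (sqrt (real l) / 4)" using l4 by (intro mult_left_mono) auto
  finally have "(sqrt (real l) - sqrt y) * sqrt (real l) \<le> (sqrt (real r) / 2) * sqrt (real l)" by (simp add: mult.commute)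
  then have "sqrt (real l) - sqrt y \<le> sqrt (real r) / 2" using l0 by (simp only: mult_le_cancel_right_pos)
  then show ?thesis unfolding wx_def ry by (simp add: y_def field_simps)
qed

text \<open>Here the source decays at the full rate and the solution is measured at half of it; the
  surplus again exceeds what a window costs.\<close>

lemma wx_source:
  assumes "1 \<le> r" "16 * r \<le> l"
  shows "sqrt (real r) / 4 + 1 \<le> wx (l - r) - wx l / 2"
proof -
  have rl: "real (l - r) = real l - real r" using assms by simp
  have "sqrt (real l / 4) \<le> sqrt (real (l - r))" using assms unfolding rl by (intro real_sqrt_le_mono) simp
  then have 1: "sqrt (real l) / 2 \<le> sqrt (real (l - r))" by (simp add: real_sqrt_divide)
  have "sqrt (real r) \<le> sqrt (real r * real r)" using assms by (intro real_sqrt_le_mono) simp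
  then have 2: "sqrt (real r) \<le> real r" by simp
  have "real l \<ge> 16 * real r" "real r \<ge> 1" using assms by auto
  then show ?thesis using 1 2 unfolding wx_def rl by (simp add: field_simps)
qed

text \<open>Where |h| / W is largest, the step hypothesis returns at most half of the maximum and
  adds at most M / 2. The maximum is attained because \<open>h\<close> vanishes beyond
  \<open>N\<close>.\<close>

lemma max_principle:
  fixes h W :: "nat \<Rightarrow> real"
  assumes W: "\<And>k. 0 < W k" and M: "0 \<le> M" and h0: "\<bar>h 0\<bar> \<le> M * W 0" and hN: "\<And>k. N < k \<Longrightarrow> h k = 0"
    and step: "\<And>k. 1 \<le> k \<Longrightarrow> k \<le> N \<Longrightarrow> \<exists>i j \<alpha> \<beta> t. i < k \<and> 0 \<le> \<alpha> \<and> 0 \<le> \<beta> \<and> \<bar>h k\<bar> \<le> \<alpha> * \<bar>h i\<bar> + \<beta> * \<bar>h j\<bar> + t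
        \<and> \<alpha> * W i + \<beta> * W j \<le> W k / 2 \<and> t \<le> M * W k / 2"
  shows "\<bar>h k\<bar> \<le> M * W k"
proof (cases "N < k")
  case True then show ?thesis using hN[of k] M W[of k] by simp
next
  case False
  define \<mu> where "\<mu> = Max ((\<lambda>k. \<bar>h k\<bar> / W k) ` {0..N})"
  have \<mu>_le: "\<bar>h k\<bar> \<le> \<mu> * W k" if "k \<le> N" for k
  proof -
    have "\<bar>h k\<bar> / W k \<le> \<mu>" unfolding \<mu>_def using that by (intro Max_ge) auto
    then show ?thesis using W[of k] by (simp add: field_simps)
  qed
  have \<mu>0: "0 \<le> \<mu>" using \<mu>_le[of 0] W[of 0] by (smt (verit) mult_neg_pos zero_le)
  have \<mu>_all: "\<bar>h k\<bar> \<le> \<mu> * W k" for k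
    using \<mu>_le[of k] hN[of k] \<mu>0 W[of k] by (cases "k \<le> N") auto
  have "\<mu> \<in> (\<lambda>k. \<bar>h k\<bar> / W k) ` {0..N}" unfolding \<mu>_def by (intro Max_in) auto
  then obtain k0 where k0: "k0 \<le> N" "\<mu> = \<bar>h k0\<bar> / W k0" by auto
  have e: "\<bar>h k0\<bar> = \<mu> * W k0" using k0 W[of k0] by simp
  have "\<mu> \<le> M"
  proof (cases "k0 = 0")
    case True
    then have "\<mu> * W 0 \<le> M * W 0" using e h0 by simp
    then show ?thesis using W[of 0] by (simp only: mult_le_cancel_right_pos)
  next
    case False
    then obtain i j \<alpha> \<beta> t where s: "0 \<le> \<alpha>" "0 \<le> \<beta>" "\<bar>h k0\<bar> \<le> \<alpha> * \<bar>h i\<bar> + \<beta> * \<bar>h j\<bar> + t"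
      "\<alpha> * W i + \<beta> * W j \<le> W k0 / 2" "t \<le> M * W k0 / 2"
      using step[of k0] k0(1) by auto
    have "\<mu> * W k0 \<le> \<alpha> * (\<mu> * W i) + \<beta> * (\<mu> * W j) + M * W k0 / 2"
      using s(1,2,3,5) mult_left_mono[OF \<mu>_all[of i] s(1)] mult_left_mono[OF \<mu>_all[of j] s(2)] e by linarith
    also have "\<alpha> * (\<mu> * W i) + \<beta> * (\<mu> * W j) = \<mu> * (\<alpha> * W i + \<beta> * W j)" by (simp add: algebra_simps)
    also have "\<dots> \<le> \<mu> * (W k0 / 2)" using s(4) \<mu>0 by (intro mult_left_mono)
    finally have "\<mu> * W k0 \<le> M * W k0" by linarith
    then show ?thesis using W[of k0] by (simp only: mult_le_cancel_right_pos)
  qed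
  then have "\<mu> * W k \<le> M * W k" using W[of k] by (intro mult_right_mono) auto
  then show ?thesis using \<mu>_all[of k] by linarith
qed

context hill begin

text \<open>Green's formula on both sides of site \<open>l\<close> eliminates its two neighbours.
  There remain a truncated D, possibly with different radii, the residuals in the window, and the
  two values just outside it.\<close>

lemma window_identity:
  fixes h :: "nat \<Rightarrow> real" and \<theta> :: real
  assumes E: "E < Es" and r: "r < l"
  defines "F \<equiv> \<lambda>k. (V (\<theta> + \<omega> * real k) - E) * h k - h (Suc k) - h (k - 1)"
    and "\<eta> \<equiv> \<theta> + \<omega> * real l"
  shows "(V \<eta> - E - kf V \<omega> E R \<eta> - kf V (-\<omega>) E r \<eta>) * h l
    = F l + pp V \<omega> E R \<eta> R * h (l + R + 1) + (\<Sum>i<R. pp V \<omega> E R \<eta> (Suc i) * F (l + i + 1))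
     + pp V (-\<omega>) E r \<eta> r * h (l - r - 1) + (\<Sum>i<r. pp V (-\<omega>) E r \<eta> (Suc i) * F (l - i - 1))"
proof -
  have E': "E < Estar V (-\<omega>)" using E by (simp add: Estar_neg)
  have right: "h (l + 1) = kf V \<omega> E R \<eta> * h l + pp V \<omega> E R \<eta> R * h (l + R + 1) + (\<Sum>i<R. pp V \<omega> E R \<eta> (Suc i) * F (l + i + 1))"
  proof -
    have "ap V \<omega> E \<eta> i = V (\<theta> + \<omega> * real (l + i + 1)) - E" for i
      by (simp add: ap_def \<eta>_def algebra_simps)
    then show ?thesis
      using cf_green_identity[OF kf_cfpos[OF E, of R \<eta>], of "\<lambda>i. h (l + i)"]
      unfolding kf_def pp_def F_def by simp
  qed
  have left: "h (l - 1) = kf V (-\<omega>) E r \<eta> * h l + pp V (-\<omega>) E r \<eta> r * h (l - r - 1) + (\<Sum>i<r. pp V (-\<omega>) E r \<eta> (Suc i) * F (l - i - 1))"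
  proof -
    have F: "ap V (-\<omega>) E \<eta> i * h (l - Suc i) - h (l - Suc (Suc i)) - h (l - i) = F (l - i - 1)" if "i < r" for i
    proof -
      have i: "real (l - i - 1) = real l - real i - 1" "Suc (l - i - 1) = l - i" "l - i - 1 - 1 = l - Suc (Suc i)" "l - i - 1 = l - Suc i"
        using that r by (auto simp: of_nat_diff)
      have "ap V (-\<omega>) E \<eta> i = V (\<theta> + \<omega> * real (l - i - 1)) - E"
        unfolding i(1) by (simp add: ap_def \<eta>_def algebra_simps)
      then show ?thesis unfolding F_def i(2,3) by (simp add: i(4))
    qed
    have "(\<Sum>i<r. pp V (-\<omega>) E r \<eta> (Suc i) * (ap V (-\<omega>) E \<eta> i * h (l - Suc i) - h (l - Suc (Suc i)) - h (l - i)))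
       = (\<Sum>i<r. pp V (-\<omega>) E r \<eta> (Suc i) * F (l - i - 1))"
      by (intro sum.cong) (auto simp: F)
    then show ?thesis
      using cf_green_identity[OF hill.kf_cfpos[OF hill_neg E', of r \<eta>], of "\<lambda>i. h (l - i)"]
      unfolding kf_def pp_def by simp
  qed
  have "(V \<eta> - E) * h l = F l + h (l + 1) + h (l - 1)" by (simp add: F_def \<eta>_def)
  then show ?thesis using right left by (simp add: algebra_simps)
qed

lemma window_estimate:
  fixes h :: "nat \<Rightarrow> real" and \<theta> :: real
  assumes E: "E < Es" and r: "r < l" and l: "l \<le> N" and hN: "\<And>k. N < k \<Longrightarrow> h k = 0"
  defines "F \<equiv> \<lambda>k. (V (\<theta> + \<omega> * real k) - E) * h k - h (Suc k) - h (k - 1)"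
    and "\<eta> \<equiv> \<theta> + \<omega> * real l"
  assumes d: "0 < d" "d \<le> DN V \<omega> E r \<eta>"
    and pr: "\<And>n k. n \<le> r \<Longrightarrow> pp V \<omega> E n \<eta> k \<le> 1" and pl: "\<And>n k. n \<le> r \<Longrightarrow> pp V (-\<omega>) E n \<eta> k \<le> 1"
    and q: "pp V \<omega> E r \<eta> r \<le> q" "pp V (-\<omega>) E r \<eta> r \<le> q"
    and \<Phi>: "\<And>k. l - r \<le> k \<Longrightarrow> 1 \<le> k \<Longrightarrow> k \<le> N \<Longrightarrow> \<bar>F k\<bar> \<le> \<Phi>"
  shows "d * \<bar>h l\<bar> \<le> q * \<bar>h (l - r - 1)\<bar> + q * \<bar>h (l + r + 1)\<bar> + (2 * real r + 1) * \<Phi>"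
proof -
  \<comment> \<open>On the right the window is cut at \<open>N\<close>, where \<open>h\<close>
    vanishes; a shorter fraction is smaller, so the lower bound \<open>d\<close> for the truncated D
    survives.\<close>
  define R where "R = min r (N - l)"
  have R: "R \<le> r" "l + R \<le> N" using l by (auto simp: R_def)
  have E': "E < Estar V (-\<omega>)" using E by (simp add: Estar_neg)
  have p0: "0 \<le> pp V \<omega> E n \<eta> k" "0 \<le> pp V (-\<omega>) E n \<eta> k" for n k
    using pp_nonneg[OF E] hill.pp_nonneg[OF hill_neg E'] by auto
  have q0: "0 \<le> q" using p0(1)[of r r] q(1) by linarith
  have "\<bar>F l\<bar> \<le> \<Phi>" using \<Phi>[of l] r l by simp
  then have \<Phi>0: "0 \<le> \<Phi>" by linarith
  define A where "A = V \<eta> - E - kf V \<omega> E R \<eta> - kf V (-\<omega>) E r \<eta>"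
  have "d \<le> A" using d(2) kf_mono[OF E R(1), of \<eta>] by (simp add: A_def DN_def)
  then have "d * \<bar>h l\<bar> \<le> A * \<bar>h l\<bar>" by (intro mult_right_mono) auto
  also have "\<dots> = \<bar>A * h l\<bar>" using \<open>d \<le> A\<close> d(1) by (simp add: abs_mult)
  also have "A * h l = F l + pp V \<omega> E R \<eta> R * h (l + R + 1) + (\<Sum>i<R. pp V \<omega> E R \<eta> (Suc i) * F (l + i + 1))
     + pp V (-\<omega>) E r \<eta> r * h (l - r - 1) + (\<Sum>i<r. pp V (-\<omega>) E r \<eta> (Suc i) * F (l - i - 1))"
    unfolding A_def F_def \<eta>_def by (rule window_identity[OF E r])
  finally have 1: "d * \<bar>h l\<bar> \<le> \<bar>F l\<bar> + \<bar>pp V \<omega> E R \<eta> R * h (l + R + 1)\<bar> + \<bar>\<Sum>i<R. pp V \<omega> E R \<eta> (Suc i) * F (l + i + 1)\<bar>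
     + \<bar>pp V (-\<omega>) E r \<eta> r * h (l - r - 1)\<bar> + \<bar>\<Sum>i<r. pp V (-\<omega>) E r \<eta> (Suc i) * F (l - i - 1)\<bar>" by linarith
  have 2: "\<bar>F l\<bar> \<le> \<Phi>" using \<Phi>[of l] r l by simp
  have 3: "\<bar>pp V \<omega> E R \<eta> R * h (l + R + 1)\<bar> \<le> q * \<bar>h (l + r + 1)\<bar>"
  proof (cases "R = r")
    case True then show ?thesis using p0(1)[of r r] q(1) by (auto simp: abs_mult intro!: mult_right_mono)
  next
    case False
    then have "N < l + R + 1" by (auto simp: R_def)
    then show ?thesis using hN q0 by simp
  qed
  have 4: "\<bar>pp V (-\<omega>) E r \<eta> r * h (l - r - 1)\<bar> \<le> q * \<bar>h (l - r - 1)\<bar>"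
    using p0(2)[of r r] q(2) by (auto simp: abs_mult intro!: mult_right_mono)
  have s: "\<bar>x * y\<bar> \<le> \<Phi>" if "0 \<le> x" "x \<le> 1" "\<bar>y\<bar> \<le> \<Phi>" for x y :: real
    using mult_mono[of x 1 "\<bar>y\<bar>" \<Phi>] that by (simp add: abs_mult)
  have 5: "\<bar>\<Sum>i<R. pp V \<omega> E R \<eta> (Suc i) * F (l + i + 1)\<bar> \<le> real R * \<Phi>"
  proof -
    have "\<bar>\<Sum>i<R. pp V \<omega> E R \<eta> (Suc i) * F (l + i + 1)\<bar> \<le> (\<Sum>i<R. \<bar>pp V \<omega> E R \<eta> (Suc i) * F (l + i + 1)\<bar>)" by (rule sum_abs)
    also have "\<dots> \<le> (\<Sum>i<R. \<Phi>)"
      using R pr[OF R(1)] p0(1) by (intro sum_mono s \<Phi>) auto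
    finally show ?thesis by simp
  qed
  have 6: "\<bar>\<Sum>i<r. pp V (-\<omega>) E r \<eta> (Suc i) * F (l - i - 1)\<bar> \<le> real r * \<Phi>"
  proof -
    have "\<bar>\<Sum>i<r. pp V (-\<omega>) E r \<eta> (Suc i) * F (l - i - 1)\<bar> \<le> (\<Sum>i<r. \<bar>pp V (-\<omega>) E r \<eta> (Suc i) * F (l - i - 1)\<bar>)" by (rule sum_abs)
    also have "\<dots> \<le> (\<Sum>i<r. \<Phi>)"
      using r l pl[of r] p0(2) by (intro sum_mono s \<Phi>) auto
    finally show ?thesis by simp
  qed
  have "real R * \<Phi> \<le> real r * \<Phi>" using R \<Phi>0 by (intro mult_right_mono) auto
  then show ?thesis using 1 2 3 4 5 6 by (simp add: algebra_simps)
qed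

end

text \<open>The wells are the integer translates of \<open>[m - \<rho>, m + \<rho>]\<close>; outside them the potential exceeds its
  minimum by \<open>4 \<kappa>\<close>, inside it is strongly convex. A well at distance \<open>t\<close> from the critical phase is examined
  through a window of radius \<open>rad t\<close>, and the Diophantine condition enters only through \<open>rad_dioph\<close>.\<close>

locale core = hill +
  fixes \<kappa> \<gamma> \<rho> :: real and rad :: "real \<Rightarrow> nat"
  assumes \<kappa>: "3 \<le> \<kappa>" and \<gamma>: "2 \<le> \<gamma>" and \<rho>: "0 < \<rho>"
    and small_coupling: "2 * B1\<^sup>2 / \<kappa> ^ 3 + B2 / \<kappa>\<^sup>2 \<le> \<gamma> / 2"
    and nonwell: "(\<And>j::int. \<rho> < \<bar>x - m - of_int j\<bar>) \<Longrightarrow> V m + 4 * \<kappa> \<le> V x"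
    and well_convex: "x \<in> {m-\<rho>..m+\<rho>} \<Longrightarrow> y \<in> {m-\<rho>..m+\<rho>} \<Longrightarrow> V ((x + y) / 2) \<le> (V x + V y) / 2 - \<gamma> * (x - y)\<^sup>2"
    and rad_large: "0 < t \<Longrightarrow> t \<le> 2 * \<rho> \<Longrightarrow> 1 \<le> rad t \<and> 4 * (2 * real (rad t) + 1) \<le> t\<^sup>2 * \<kappa> powr (sqrt (real (rad t)) / 4 - 1 / 2)"
    and rad_dioph: "1 \<le> l \<Longrightarrow> 0 \<le> s \<Longrightarrow> s \<le> 2 * \<rho> \<Longrightarrow> s = 0 \<or> l \<le> rad s \<Longrightarrow> \<bar>\<omega> * real l - of_int j\<bar> - s \<le> t \<Longrightarrow> t \<le> 2 * \<rho>
        \<Longrightarrow> 0 < t \<and> 2 * s \<le> t \<and> 16 * rad t \<le> l"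
begin

lemma core_neg: "core V V' (-\<omega>) m B0 B1 B2 \<kappa> \<gamma> \<rho> rad"
proof -
  have "0 < t \<and> 2 * s \<le> t \<and> 16 * rad t \<le> l"
    if "1 \<le> l" "0 \<le> s" "s \<le> 2 * \<rho>" "s = 0 \<or> l \<le> rad s" "\<bar>- \<omega> * real l - of_int j\<bar> - s \<le> t" "t \<le> 2 * \<rho>" for l s j t
  proof (rule rad_dioph[of _ _ "-j"])
    have "\<bar>\<omega> * real l - of_int (-j)\<bar> = \<bar>- \<omega> * real l - of_int j\<bar>" by (simp add: abs_if)
    then show "\<bar>\<omega> * real l - of_int (-j)\<bar> - s \<le> t" using that by linarith
  qed (use that in auto)
  then show ?thesis
    by (intro core.intro hill_neg core_axioms.intro \<kappa> \<gamma> \<rho> small_coupling nonwell well_convex rad_large)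
qed

abbreviation "well \<equiv> {m-\<rho>..m+\<rho>}"

definition wt :: "nat \<Rightarrow> real" where "wt k = \<kappa> powr (- wx k)"

lemma \<kappa>_pos: "0 < \<kappa>" "1 < \<kappa>" using \<kappa> by auto

lemma wt_pos: "0 < wt k" using \<kappa>_pos by (simp add: wt_def)

lemma wt_0: "wt 0 = 1" using \<kappa>_pos by (simp add: wt_def wx_0)

lemma wt_antimono: "i \<le> j \<Longrightarrow> wt j \<le> wt i"
  unfolding wt_def using \<kappa>_pos wx_mono by (intro powr_mono) auto

lemma wt_le_1: "wt k \<le> 1" using wt_antimono[of 0 k] wt_0 by simp

text \<open>All truncations n <= N are included since a window may be cut short at the end of the
  orbit segment.\<close>

definition decay :: "real \<Rightarrow> nat \<Rightarrow> real \<Rightarrow> bool" where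
  "decay E N \<theta> \<longleftrightarrow> (\<forall>n\<le>N. \<forall>k. pp V \<omega> E n \<theta> k \<le> wt k \<and> pp V (-\<omega>) E n \<theta> k \<le> wt k)"

definition nonres :: "real \<Rightarrow> real \<Rightarrow> real \<Rightarrow> bool" where
  "nonres E \<theta>c \<eta> \<longleftrightarrow> decay E (rad \<bar>\<eta> - \<theta>c\<bar>) \<eta> \<and> \<bar>\<eta> - \<theta>c\<bar>\<^sup>2 \<le> DN V \<omega> E (rad \<bar>\<eta> - \<theta>c\<bar>) \<eta>"

lemma decay_neg: "core.decay V (-\<omega>) \<kappa> E N \<theta> = decay E N \<theta>"
  unfolding decay_def core.decay_def[OF core_neg] wt_def core.wt_def[OF core_neg] by auto

lemma nonres_neg: "core.nonres V (-\<omega>) \<kappa> rad E \<theta>c \<eta> = nonres E \<theta>c \<eta>"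
  unfolding nonres_def core.nonres_def[OF core_neg] decay_neg DN_neg ..

text \<open>Solving for the central value divides by D >= t^2. The gain of the weights across the
  window beats this with a factor 4 (2 r + 1) to spare, enough for two boundary terms and 2 r + 1
  sources.\<close>

lemma wt_ratio_window:
  assumes t: "0 < t" "t \<le> 2 * \<rho>" "16 * rad t \<le> l"
  shows "4 * (2 * real (rad t) + 1) * (wt (rad t) * \<kappa> powr (wx l - wx (l - rad t - 1))) \<le> t\<^sup>2"
    and "4 * (2 * real (rad t) + 1) * \<kappa> powr (3/2 + wx l / 2 - wx (l - rad t)) \<le> t\<^sup>2"
proof -
  let ?r = "rad t"
  define p where "p = \<kappa> powr (sqrt (real ?r) / 4 - 1 / 2)"
  have r: "1 \<le> ?r" "4 * (2 * real ?r + 1) \<le> t\<^sup>2 * p" using rad_large[OF t(1,2)] by (auto simp: p_def)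
  have p: "p > 0" using \<kappa>_pos by (simp add: p_def)
  have inv: "\<kappa> powr (- (sqrt (real ?r) / 4 - 1 / 2)) = 1 / p" unfolding p_def by (rule powr_minus_divide)
  have bound: "4 * (2 * real ?r + 1) * x \<le> t\<^sup>2" if "x \<le> 1 / p" for x
  proof -
    have "4 * (2 * real ?r + 1) * x \<le> 4 * (2 * real ?r + 1) * (1 / p)" using that by (intro mult_left_mono) auto
    also have "\<dots> \<le> t\<^sup>2 * p * (1 / p)" using r(2) p by (intro mult_right_mono) auto
    finally show ?thesis using p by simp
  qed
  have "wt ?r * \<kappa> powr (wx l - wx (l - ?r - 1)) = \<kappa> powr (- wx ?r + (wx l - wx (l - ?r - 1)))"
    unfolding wt_def powr_add ..
  also have "\<dots> \<le> 1 / p" unfolding inv[symmetric]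
    using wx_window[OF r(1) t(3)] \<kappa>_pos by (intro powr_mono) auto
  finally show "4 * (2 * real ?r + 1) * (wt ?r * \<kappa> powr (wx l - wx (l - ?r - 1))) \<le> t\<^sup>2" by (rule bound)
  have "\<kappa> powr (3/2 + wx l / 2 - wx (l - ?r)) \<le> 1 / p" unfolding inv[symmetric]
    using wx_source[OF r(1) t(3)] \<kappa>_pos by (intro powr_mono) auto
  then show "4 * (2 * real ?r + 1) * \<kappa> powr (3/2 + wx l / 2 - wx (l - ?r)) \<le> t\<^sup>2" by (rule bound)
qed

text \<open>Off the wells the recursion itself contracts, as V - E >= 4 \<kappa>. A site in a well
  is, modulo 1, a phase at distance t >= 2 s from \<theta>c by the Diophantine condition, so
  \<open>IH\<close> provides a window with D >= t^2 and decay inside. The case S = 0 serves the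
  solutions, the case \<epsilon> = 1/2 their differences.\<close>

lemma orbit_max_principle:
  fixes h :: "nat \<Rightarrow> real"
  assumes E: "E < Es" and \<theta>c: "\<theta>c \<in> well" and \<theta>: "\<theta> \<in> well" "\<bar>\<theta> - \<theta>c\<bar> \<le> s" and s: "s \<le> 2 * \<rho>" "s = 0 \<or> N \<le> rad s"
    and IH: "\<And>\<eta>. \<eta> \<in> well \<Longrightarrow> 0 < \<bar>\<eta> - \<theta>c\<bar> \<Longrightarrow> 2 * s \<le> \<bar>\<eta> - \<theta>c\<bar> \<Longrightarrow> nonres E \<theta>c \<eta>"
    and hN: "\<And>k. N < k \<Longrightarrow> h k = 0" and M: "0 \<le> M" and h0: "\<bar>h 0\<bar> \<le> M"
    and \<epsilon>: "0 \<le> \<epsilon>" "\<epsilon> \<le> 1" and S: "0 \<le> S" "S = 0 \<or> \<epsilon> = 1 / 2 \<and> M = S * \<kappa> powr (-3/2)"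
    and F: "\<And>k. 1 \<le> k \<Longrightarrow> k \<le> N \<Longrightarrow> \<bar>(V (\<theta> + \<omega> * real k) - E) * h k - h (Suc k) - h (k - 1)\<bar> \<le> S * wt k"
  shows "\<bar>h k\<bar> \<le> M * \<kappa> powr (- \<epsilon> * wx k)"
proof -
  define W where "W k = \<kappa> powr (- \<epsilon> * wx k)" for k
  have W: "0 < W k" for k using \<kappa>_pos by (simp add: W_def)
  have W0: "W 0 = 1" using \<kappa>_pos by (simp add: W_def wx_0)
  have Wanti: "W j \<le> W i" if "i \<le> j" for i j
    unfolding W_def using \<kappa>_pos wx_mono[OF that] \<epsilon> by (intro powr_mono) (auto intro: mult_left_mono)
  have Wratio: "W i \<le> W k * \<kappa> powr (wx k - wx i)" if "i \<le> k" for i k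
  proof -
    have "\<epsilon> * (wx k - wx i) \<le> 1 * (wx k - wx i)" using \<epsilon> wx_mono[OF that] by (intro mult_right_mono) auto
    then have "W i \<le> \<kappa> powr (- \<epsilon> * wx k + (wx k - wx i))"
      unfolding W_def using \<kappa>_pos by (intro powr_mono) (auto simp: algebra_simps)
    then show ?thesis unfolding W_def powr_add .
  qed
  have "\<bar>h k\<bar> \<le> M * W k"
  proof (rule max_principle[where N=N])
    show "\<bar>h 0\<bar> \<le> M * W 0" using h0 W0 by simp
    fix k assume k: "1 \<le> k" "k \<le> N"
    define F' where "F' k = (V (\<theta> + \<omega> * real k) - E) * h k - h (Suc k) - h (k - 1)" for k
    show "\<exists>i j \<alpha> \<beta> t. i < k \<and> 0 \<le> \<alpha> \<and> 0 \<le> \<beta> \<and> \<bar>h k\<bar> \<le> \<alpha> * \<bar>h i\<bar> + \<beta> * \<bar>h j\<bar> + t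
        \<and> \<alpha> * W i + \<beta> * W j \<le> W k / 2 \<and> t \<le> M * W k / 2"
    proof (cases "\<exists>j::int. \<bar>\<theta> + \<omega> * real k - m - of_int j\<bar> \<le> \<rho>")
      case False
      have a: "4 * \<kappa> \<le> V (\<theta> + \<omega> * real k) - E"
        using nonwell[of "\<theta> + \<omega> * real k"] False Es_le E by (force simp: not_le)
      have "4 * \<kappa> * \<bar>h k\<bar> \<le> (V (\<theta> + \<omega> * real k) - E) * \<bar>h k\<bar>" using a by (intro mult_right_mono) auto
      also have "\<dots> = \<bar>(V (\<theta> + \<omega> * real k) - E) * h k\<bar>" using a \<kappa>_pos by (simp add: abs_mult)
      also have "\<dots> = \<bar>F' k + h (Suc k) + h (k - 1)\<bar>" by (simp add: F'_def)
      also have "\<dots> \<le> S * wt k + \<bar>h (Suc k)\<bar> + \<bar>h (k - 1)\<bar>" using F[OF k] by (simp add: F'_def)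
      finally have hk: "\<bar>h k\<bar> \<le> 1 / (4 * \<kappa>) * \<bar>h (k - 1)\<bar> + 1 / (4 * \<kappa>) * \<bar>h (Suc k)\<bar> + S * wt k / (4 * \<kappa>)"
        using \<kappa>_pos by (simp add: field_simps)
      have w1: "W (k - 1) \<le> W k * \<kappa>"
      proof -
        have "wx k - wx (k - 1) \<le> 1" using wx_step[of "k - 1"] k by simp
        then have "\<kappa> powr (wx k - wx (k - 1)) \<le> \<kappa> powr 1" using \<kappa>_pos by (intro powr_mono) auto
        then have "W k * \<kappa> powr (wx k - wx (k - 1)) \<le> W k * \<kappa>" using W[of k] \<kappa>_pos by (intro mult_left_mono) auto
        then show ?thesis using Wratio[of "k - 1" k] by simp
      qed
      have w2: "W (Suc k) \<le> W k * \<kappa>"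
      proof -
        have "W k * 1 \<le> W k * \<kappa>" using \<kappa>_pos W[of k] by (intro mult_left_mono) auto
        then show ?thesis using Wanti[of k "Suc k"] by simp
      qed
      have ww: "1 / (4 * \<kappa>) * W (k - 1) + 1 / (4 * \<kappa>) * W (Suc k) \<le> W k / 2"
        using w1 w2 \<kappa>_pos by (simp add: field_simps)
      have tt: "S * wt k / (4 * \<kappa>) \<le> M * W k / 2"
      proof (cases "S = 0")
        case True then show ?thesis using M W[of k] by simp
      next
        case False
        then have eM: "\<epsilon> = 1 / 2" "M = S * \<kappa> powr (-3/2)" using S by auto
        \<comment> \<open>Origin of the power -3/2: 1 from the division by \<kappa>, and 1/2 from wx
          k / 2 with wx k >= 1.\<close>
        have "wt k = \<kappa> powr (- wx k / 2) * W k" unfolding wt_def W_def eM by (simp flip: powr_add)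
        moreover have "\<kappa> powr (- wx k / 2 - 1) = \<kappa> powr (- wx k / 2) / \<kappa>" using \<kappa>_pos by (simp add: powr_diff)
        ultimately have "wt k / \<kappa> = \<kappa> powr (- wx k / 2 - 1) * W k" by simp
        also have "\<dots> \<le> \<kappa> powr (-3/2) * W k"
          using wx_ge_1[OF k(1)] k \<kappa>_pos W[of k] by (intro mult_right_mono powr_mono) auto
        finally have "wt k / \<kappa> \<le> \<kappa> powr (-3/2) * W k" .
        then have "S * (wt k / \<kappa>) \<le> S * (\<kappa> powr (-3/2) * W k)" using S by (intro mult_left_mono)
        then have "S * wt k / \<kappa> \<le> M * W k" by (simp add: eM mult_ac)
        moreover have "0 \<le> S * wt k / \<kappa>" using S wt_pos[of k] \<kappa>_pos by simp
        ultimately show ?thesis by simp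
      qed
      show ?thesis
        using hk ww tt k \<kappa>_pos
        by (intro exI[of _ "k - 1"] exI[of _ "Suc k"] exI[of _ "1 / (4 * \<kappa>)"] exI[of _ "S * wt k / (4 * \<kappa>)"]) auto
    next
      case True
      then obtain j :: int where j: "\<bar>\<theta> + \<omega> * real k - m - of_int j\<bar> \<le> \<rho>" by blast
      define \<eta> where "\<eta> = \<theta> + \<omega> * real k + of_int (-j)"
      define t where "t = \<bar>\<eta> - \<theta>c\<bar>"
      have \<eta>w: "\<eta> \<in> well" using j by (auto simp: \<eta>_def abs_le_iff)
      have t2: "t \<le> 2 * \<rho>" using \<eta>w \<theta>c by (auto simp: t_def abs_le_iff)
      have "\<bar>\<omega> * real k - of_int j\<bar> - s \<le> t" using \<theta>(2) by (simp add: t_def \<eta>_def)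
      \<comment> \<open>The last part keeps the window, of radius at most k / 16, away from the
        boundary site 0.\<close>
      then have t: "0 < t" "2 * s \<le> t" "16 * rad t \<le> k"
        using rad_dioph[of k s j t] k s t2 \<theta>(2) by (auto simp: abs_le_iff)
      define r where "r = rad t"
      have r: "1 \<le> r" "r < k" using rad_large[OF t(1) t2] t(3) by (auto simp: r_def)
      have nr: "decay E r \<eta>" "t\<^sup>2 \<le> DN V \<omega> E r \<eta>"
        using IH[OF \<eta>w] t by (auto simp: nonres_def t_def r_def)
      have shift1: "pp V \<omega> E n (\<theta> + \<omega> * real k) i = pp V \<omega> E n \<eta> i"
        "pp V (-\<omega>) E n (\<theta> + \<omega> * real k) i = pp V (-\<omega>) E n \<eta> i"
        "DN V \<omega> E n (\<theta> + \<omega> * real k) = DN V \<omega> E n \<eta>" for n i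
        unfolding \<eta>_def by (simp_all only: pp_int hill.pp_int[OF hill_neg] DN_int)
      have dec: "pp V \<omega> E n \<eta> i \<le> wt i" "pp V (-\<omega>) E n \<eta> i \<le> wt i" if "n \<le> r" for n i
        using nr(1) that by (auto simp: decay_def)
      have dec1: "pp V \<omega> E n \<eta> i \<le> 1" "pp V (-\<omega>) E n \<eta> i \<le> 1" if "n \<le> r" for n i
        using dec[OF that, of i] wt_le_1[of i] by linarith+
      have est: "t\<^sup>2 * \<bar>h k\<bar> \<le> wt r * \<bar>h (k - r - 1)\<bar> + wt r * \<bar>h (k + r + 1)\<bar> + (2 * real r + 1) * (S * wt (k - r))"
      proof (rule window_estimate[where h=h and d="t\<^sup>2" and \<theta>=\<theta>, OF E r(2) k(2) hN, unfolded shift1])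
        fix i assume i: "k - r \<le> i" "1 \<le> i" "i \<le> N"
        show "\<bar>(V (\<theta> + \<omega> * real i) - E) * h i - h (Suc i) - h (i - 1)\<bar> \<le> S * wt (k - r)"
          using F[OF i(2,3)] mult_left_mono[OF wt_antimono[OF i(1)] S(1)] by linarith
      qed (use t nr dec dec1 in auto)
      \<comment> \<open>The weight decreases, so the right end of the window is no worse than the
        left end.\<close>
      have w1: "W (k - r - 1) + W (k + r + 1) \<le> 2 * (W k * \<kappa> powr (wx k - wx (k - r - 1)))"
      proof -
        have "W (k - r - 1) \<le> W k * \<kappa> powr (wx k - wx (k - r - 1))" "W (k + r + 1) \<le> W (k - r - 1)"
          by (rule Wratio, simp, rule Wanti, simp)
        then show ?thesis by linarith
      qed
      have A: "4 * (2 * real r + 1) * (wt r * \<kappa> powr (wx k - wx (k - r - 1))) \<le> t\<^sup>2"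
        and B: "4 * (2 * real r + 1) * \<kappa> powr (3/2 + wx k / 2 - wx (k - r)) \<le> t\<^sup>2"
        using wt_ratio_window[OF t(1) t2 t(3)] by (auto simp: r_def)
      define z where "z = wt r * \<kappa> powr (wx k - wx (k - r - 1))"
      have z0: "0 \<le> z" using wt_pos[of r] by (simp add: z_def)
      have "4 * z \<le> 4 * (2 * real r + 1) * z" using z0 by (simp add: algebra_simps)
      then have z: "4 * z \<le> t\<^sup>2" using A unfolding z_def by linarith
      have "wt r * (W (k - r - 1) + W (k + r + 1)) \<le> wt r * (2 * (W k * \<kappa> powr (wx k - wx (k - r - 1))))"
        using w1 wt_pos[of r] by (intro mult_left_mono) auto
      also have "\<dots> = (4 * z) * (W k / 2)" by (simp add: z_def)
      also have "\<dots> \<le> t\<^sup>2 * (W k / 2)" using z W[of k] by (intro mult_right_mono) auto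
      finally have ww: "wt r * (W (k - r - 1) + W (k + r + 1)) \<le> t\<^sup>2 * (W k / 2)" .
      have tt: "(2 * real r + 1) * (S * wt (k - r)) \<le> t\<^sup>2 * (M * W k / 2)"
      proof (cases "S = 0")
        case True then show ?thesis using M W[of k] by simp
      next
        case False
        then have eM: "\<epsilon> = 1 / 2" "M = S * \<kappa> powr (-3/2)" using S by auto
        have x: "wt (k - r) = \<kappa> powr (3/2 + wx k / 2 - wx (k - r)) * (\<kappa> powr (-3/2) * W k)"
          unfolding wt_def W_def eM by (simp flip: powr_add)
        have "(2 * real r + 1) * (S * wt (k - r)) = ((2 * real r + 1) * \<kappa> powr (3/2 + wx k / 2 - wx (k - r))) * (M * W k)"
          unfolding x eM by (simp add: mult_ac)
        also have "\<dots> \<le> (t\<^sup>2 / 4) * (M * W k)" using B M W[of k] by (intro mult_right_mono) (auto simp: algebra_simps)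
        also have "\<dots> \<le> (t\<^sup>2 / 2) * (M * W k)" using M W[of k] by (intro mult_right_mono) auto
        finally show ?thesis by simp
      qed
      have t20: "0 < t\<^sup>2" using t by simp
      have quot: "x \<le> a / D * y + a / D * z + c / D" if "0 < D" "D * x \<le> a * y + a * z + c" for D x y z a c :: real
        using that by (simp add: field_simps)
      show ?thesis
      proof (intro exI conjI)
        show "k - r - 1 < k" using r by linarith
        show "0 \<le> wt r / t\<^sup>2" "0 \<le> wt r / t\<^sup>2" using wt_pos[of r] by auto
        show "\<bar>h k\<bar> \<le> wt r / t\<^sup>2 * \<bar>h (k - r - 1)\<bar> + wt r / t\<^sup>2 * \<bar>h (k + r + 1)\<bar> + (2 * real r + 1) * (S * wt (k - r)) / t\<^sup>2"
          by (rule quot[OF t20 est])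
        show "wt r / t\<^sup>2 * W (k - r - 1) + wt r / t\<^sup>2 * W (k + r + 1) \<le> W k / 2"
          using ww t20 by (simp add: field_simps)
        show "(2 * real r + 1) * (S * wt (k - r)) / t\<^sup>2 \<le> M * W k / 2"
          using tt t20 by (simp add: field_simps)
      qed
    qed
  qed (use W M hN in auto)
  then show ?thesis by (simp add: W_def)
qed

end

section \<open>Induction over scales\<close>

lemma sum_geometric_half:
  fixes q :: real assumes "0 \<le> q" "q \<le> 1 / 2" shows "(\<Sum>k<N. q ^ k) \<le> 2"
proof -
  have "(\<Sum>k<N. q ^ k) \<le> (\<Sum>k. q ^ k)"
    using assms by (intro sum_le_suminf summable_geometric) auto
  also have "\<dots> = 1 / (1 - q)" using assms by (intro suminf_geometric) auto
  also have "\<dots> \<le> 1 / (1 / 2)" using assms by (intro divide_left_mono) auto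
  finally show ?thesis by simp
qed

context core begin

lemma decay_right:
  assumes E: "E < Es" and \<theta>c: "\<theta>c \<in> well" and \<theta>: "\<theta> \<in> well" "\<bar>\<theta> - \<theta>c\<bar> \<le> s" and s: "s \<le> 2 * \<rho>" "s = 0 \<or> N \<le> rad s"
    and IH: "\<And>\<eta>. \<eta> \<in> well \<Longrightarrow> 0 < \<bar>\<eta> - \<theta>c\<bar> \<Longrightarrow> 2 * s \<le> \<bar>\<eta> - \<theta>c\<bar> \<Longrightarrow> nonres E \<theta>c \<eta>"
    and n: "n \<le> N"
  shows "pp V \<omega> E n \<theta> k \<le> wt k"
proof -
  have "\<bar>pp V \<omega> E n \<theta> k\<bar> \<le> 1 * \<kappa> powr (- 1 * wx k)"
  proof (rule orbit_max_principle[OF E \<theta>c \<theta> s(1) _ IH, where N=n and S=0])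
    show "pp V \<omega> E n \<theta> k = 0" if "n < k" for k using that by (simp add: pp_def cfprod_beyond)
    show "\<bar>pp V \<omega> E n \<theta> 0\<bar> \<le> 1" by (simp add: pp_0)
    fix k assume k: "1 \<le> k" "k \<le> n"
    have "ap V \<omega> E \<theta> (k - 1) * pp V \<omega> E n \<theta> (Suc (k - 1)) = pp V \<omega> E n \<theta> (Suc (Suc (k - 1))) + pp V \<omega> E n \<theta> (k - 1)"
      unfolding pp_def using k by (intro cfprod_rec kf_cfpos E) auto
    moreover have "ap V \<omega> E \<theta> (k - 1) = V (\<theta> + \<omega> * real k) - E" using k by (simp add: ap_def)
    ultimately show "\<bar>(V (\<theta> + \<omega> * real k) - E) * pp V \<omega> E n \<theta> k - pp V \<omega> E n \<theta> (Suc k) - pp V \<omega> E n \<theta> (k - 1)\<bar> \<le> 0 * wt k"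
      using k by simp
  qed (use s n in auto)
  then show ?thesis by (simp add: wt_def)
qed

lemma decay_both:
  assumes E: "E < Es" and \<theta>c: "\<theta>c \<in> well" and \<theta>: "\<theta> \<in> well" "\<bar>\<theta> - \<theta>c\<bar> \<le> s" and s: "s \<le> 2 * \<rho>" "s = 0 \<or> N \<le> rad s"
    and IH: "\<And>\<eta>. \<eta> \<in> well \<Longrightarrow> 0 < \<bar>\<eta> - \<theta>c\<bar> \<Longrightarrow> 2 * s \<le> \<bar>\<eta> - \<theta>c\<bar> \<Longrightarrow> nonres E \<theta>c \<eta>"
  shows "decay E N \<theta>"
proof -
  have E': "E < Estar V (-\<omega>)" using E by (simp add: Estar_neg)
  have "pp V \<omega> E n \<theta> k \<le> wt k" if "n \<le> N" for n k
    using decay_right[OF E \<theta>c \<theta> s IH that] .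
  moreover have "pp V (-\<omega>) E n \<theta> k \<le> wt k" if "n \<le> N" for n k
    using core.decay_right[OF core_neg E' \<theta>c \<theta> s, unfolded nonres_neg, OF IH that] .
  ultimately show ?thesis by (auto simp: decay_def)
qed

text \<open>The difference solves the recursion at \<theta>1 with zero boundary values; its source
  is the difference of the potentials, at most B1 s, times the decaying solution at
  \<theta>2.\<close>

lemma pp_diff:
  assumes E: "E < Es" and \<theta>c: "\<theta>c \<in> well" and \<theta>1: "\<theta>1 \<in> well" "\<bar>\<theta>1 - \<theta>c\<bar> \<le> s" and \<theta>2: "\<bar>\<theta>1 - \<theta>2\<bar> \<le> s"
    and s: "s \<le> 2 * \<rho>" "s = 0 \<or> N \<le> rad s"
    and IH: "\<And>\<eta>. \<eta> \<in> well \<Longrightarrow> 0 < \<bar>\<eta> - \<theta>c\<bar> \<Longrightarrow> 2 * s \<le> \<bar>\<eta> - \<theta>c\<bar> \<Longrightarrow> nonres E \<theta>c \<eta>"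
    and dec: "\<And>k. pp V \<omega> E N \<theta>2 k \<le> wt k"
  shows "\<bar>pp V \<omega> E N \<theta>1 k - pp V \<omega> E N \<theta>2 k\<bar> \<le> (B1 * s * \<kappa> powr (-3/2)) * \<kappa> powr (- (1/2) * wx k)"
proof (rule orbit_max_principle[OF E \<theta>c \<theta>1 s IH, where S="B1 * s"])
  have s0: "0 \<le> s" using \<theta>1 by linarith
  show "pp V \<omega> E N \<theta>1 k - pp V \<omega> E N \<theta>2 k = 0" if "N < k" for k using that by (simp add: pp_def cfprod_beyond)
  show "0 \<le> B1 * s" using B1 s0 by simp
  then show "0 \<le> B1 * s * \<kappa> powr (-3/2)" by simp
  then show "\<bar>pp V \<omega> E N \<theta>1 0 - pp V \<omega> E N \<theta>2 0\<bar> \<le> B1 * s * \<kappa> powr (-3/2)" by (simp add: pp_0)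
  fix k assume k: "1 \<le> k" "k \<le> N"
  have rec: "(V (\<theta> + \<omega> * real k) - E) * pp V \<omega> E N \<theta> k = pp V \<omega> E N \<theta> (Suc k) + pp V \<omega> E N \<theta> (k - 1)" for \<theta>
  proof -
    have "ap V \<omega> E \<theta> (k - 1) * pp V \<omega> E N \<theta> (Suc (k - 1)) = pp V \<omega> E N \<theta> (Suc (Suc (k - 1))) + pp V \<omega> E N \<theta> (k - 1)"
      unfolding pp_def using k by (intro cfprod_rec kf_cfpos E) auto
    moreover have "ap V \<omega> E \<theta> (k - 1) = V (\<theta> + \<omega> * real k) - E" using k by (simp add: ap_def)
    ultimately show ?thesis using k by simp
  qed
  have "(V (\<theta>1 + \<omega> * real k) - E) * (pp V \<omega> E N \<theta>1 k - pp V \<omega> E N \<theta>2 k)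
      - (pp V \<omega> E N \<theta>1 (Suc k) - pp V \<omega> E N \<theta>2 (Suc k)) - (pp V \<omega> E N \<theta>1 (k - 1) - pp V \<omega> E N \<theta>2 (k - 1))
    = (V (\<theta>2 + \<omega> * real k) - V (\<theta>1 + \<omega> * real k)) * pp V \<omega> E N \<theta>2 k"
    using rec[of \<theta>1] rec[of \<theta>2] by (simp add: algebra_simps)
  also have "\<bar>\<dots>\<bar> \<le> (B1 * s) * wt k"
    unfolding abs_mult
  proof (rule mult_mono)
    have "\<bar>V (\<theta>2 + \<omega> * real k) - V (\<theta>1 + \<omega> * real k)\<bar> \<le> B1 * \<bar>\<theta>2 - \<theta>1\<bar>"
      using V_lipschitz[of "\<theta>2 + \<omega> * real k" "\<theta>1 + \<omega> * real k"] by simp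
    also have "\<dots> \<le> B1 * s" using \<theta>2 B1 by (intro mult_left_mono) auto
    finally show "\<bar>V (\<theta>2 + \<omega> * real k) - V (\<theta>1 + \<omega> * real k)\<bar> \<le> B1 * s" .
    show "\<bar>pp V \<omega> E N \<theta>2 k\<bar> \<le> wt k" using dec[of k] pp_nonneg[OF E, of N \<theta>2 k] by simp
  qed (use B1 s0 in auto)
  finally show "\<bar>(V (\<theta>1 + \<omega> * real k) - E) * (pp V \<omega> E N \<theta>1 k - pp V \<omega> E N \<theta>2 k)
      - (pp V \<omega> E N \<theta>1 (Suc k) - pp V \<omega> E N \<theta>2 (Suc k)) - (pp V \<omega> E N \<theta>1 (k - 1) - pp V \<omega> E N \<theta>2 (k - 1))\<bar> \<le> B1 * s * wt k" .
qed auto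

lemma \<kappa>_34: "\<kappa> powr (-3/4) \<le> 1 / 2"
proof -
  \<comment> \<open>The fourth power of the claim is 16 <= \<kappa>^3, true since \<kappa> >=
    3.\<close>
  have "(2::real) = (16::real) powr (1/4)" using powr_powr[of 2 4 "1/4"] by (simp add: powr_numeral)
  also have "\<dots> \<le> (\<kappa> ^ 3) powr (1/4)"
    using power_mono[OF \<kappa>, of 3] by (intro powr_mono2) auto
  also have "\<dots> = \<kappa> powr (3/4)" using \<kappa>_pos by (simp add: powr_powr flip: powr_numeral)
  finally have "2 \<le> \<kappa> powr (3/4)" .
  then have "1 / \<kappa> powr (3/4) \<le> 1 / 2" by (intro divide_left_mono) auto
  then show ?thesis using powr_minus_divide[of \<kappa> "3/4"] by simp
qed

lemma sum_wt_32: "(\<Sum>k<N. wt (Suc k) * \<kappa> powr (- (1/2) * wx (Suc k))) \<le> 2 * \<kappa> powr (-3/2)"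
proof -
  have "wt (Suc k) * \<kappa> powr (- (1/2) * wx (Suc k)) \<le> \<kappa> powr (-3/2) * (\<kappa> powr (-3/4)) ^ k" for k
  proof -
    have "wt (Suc k) * \<kappa> powr (- (1/2) * wx (Suc k)) = \<kappa> powr (- (3/2) * wx (Suc k))"
      unfolding wt_def by (simp flip: powr_add)
    also have "\<dots> \<le> \<kappa> powr (-3/2 + (-3/4) * real k)"
      using wx_ge_1[of "Suc k"] \<kappa>_pos by (intro powr_mono) auto
    also have "\<dots> = \<kappa> powr (-3/2) * (\<kappa> powr (-3/4)) ^ k"
      unfolding powr_add using \<kappa>_pos by (simp add: powr_powr flip: powr_realpow)
    finally show ?thesis .
  qed
  then have "(\<Sum>k<N. wt (Suc k) * \<kappa> powr (- (1/2) * wx (Suc k))) \<le> (\<Sum>k<N. \<kappa> powr (-3/2) * (\<kappa> powr (-3/4)) ^ k)"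
    by (intro sum_mono)
  also have "\<dots> = \<kappa> powr (-3/2) * (\<Sum>k<N. (\<kappa> powr (-3/4)) ^ k)" by (simp add: sum_distrib_left)
  also have "\<dots> \<le> \<kappa> powr (-3/2) * 2" using \<kappa>_34 by (intro mult_left_mono sum_geometric_half) auto
  finally show ?thesis by simp
qed

lemma wt_sq: "(wt (Suc k))\<^sup>2 \<le> (1 / \<kappa>\<^sup>2) * (1 / \<kappa>) ^ k"
proof -
  have "(wt (Suc k))\<^sup>2 = \<kappa> powr (- 2 * wx (Suc k))"
    unfolding wt_def power2_eq_square by (simp flip: powr_add)
  also have "\<dots> \<le> \<kappa> powr (- (2 + real k))"
    using wx_ge_1[of "Suc k"] \<kappa>_pos by (intro powr_mono) auto
  also have "\<dots> = (1 / \<kappa>\<^sup>2) * (1 / \<kappa>) ^ k"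
    using \<kappa>_pos unfolding powr_minus_divide by (simp add: powr_add powr_realpow powr_numeral power_one_over)
  finally show ?thesis .
qed

lemma sum_wt_sq: "(\<Sum>k<N. (wt (Suc k))\<^sup>2) \<le> 2 / \<kappa>\<^sup>2"
proof -
  have "(\<Sum>k<N. (wt (Suc k))\<^sup>2) \<le> (\<Sum>k<N. (1 / \<kappa>\<^sup>2) * (1 / \<kappa>) ^ k)" by (intro sum_mono wt_sq)
  also have "\<dots> = (1 / \<kappa>\<^sup>2) * (\<Sum>k<N. (1 / \<kappa>) ^ k)" by (simp add: sum_distrib_left)
  also have "\<dots> \<le> (1 / \<kappa>\<^sup>2) * 2" using \<kappa> by (intro mult_left_mono sum_geometric_half) (auto simp: field_simps)
  finally show ?thesis by simp
qed

text \<open>Tangents at both endpoints are evaluated at the midpoint. The loss is quadratic in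
  \<open>s\<close>, as the increments cancel to second order and the weights differ by O(s). By
  \<open>small_coupling\<close> each fraction spoils at most a quarter of the convexity \<gamma> s^2
  of V.\<close>

lemma kf_midpoint:
  assumes E: "E < Es" and \<theta>c: "\<theta>c \<in> well" and \<theta>: "\<theta> \<in> well" and se: "s = \<bar>\<theta> - \<theta>c\<bar>"
    and s: "s \<le> 2 * \<rho>" "N \<le> rad s"
    and IH: "\<And>\<eta>. \<eta> \<in> well \<Longrightarrow> 0 < \<bar>\<eta> - \<theta>c\<bar> \<Longrightarrow> 2 * s \<le> \<bar>\<eta> - \<theta>c\<bar> \<Longrightarrow> nonres E \<theta>c \<eta>"
  shows "(kf V \<omega> E N \<theta>c + kf V \<omega> E N \<theta>) / 2 - (B1\<^sup>2 / \<kappa> ^ 3 + B2 / (2 * \<kappa>\<^sup>2)) * s\<^sup>2 \<le> kf V \<omega> E N ((\<theta>c + \<theta>) / 2)"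
proof -
  define \<mu> where "\<mu> = (\<theta>c + \<theta>) / 2"
  define P where "P k = pp V \<omega> E N \<theta> (Suc k)" for k
  define Q where "Q k = pp V \<omega> E N \<theta>c (Suc k)" for k
  define x where "x k = ap V \<omega> E \<mu> k - ap V \<omega> E \<theta> k" for k
  define y where "y k = ap V \<omega> E \<mu> k - ap V \<omega> E \<theta>c k" for k
  have s0: "0 \<le> s" using se by simp
  have dP: "P k \<le> wt (Suc k)" "0 \<le> P k" and dQ: "Q k \<le> wt (Suc k)" "0 \<le> Q k" for k
    using decay_right[OF E \<theta>c \<theta>, of s N N "Suc k"] decay_right[OF E \<theta>c \<theta>c, of s N N "Suc k"] se s IH pp_nonneg[OF E]
    by (auto simp: P_def Q_def)
  have df: "\<bar>P k - Q k\<bar> \<le> (B1 * s * \<kappa> powr (-3/2)) * \<kappa> powr (- (1/2) * wx (Suc k))" for k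
    unfolding P_def Q_def
    by (rule pp_diff[OF E \<theta>c \<theta>]) (use se s IH decay_right[OF E \<theta>c \<theta>c, of s N N] in auto)
  have xb: "\<bar>x k\<bar> \<le> B1 * (s / 2)" for k
  proof -
    have "\<bar>\<mu> - \<theta>\<bar> = s / 2" using se by (simp add: \<mu>_def abs_if field_simps)
    then show ?thesis using ap_diff_le[of E \<mu> k \<theta>] unfolding x_def by (simp only:)
  qed
  have xy: "\<bar>x k + y k\<bar> \<le> B2 * s\<^sup>2 / 2" for k
  proof -
    define z where "z = \<mu> + \<omega> * real (Suc k)"
    define d where "d = (\<theta> - \<theta>c) / 2"
    have e: "\<theta> + \<omega> * real (Suc k) = z + d" "\<theta>c + \<omega> * real (Suc k) = z + (-d)" by (auto simp: z_def d_def \<mu>_def field_simps)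
    have "x k + y k = - (V (z + d) - V z - d * V' z) - (V (z + (-d)) - V z - (-d) * V' z)"
      unfolding x_def y_def ap_def e z_def[symmetric] by simp
    moreover have "\<bar>- a - b\<bar> \<le> 2 * c" if "\<bar>a\<bar> \<le> c" "\<bar>b\<bar> \<le> c" for a b c :: real using that by linarith
    ultimately have "\<bar>x k + y k\<bar> \<le> 2 * (B2 * d\<^sup>2)" using V_taylor[of z d] V_taylor[of z "-d"] by simp
    moreover have "d\<^sup>2 = s\<^sup>2 / 4" using se by (simp add: d_def power_divide)
    ultimately show ?thesis by simp
  qed
  have summand: "(P k)\<^sup>2 * x k + (Q k)\<^sup>2 * y k \<le> (B1\<^sup>2 * s\<^sup>2 * \<kappa> powr (-3/2)) * (wt (Suc k) * \<kappa> powr (- (1/2) * wx (Suc k))) + (B2 * s\<^sup>2 / 2) * (wt (Suc k))\<^sup>2" for k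
  proof -
    \<comment> \<open>Separates a difference of weights, paired with a first-order increment, from a
      second-order increment with a common weight.\<close>
    have "(P k)\<^sup>2 * x k + (Q k)\<^sup>2 * y k = x k * ((P k + Q k) * (P k - Q k)) + (x k + y k) * (Q k)\<^sup>2"
      by (simp add: power2_eq_square algebra_simps)
    also have "x k * ((P k + Q k) * (P k - Q k)) \<le> (B1 * (s / 2)) * ((2 * wt (Suc k)) * ((B1 * s * \<kappa> powr (-3/2)) * \<kappa> powr (- (1/2) * wx (Suc k))))"
    proof -
      have "x k * ((P k + Q k) * (P k - Q k)) \<le> \<bar>x k\<bar> * (\<bar>P k + Q k\<bar> * \<bar>P k - Q k\<bar>)"
        by (metis abs_ge_self abs_mult)
      also have "\<dots> \<le> (B1 * (s / 2)) * ((2 * wt (Suc k)) * ((B1 * s * \<kappa> powr (-3/2)) * \<kappa> powr (- (1/2) * wx (Suc k))))"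
        using xb[of k] df[of k] dP[of k] dQ[of k] B1 s0 wt_pos[of "Suc k"] by (intro mult_mono) auto
      finally show ?thesis .
    qed
    also have "(x k + y k) * (Q k)\<^sup>2 \<le> (B2 * s\<^sup>2 / 2) * (wt (Suc k))\<^sup>2"
      using dQ[of k] B2 by (intro mult_mono power_mono abs_le_D1[OF xy]) auto
    finally show ?thesis by (simp add: power2_eq_square mult_ac)
  qed
  have "(\<Sum>k<N. (P k)\<^sup>2 * x k + (Q k)\<^sup>2 * y k)
     \<le> (\<Sum>k<N. (B1\<^sup>2 * s\<^sup>2 * \<kappa> powr (-3/2)) * (wt (Suc k) * \<kappa> powr (- (1/2) * wx (Suc k))) + (B2 * s\<^sup>2 / 2) * (wt (Suc k))\<^sup>2)"
    by (intro sum_mono summand)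
  also have "\<dots> = (B1\<^sup>2 * s\<^sup>2 * \<kappa> powr (-3/2)) * (\<Sum>k<N. wt (Suc k) * \<kappa> powr (- (1/2) * wx (Suc k))) + (B2 * s\<^sup>2 / 2) * (\<Sum>k<N. (wt (Suc k))\<^sup>2)"
    by (simp add: sum.distrib sum_distrib_left)
  also have "\<dots> \<le> (B1\<^sup>2 * s\<^sup>2 * \<kappa> powr (-3/2)) * (2 * \<kappa> powr (-3/2)) + (B2 * s\<^sup>2 / 2) * (2 / \<kappa>\<^sup>2)"
    using B2 by (intro add_mono mult_left_mono sum_wt_32 sum_wt_sq) auto
  also have "(B1\<^sup>2 * s\<^sup>2 * \<kappa> powr (-3/2)) * (2 * \<kappa> powr (-3/2)) = 2 * B1\<^sup>2 * s\<^sup>2 * \<kappa> powr (- 3)"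
    by (simp add: mult_ac flip: powr_add)
  also have "\<kappa> powr (- 3) = 1 / \<kappa> ^ 3" using \<kappa>_pos unfolding powr_minus_divide by simp
  finally have sum: "(\<Sum>k<N. (P k)\<^sup>2 * x k + (Q k)\<^sup>2 * y k) \<le> 2 * ((B1\<^sup>2 / \<kappa> ^ 3 + B2 / (2 * \<kappa>\<^sup>2)) * s\<^sup>2)"
    by (simp add: algebra_simps)
  have "kf V \<omega> E N \<theta> - (\<Sum>k<N. (P k)\<^sup>2 * x k) \<le> kf V \<omega> E N \<mu>"
    "kf V \<omega> E N \<theta>c - (\<Sum>k<N. (Q k)\<^sup>2 * y k) \<le> kf V \<omega> E N \<mu>"
    using tangent_N[OF E E, of N \<theta> \<mu>] tangent_N[OF E E, of N \<theta>c \<mu>] by (auto simp: P_def Q_def x_def y_def)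
  moreover have "(b + a) / 2 - T \<le> z" if "a - X \<le> z" "b - Y \<le> z" "X + Y \<le> 2 * T" for a b X Y T z :: real
    using that by (simp add: field_simps)
  ultimately show ?thesis using sum unfolding sum.distrib \<mu>_def[symmetric] by blast
qed

lemma wt_rad: assumes "0 < t" "t \<le> 2 * \<rho>" shows "12 * wt (rad t) \<le> t\<^sup>2"
proof -
  let ?r = "rad t"
  define p where "p = \<kappa> powr (sqrt (real ?r) / 4 - 1 / 2)"
  have r: "1 \<le> ?r" "4 * (2 * real ?r + 1) \<le> t\<^sup>2 * p" using rad_large[OF assms] by (auto simp: p_def)
  have p: "p > 0" using \<kappa>_pos by (simp add: p_def)
  have "wt ?r \<le> \<kappa> powr (- (sqrt (real ?r) / 4 - 1 / 2))"
    unfolding wt_def using \<kappa>_pos real_sqrt_ge_zero[of "real ?r"]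
    by (intro powr_mono) (auto simp: wx_def field_simps)
  also have "\<dots> = 1 / p" unfolding p_def by (rule powr_minus_divide)
  finally have "12 * wt ?r \<le> 12 * (1 / p)" by simp
  also have "\<dots> \<le> t\<^sup>2 * p * (1 / p)" using r p by (intro mult_right_mono) auto
  finally show ?thesis using p by simp
qed

text \<open>Each truncation error is a truncated tail, at most \<open>wt N\<close>, times a value of
  \<open>gg\<close>, which is at most 1 at a minimum point.\<close>

lemma DN_minimizer_le:
  assumes E: "E < Es" and min: "\<And>\<eta>. DD V \<omega> E \<theta>c \<le> DD V \<omega> E \<eta>" and dec: "decay E N \<theta>c"
  shows "DN V \<omega> E N \<theta>c \<le> DD V \<omega> E \<theta>c + 2 * wt N"
proof -
  have E': "E < Estar V (-\<omega>)" using E by (simp add: Estar_neg)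
  have d: "pp V \<omega> E N \<theta>c N \<le> wt N" "pp V (-\<omega>) E N \<theta>c N \<le> wt N" using dec by (auto simp: decay_def)
  have g: "gg V \<omega> E \<theta>c (Suc N) \<le> 1" "gg V (-\<omega>) E \<theta>c (Suc N) \<le> 1"
    using gg_le_1[OF E min] hill.gg_le_1[OF hill_neg E', of \<theta>c "Suc N"] min by (auto simp: DD_neg)
  have "ff V \<omega> E \<theta>c - kf V \<omega> E N \<theta>c \<le> 1 * wt N"
    unfolding truncation_error[OF E] using g d wt_pos[of N] pp_nonneg[OF E] by (intro mult_mono) auto
  moreover have "ff V (-\<omega>) E \<theta>c - kf V (-\<omega>) E N \<theta>c \<le> 1 * wt N"
    unfolding hill.truncation_error[OF hill_neg E'] using g d wt_pos[of N] hill.pp_nonneg[OF hill_neg E'] by (intro mult_mono) auto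
  ultimately show ?thesis by (simp add: DD_def DN_def)
qed

lemma scale_step:
  assumes E: "E < Es" and \<theta>c: "\<theta>c \<in> well" and min: "\<And>\<eta>. DD V \<omega> E \<theta>c \<le> DD V \<omega> E \<eta>"
    and \<theta>: "\<theta> \<in> well" and se: "s = \<bar>\<theta> - \<theta>c\<bar>" and s: "0 < s"
    and IH: "\<And>\<eta>. \<eta> \<in> well \<Longrightarrow> 0 < \<bar>\<eta> - \<theta>c\<bar> \<Longrightarrow> 2 * s \<le> \<bar>\<eta> - \<theta>c\<bar> \<Longrightarrow> nonres E \<theta>c \<eta>"
  shows "decay E (rad s) \<theta> \<and> DD V \<omega> E \<theta>c + s\<^sup>2 \<le> DN V \<omega> E (rad s) \<theta>"
proof -
  have E': "E < Estar V (-\<omega>)" using E by (simp add: Estar_neg)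
  have s2: "s \<le> 2 * \<rho>" using \<theta> \<theta>c se by (auto simp: abs_le_iff)
  define N where "N = rad s"
  define \<mu> where "\<mu> = (\<theta>c + \<theta>) / 2"
  have dec: "decay E N \<theta>c" "decay E N \<theta>"
    using decay_both[OF E \<theta>c \<theta>c, of s N] decay_both[OF E \<theta>c \<theta>, of s N] se s2 IH by (auto simp: N_def)
  have r: "(kf V \<omega> E N \<theta>c + kf V \<omega> E N \<theta>) / 2 - (B1\<^sup>2 / \<kappa> ^ 3 + B2 / (2 * \<kappa>\<^sup>2)) * s\<^sup>2 \<le> kf V \<omega> E N \<mu>"
    unfolding \<mu>_def by (rule kf_midpoint[OF E \<theta>c \<theta> se s2 _ IH]) (auto simp: N_def)
  have l: "(kf V (-\<omega>) E N \<theta>c + kf V (-\<omega>) E N \<theta>) / 2 - (B1\<^sup>2 / \<kappa> ^ 3 + B2 / (2 * \<kappa>\<^sup>2)) * s\<^sup>2 \<le> kf V (-\<omega>) E N \<mu>"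
    unfolding \<mu>_def by (rule core.kf_midpoint[OF core_neg E' \<theta>c \<theta> se s2, unfolded nonres_neg, OF _ IH]) (auto simp: N_def)
  have "s\<^sup>2 = (\<theta>c - \<theta>)\<^sup>2" using se by (simp add: power2_commute)
  then have c: "V \<mu> \<le> (V \<theta>c + V \<theta>) / 2 - \<gamma> * s\<^sup>2"
    unfolding \<mu>_def using well_convex[OF \<theta>c \<theta>] by simp
  have q: "(2 * (B1\<^sup>2 / \<kappa> ^ 3 + B2 / (2 * \<kappa>\<^sup>2))) * s\<^sup>2 \<le> (\<gamma> / 2) * s\<^sup>2"
    using small_coupling by (intro mult_right_mono) (auto simp: algebra_simps)
  have "DD V \<omega> E \<theta>c \<le> DN V \<omega> E N \<mu>" using min[of \<mu>] DD_le_DN[OF E, of \<mu> N] by linarith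
  also have "\<dots> \<le> (DN V \<omega> E N \<theta>c + DN V \<omega> E N \<theta>) / 2 - (\<gamma> / 2) * s\<^sup>2"
  proof -
    define Q where "Q = (B1\<^sup>2 / \<kappa> ^ 3 + B2 / (2 * \<kappa>\<^sup>2)) * s\<^sup>2"
    have "2 * Q \<le> (\<gamma> / 2) * s\<^sup>2" using q unfolding Q_def mult.assoc .
    then show ?thesis using r l c unfolding DN_def Q_def[symmetric] by (simp add: field_simps)
  qed
  \<comment> \<open>Twice the midpoint inequality, with D_N at \<theta>c replaced by \<delta> + 2 wt
    N. Then \<gamma> >= 2 and 12 wt N <= s^2 leave s^2.\<close>
  finally have "DD V \<omega> E \<theta>c + \<gamma> * s\<^sup>2 - 2 * wt N \<le> DN V \<omega> E N \<theta>"
    using DN_minimizer_le[OF E min dec(1)] by (simp add: field_simps)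
  moreover have "2 * s\<^sup>2 \<le> \<gamma> * s\<^sup>2" using \<gamma> by (intro mult_right_mono) auto
  moreover have "12 * wt N \<le> s\<^sup>2" unfolding N_def by (rule wt_rad[OF s s2])
  ultimately have "DD V \<omega> E \<theta>c + s\<^sup>2 \<le> DN V \<omega> E N \<theta>" using wt_pos[of N] by linarith
  then show ?thesis using dec by (simp add: N_def)
qed

lemma all_scales:
  assumes E: "E < Es" and \<theta>c: "\<theta>c \<in> well" and min: "\<And>\<eta>. DD V \<omega> E \<theta>c \<le> DD V \<omega> E \<eta>"
    and \<theta>: "\<theta> \<in> well" "\<theta> \<noteq> \<theta>c"
  shows "decay E (rad \<bar>\<theta> - \<theta>c\<bar>) \<theta> \<and> DD V \<omega> E \<theta>c + \<bar>\<theta> - \<theta>c\<bar>\<^sup>2 \<le> DN V \<omega> E (rad \<bar>\<theta> - \<theta>c\<bar>) \<theta>"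
proof -
  have nr: "nonres E \<theta>c \<eta>" if "decay E (rad \<bar>\<eta> - \<theta>c\<bar>) \<eta> \<and> DD V \<omega> E \<theta>c + \<bar>\<eta> - \<theta>c\<bar>\<^sup>2 \<le> DN V \<omega> E (rad \<bar>\<eta> - \<theta>c\<bar>) \<eta>" for \<eta>
    using that DD_nonneg[OF E, of \<theta>c] by (auto simp: nonres_def)
  \<comment> \<open>Dyadic induction on the distance: a step refers only to points at least twice as
    far from \<theta>c, and at the first scale the well contains none.\<close>
  have ind: "\<forall>\<eta>\<in>well. 0 < \<bar>\<eta> - \<theta>c\<bar> \<longrightarrow> 2 * \<rho> / 2 ^ n \<le> \<bar>\<eta> - \<theta>c\<bar> \<longrightarrow>
      decay E (rad \<bar>\<eta> - \<theta>c\<bar>) \<eta> \<and> DD V \<omega> E \<theta>c + \<bar>\<eta> - \<theta>c\<bar>\<^sup>2 \<le> DN V \<omega> E (rad \<bar>\<eta> - \<theta>c\<bar>) \<eta>" for n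
  proof (induction n)
    case 0
    show ?case
    proof (intro ballI impI)
      fix \<eta> assume \<eta>: "\<eta> \<in> well" "0 < \<bar>\<eta> - \<theta>c\<bar>" "2 * \<rho> / 2 ^ 0 \<le> \<bar>\<eta> - \<theta>c\<bar>"
      show "decay E (rad \<bar>\<eta> - \<theta>c\<bar>) \<eta> \<and> DD V \<omega> E \<theta>c + \<bar>\<eta> - \<theta>c\<bar>\<^sup>2 \<le> DN V \<omega> E (rad \<bar>\<eta> - \<theta>c\<bar>) \<eta>"
      proof (rule scale_step[OF E \<theta>c min \<eta>(1) refl \<eta>(2)])
        fix \<xi> assume \<xi>: "\<xi> \<in> well" "2 * \<bar>\<eta> - \<theta>c\<bar> \<le> \<bar>\<xi> - \<theta>c\<bar>"
        have "\<bar>\<xi> - \<theta>c\<bar> \<le> 2 * \<rho>" using \<xi>(1) \<theta>c by (auto simp: abs_le_iff)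
        then show "nonres E \<theta>c \<xi>" using \<xi> \<eta> \<rho> by simp
      qed
    qed
  next
    case (Suc n)
    show ?case
    proof (intro ballI impI)
      fix \<eta> assume \<eta>: "\<eta> \<in> well" "0 < \<bar>\<eta> - \<theta>c\<bar>" "2 * \<rho> / 2 ^ Suc n \<le> \<bar>\<eta> - \<theta>c\<bar>"
      show "decay E (rad \<bar>\<eta> - \<theta>c\<bar>) \<eta> \<and> DD V \<omega> E \<theta>c + \<bar>\<eta> - \<theta>c\<bar>\<^sup>2 \<le> DN V \<omega> E (rad \<bar>\<eta> - \<theta>c\<bar>) \<eta>"
      proof (rule scale_step[OF E \<theta>c min \<eta>(1) refl \<eta>(2)])
        fix \<xi> assume \<xi>: "\<xi> \<in> well" "0 < \<bar>\<xi> - \<theta>c\<bar>" "2 * \<bar>\<eta> - \<theta>c\<bar> \<le> \<bar>\<xi> - \<theta>c\<bar>"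
        have "2 * \<rho> / 2 ^ n \<le> 2 * \<bar>\<eta> - \<theta>c\<bar>" using \<eta>(3) by (simp add: field_simps)
        then have "2 * \<rho> / 2 ^ n \<le> \<bar>\<xi> - \<theta>c\<bar>" using \<xi>(3) by (rule order_trans)
        then show "nonres E \<theta>c \<xi>" using Suc \<xi> by (intro nr) auto
      qed
    qed
  qed
  obtain n where n: "2 * \<rho> / \<bar>\<theta> - \<theta>c\<bar> < 2 ^ n" using real_arch_pow[of 2 "2 * \<rho> / \<bar>\<theta> - \<theta>c\<bar>"] by auto
  have "2 * \<rho> / 2 ^ n \<le> \<bar>\<theta> - \<theta>c\<bar>" using n \<theta>(2) by (simp add: field_simps)
  then show ?thesis using ind[of n] \<theta> by auto
qed

end

section \<open>The minimum of the separation\<close>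

context core begin

text \<open>The minimum point is normalised to the well around \<open>m\<close>; energies within 1
  of \<open>Es\<close> make constants such as Cb E <= B0 + 3 uniform.\<close>

definition crit :: "real \<Rightarrow> real \<Rightarrow> bool" where
  "crit E \<theta>c \<longleftrightarrow> Es - 1 < E \<and> E < Es \<and> \<theta>c \<in> well \<and> (\<forall>\<eta>. DD V \<omega> E \<theta>c \<le> DD V \<omega> E \<eta>)"

lemma crit_neg: "core.crit V (-\<omega>) m \<rho> E \<theta>c = crit E \<theta>c"
  unfolding crit_def core.crit_def[OF core_neg] by (simp add: DD_neg Estar_neg)

lemma minimizer_bounds:
  assumes E: "Es - 1 < E" "E < Es" and min: "\<And>\<eta>. DD V \<omega> E \<theta> \<le> DD V \<omega> E \<eta>"
  shows "DD V \<omega> E \<theta> \<le> 3" "V \<theta> \<le> V m + 5"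
proof -
  have E': "E < Estar V (-\<omega>)" using E by (simp add: Estar_neg)
  have "DD V \<omega> E \<theta> \<le> DD V \<omega> E m" by (rule min)
  also have "\<dots> \<le> V m - E" using ff_nonneg[OF E(2), of m] ff_nonneg'[OF E(2), of m] by (simp add: DD_def)
  \<comment> \<open>The 3 comes from V m <= Es + 2 and E > Es - 1; the 5 adds two fractions, each at
    most 1 at a minimum point.\<close>
  finally show d: "DD V \<omega> E \<theta> \<le> 3" using E Es_ge by linarith
  have "ff V \<omega> E \<theta> \<le> 1" using gg_le_1[OF E(2) min, of 1] by (simp add: gg_Suc gg_0)
  moreover have "ff V (-\<omega>) E \<theta> \<le> 1"
    using hill.gg_le_1[OF hill_neg E', of \<theta> 1] min by (simp add: DD_neg gg_Suc gg_0)
  ultimately show "V \<theta> \<le> V m + 5" using d E Es_le by (simp add: DD_def)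
qed

lemma minimizer_in_well:
  assumes "Es - 1 < E" "E < Es" "\<And>\<eta>. DD V \<omega> E \<theta> \<le> DD V \<omega> E \<eta>"
  shows "\<exists>j::int. \<theta> + of_int j \<in> well"
proof (rule ccontr)
  assume no: "\<not> ?thesis"
  have "\<rho> < \<bar>\<theta> - m - of_int j\<bar>" for j :: int
  proof (rule ccontr)
    assume "\<not> \<rho> < \<bar>\<theta> - m - of_int j\<bar>"
    then have "\<theta> + of_int (-j) \<in> well" by (auto simp: abs_le_iff)
    then show False using no by blast
  qed
  then have "V m + 4 * \<kappa> \<le> V \<theta>" by (rule nonwell)
  then show False using minimizer_bounds(2)[OF assms] \<kappa> by linarith
qed

lemma crit_exists: assumes "Es - 1 < E" "E < Es" shows "\<exists>\<theta>c. crit E \<theta>c"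
proof -
  obtain \<theta> where \<theta>: "\<And>\<eta>. DD V \<omega> E \<theta> \<le> DD V \<omega> E \<eta>" using DD_minimizer[OF assms(2)] by blast
  obtain j :: int where j: "\<theta> + of_int j \<in> well" using minimizer_in_well[OF assms \<theta>] by blast
  have "crit E (\<theta> + of_int j)" unfolding crit_def DD_int using assms \<theta> j by auto
  then show ?thesis by blast
qed

text \<open>At \<theta>c itself s = 0, where the Diophantine assumption puts no limit on the orbit
  length and all other points of the well are covered by \<open>all_scales\<close>.\<close>

lemma crit_decay: assumes "crit E \<theta>c" shows "decay E N \<theta>c"
proof -
  have c: "E < Es" "\<theta>c \<in> well" "\<And>\<eta>. DD V \<omega> E \<theta>c \<le> DD V \<omega> E \<eta>" using assms by (auto simp: crit_def)
  show ?thesis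
  proof (rule decay_both[OF c(1,2,2), of 0])
    fix \<eta> assume \<eta>: "\<eta> \<in> well" "0 < \<bar>\<eta> - \<theta>c\<bar>"
    then have "\<eta> \<noteq> \<theta>c" by auto
    from all_scales[OF c(1,2,3) \<eta>(1) this] show "nonres E \<theta>c \<eta>"
      using DD_nonneg[OF c(1), of \<theta>c] by (auto simp: nonres_def)
  qed (use \<rho> in auto)
qed

lemma crit_gg: assumes "crit E \<theta>c" shows "gg V \<omega> E \<theta>c k \<le> wt k"
proof (rule LIMSEQ_le_const2[OF pp_tendsto])
  show "E < Es" using assms by (simp add: crit_def)
  show "\<exists>N. \<forall>n\<ge>N. pp V \<omega> E n \<theta>c k \<le> wt k" using crit_decay[OF assms] unfolding decay_def by blast
qed

lemma crit_gg': assumes "crit E \<theta>c" shows "gg V (-\<omega>) E \<theta>c k \<le> wt k"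
  using core.crit_gg[OF core_neg, unfolded crit_neg, OF assms] .

lemma crit_sum_gg: assumes "crit E \<theta>c" shows "(\<Sum>k. (gg V \<omega> E \<theta>c (Suc k))\<^sup>2) \<le> 1 / 2"
proof (rule suminf_le_const)
  have E: "E < Es" using assms by (simp add: crit_def)
  show "summable (\<lambda>k. (gg V \<omega> E \<theta>c (Suc k))\<^sup>2)" by (rule gg_Suc_summable[OF E])
  fix n
  have "(\<Sum>k<n. (gg V \<omega> E \<theta>c (Suc k))\<^sup>2) \<le> (\<Sum>k<n. (wt (Suc k))\<^sup>2)"
    by (intro sum_mono power_mono crit_gg assms less_imp_le[OF gg_pos[OF E]])
  also have "\<dots> \<le> 2 / \<kappa>\<^sup>2" by (rule sum_wt_sq)
  also have "\<dots> \<le> 2 / 3\<^sup>2" using \<kappa> by (intro divide_left_mono power_mono) auto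
  finally show "(\<Sum>k<n. (gg V \<omega> E \<theta>c (Suc k))\<^sup>2) \<le> 1 / 2" by simp
qed

lemma crit_J: assumes "crit E \<theta>c" shows "J E \<theta>c \<le> 2"
  using crit_sum_gg[OF assms] core.crit_sum_gg[OF core_neg, unfolded crit_neg, OF assms] by (simp add: J_def)

text \<open>The energy tangent is taken at the minimum point of a higher energy \<open>e\<close>,
  where J <= 2, and carries the smallness of D back to \<open>E\<close>. A gap uniform in the phase
  satisfies d^2 <= 4 C^3 (Es - e) by \<open>separation_below_threshold\<close>, so the remainder
  vanishes as \<open>e\<close> tends to \<open>Es\<close>.\<close>

lemma crit_le:
  assumes "crit E \<theta>c" shows "DD V \<omega> E \<theta>c \<le> 2 * (Es - E)"
proof -
  have E: "Es - 1 < E" "E < Es" and min: "\<And>\<eta>. DD V \<omega> E \<theta>c \<le> DD V \<omega> E \<eta>" using assms by (auto simp: crit_def)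
  define C where "C = B0 + 3"
  have C: "C > 0" using B0 by (simp add: C_def)
  have main: "DD V \<omega> E \<theta>c \<le> 2 * (Es - E) + sqrt (4 * C ^ 3 * (Es - e))" if e: "E < e" "e < Es" for e
  proof -
    obtain \<theta>' where c': "crit e \<theta>'" using crit_exists[of e] E e by auto
    have d0: "0 \<le> DD V \<omega> e \<theta>'" by (rule DD_nonneg[OF e(2)])
    have CbC: "Cb e \<le> C" "0 < Cb e" using Es_ge E e Cb_pos[OF e(2)] by (auto simp: C_def)
    have "e + (DD V \<omega> e \<theta>')\<^sup>2 / (4 * Cb e ^ 3) \<le> Es"
      using c' by (intro separation_below_threshold[OF e(2) d0]) (auto simp: crit_def)
    then have "(DD V \<omega> e \<theta>')\<^sup>2 / (4 * Cb e ^ 3) \<le> Es - e" by linarith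
    then have "(DD V \<omega> e \<theta>')\<^sup>2 \<le> (Es - e) * (4 * Cb e ^ 3)" using CbC by (simp add: pos_divide_le_eq)
    also have "\<dots> \<le> (Es - e) * (4 * C ^ 3)" using CbC e by (intro mult_left_mono power_mono) auto
    finally have "DD V \<omega> e \<theta>' \<le> sqrt (4 * C ^ 3 * (Es - e))" by (intro real_le_rsqrt) (simp add: mult_ac)
    moreover have "DD V \<omega> E \<theta>c \<le> DD V \<omega> e \<theta>' + (e - E) * J e \<theta>'"
      using min[of \<theta>'] DD_energy[OF e(2) E(2), of \<theta>'] by (simp add: algebra_simps)
    moreover have "(e - E) * J e \<theta>' \<le> (Es - E) * 2"
      using crit_J[OF c'] e E by (intro mult_mono) (auto simp: J_def intro!: add_nonneg_nonneg suminf_nonneg gg_Suc_summable hill.gg_Suc_summable[OF hill_neg] simp: Estar_neg)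
    ultimately show ?thesis by linarith
  qed
  have "((\<lambda>e. 2 * (Es - E) + sqrt (4 * C ^ 3 * (Es - e))) \<longlongrightarrow> 2 * (Es - E) + sqrt (4 * C ^ 3 * (Es - Es))) (at_left Es)"
    by (intro tendsto_intros)
  then have lim: "((\<lambda>e. 2 * (Es - E) + sqrt (4 * C ^ 3 * (Es - e))) \<longlongrightarrow> 2 * (Es - E)) (at_left Es)" by simp
  have "\<forall>\<^sub>F e in at_left Es. DD V \<omega> E \<theta>c \<le> 2 * (Es - E) + sqrt (4 * C ^ 3 * (Es - e))"
    using eventually_at_left_real[OF E(2)] by eventually_elim (rule main, auto)
  then show ?thesis by (rule tendsto_lowerbound[OF lim]) simp
qed

text \<open>Growth around one minimum point and the truncation bound at the other would give t^2 <=
  2 wt (rad t), against 12 wt (rad t) <= t^2.\<close>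

lemma crit_unique:
  assumes "crit E \<theta>c" "crit E \<theta>" shows "\<theta> = \<theta>c"
proof (rule ccontr)
  assume ne: "\<theta> \<noteq> \<theta>c"
  have E: "E < Es" and w: "\<theta>c \<in> well" "\<theta> \<in> well" and min: "\<And>\<eta>. DD V \<omega> E \<theta>c \<le> DD V \<omega> E \<eta>" "\<And>\<eta>. DD V \<omega> E \<theta> \<le> DD V \<omega> E \<eta>"
    using assms by (auto simp: crit_def)
  define t where "t = \<bar>\<theta> - \<theta>c\<bar>"
  have t: "0 < t" "t \<le> 2 * \<rho>" using ne w by (auto simp: t_def abs_le_iff)
  have "DD V \<omega> E \<theta>c + t\<^sup>2 \<le> DN V \<omega> E (rad t) \<theta>"
    using all_scales[OF E w(1) min(1) w(2) ne] by (simp add: t_def)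
  also have "\<dots> \<le> DD V \<omega> E \<theta> + 2 * wt (rad t)"
    by (rule DN_minimizer_le[OF E min(2) crit_decay[OF assms(2)]])
  finally have "t\<^sup>2 \<le> 2 * wt (rad t)" using min(2)[of \<theta>c] by linarith
  then show False using wt_rad[OF t] t wt_pos[of "rad t"] by (smt (verit) zero_less_power)
qed

lemma minimizer_unique:
  assumes "crit E \<theta>c" "DD V \<omega> E \<theta> = DD V \<omega> E \<theta>c" shows "\<theta> - \<theta>c \<in> \<int>"
proof -
  have c: "Es - 1 < E" "E < Es" "\<And>\<eta>. DD V \<omega> E \<theta>c \<le> DD V \<omega> E \<eta>" using assms by (auto simp: crit_def)
  obtain j :: int where j: "\<theta> + of_int j \<in> well"
    using minimizer_in_well[OF c(1,2), of \<theta>] c(3) assms(2) by auto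
  have "crit E (\<theta> + of_int j)" unfolding crit_def DD_int using c j assms(2) by auto
  from crit_unique[OF assms(1) this] have "\<theta> - \<theta>c = of_int (-j)" by simp
  then show ?thesis by (metis Ints_of_int)
qed

text \<open>If D(\<theta>) < 9 \<delta>, then \<open>gg_sq_DD\<close> bounds the solutions at
  \<theta> by 3 and the truncation errors by 3 wt N each. Hence D(\<theta>) >= \<delta> + s^2 / 2 >=
  9 \<delta> after all.\<close>

lemma crit_growth:
  assumes cr: "crit E \<theta>c" and \<theta>: "\<theta> \<in> well" and t: "16 * DD V \<omega> E \<theta>c \<le> (\<theta> - \<theta>c)\<^sup>2"
  shows "9 * DD V \<omega> E \<theta>c \<le> DD V \<omega> E \<theta>"
proof (rule ccontr)
  assume no: "\<not> ?thesis"
  have E: "E < Es" and w: "\<theta>c \<in> well" and min: "\<And>\<eta>. DD V \<omega> E \<theta>c \<le> DD V \<omega> E \<eta>" using cr by (auto simp: crit_def)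
  have E': "E < Estar V (-\<omega>)" using E by (simp add: Estar_neg)
  define \<delta> where "\<delta> = DD V \<omega> E \<theta>c"
  have \<delta>: "\<delta> > 0" unfolding \<delta>_def by (rule DD_pos[OF E])
  have ne: "\<theta> \<noteq> \<theta>c" using t \<delta> by (auto simp: \<delta>_def)
  define s where "s = \<bar>\<theta> - \<theta>c\<bar>"
  have s: "0 < s" "s \<le> 2 * \<rho>" "16 * \<delta> \<le> s\<^sup>2" using ne w \<theta> t by (auto simp: s_def \<delta>_def abs_le_iff)
  define N where "N = rad s"
  have a: "decay E N \<theta>" "\<delta> + s\<^sup>2 \<le> DN V \<omega> E N \<theta>"
    using all_scales[OF E w min \<theta> ne] by (auto simp: s_def N_def \<delta>_def)
  have g3: "x \<le> 3" if "x\<^sup>2 * DD V \<omega> E \<eta> \<le> DD V \<omega> E \<theta>" for x \<eta>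
  proof -
    have "x\<^sup>2 * \<delta> \<le> x\<^sup>2 * DD V \<omega> E \<eta>" using min[of \<eta>] by (intro mult_left_mono) (auto simp: \<delta>_def)
    then have "x\<^sup>2 * \<delta> \<le> 9 * \<delta>" using that no by (simp add: \<delta>_def)
    then have "x\<^sup>2 \<le> 3\<^sup>2" using \<delta> by simp
    then show ?thesis by (rule power2_le_imp_le) simp
  qed
  have g: "gg V \<omega> E \<theta> (Suc N) \<le> 3" "gg V (-\<omega>) E \<theta> (Suc N) \<le> 3"
    using g3[OF gg_sq_DD[OF E, of \<theta> "Suc N"]] g3[OF hill.gg_sq_DD[OF hill_neg E', of \<theta> "Suc N", unfolded DD_neg]] by auto
  have d: "pp V \<omega> E N \<theta> N \<le> wt N" "pp V (-\<omega>) E N \<theta> N \<le> wt N" using a(1) by (auto simp: decay_def)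
  have "ff V \<omega> E \<theta> - kf V \<omega> E N \<theta> \<le> 3 * wt N"
    unfolding truncation_error[OF E] using g d wt_pos[of N] pp_nonneg[OF E] by (intro mult_mono) auto
  moreover have "ff V (-\<omega>) E \<theta> - kf V (-\<omega>) E N \<theta> \<le> 3 * wt N"
    unfolding hill.truncation_error[OF hill_neg E'] using g d wt_pos[of N] hill.pp_nonneg[OF hill_neg E'] by (intro mult_mono) auto
  ultimately have "DN V \<omega> E N \<theta> \<le> DD V \<omega> E \<theta> + 6 * wt N" by (simp add: DD_def DN_def)
  moreover have "12 * wt N \<le> s\<^sup>2" unfolding N_def by (rule wt_rad[OF s(1,2)])
  ultimately have "\<delta> + s\<^sup>2 / 2 \<le> DD V \<omega> E \<theta>" using a(2) by linarith
  then show False using s(3) no by (simp add: \<delta>_def)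
qed

text \<open>V exceeds its minimum by at most 5 at \<theta>c and by at least 4 \<kappa> >= 12 off the
  wells, so a shift that changes V by less than 1 stays in the wells; \<rho> <= 1/4 and |t| < 1/4
  exclude the other translates.\<close>

lemma crit_neighbourhood:
  assumes cr: "crit E \<theta>c" and \<rho>4: "\<rho> \<le> 1 / 4" and t: "\<bar>t\<bar> < 1 / 4" "B1 * \<bar>t\<bar> < 1"
  shows "\<theta>c + t \<in> well"
proof (rule ccontr)
  assume no: "\<theta>c + t \<notin> well"
  have E: "Es - 1 < E" "E < Es" and w: "\<theta>c \<in> well" and min: "\<And>\<eta>. DD V \<omega> E \<theta>c \<le> DD V \<omega> E \<eta>" using cr by (auto simp: crit_def)
  have "\<rho> < \<bar>\<theta>c + t - m - of_int j\<bar>" for j :: int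
  proof (cases "j = 0")
    case True then show ?thesis using no by (auto simp: abs_le_iff not_less)
  next
    case False
    then have "1 \<le> \<bar>real_of_int j\<bar>" by linarith
    moreover have "\<bar>\<theta>c - m\<bar> \<le> \<rho>" using w by (auto simp: abs_le_iff)
    ultimately show ?thesis using t(1) \<rho>4 by linarith
  qed
  then have "V m + 4 * \<kappa> \<le> V (\<theta>c + t)" by (rule nonwell)
  also have "\<dots> \<le> V \<theta>c + B1 * \<bar>t\<bar>" using V_lipschitz[of "\<theta>c + t" \<theta>c] by simp
  finally show False using minimizer_bounds(2)[OF E min] \<kappa> t(2) by linarith
qed

end

section \<open>The lower bound for the slope\<close>

text \<open>D f^2 / (1 - D f) is the value of D one step further back. A ratio of two orbits
  persists up to the factor (1 - e)^2 from f^2, while the denominator only helps once D f <= D'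
  f'.\<close>

lemma riccati_growth:
  fixes D D' f f' r e :: real
  assumes "0 < D" "0 < f" "r * D \<le> D'" "(1 - e) * f \<le> f'" "D' * f' < 1"
    "1 \<le> r * (1 - e)" "0 \<le> e" "e < 1"
  shows "r * (1 - e)\<^sup>2 * (D * f\<^sup>2 / (1 - D * f)) \<le> D' * f'\<^sup>2 / (1 - D' * f')"
proof -
  have r: "0 < r" using assms(6,8) by (metis diff_gt_0_iff_gt not_one_le_zero order.strict_iff_order zero_less_mult_pos2 less_le_trans zero_less_one)
  have e: "0 < (1 - e) * f" "0 < r * D" using assms r by auto
  have f'D': "0 < f'" "0 < D'" using e assms by linarith+
  have "1 * (D * f) \<le> (r * (1 - e)) * (D * f)" using assms by (intro mult_right_mono) auto
  also have "\<dots> = (r * D) * ((1 - e) * f)" by simp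
  also have "\<dots> \<le> D' * f'" using assms e f'D' by (intro mult_mono) auto
  finally have 1: "1 - D' * f' \<le> 1 - D * f" by simp
  have "(r * D) * ((1 - e) * f)\<^sup>2 \<le> D' * f'\<^sup>2"
    using assms e f'D' by (intro mult_mono power_mono) auto
  then have 2: "r * (1 - e)\<^sup>2 * (D * f\<^sup>2) \<le> D' * f'\<^sup>2" by (simp add: power_mult_distrib mult_ac)
  have "r * (1 - e)\<^sup>2 * (D * f\<^sup>2 / (1 - D * f)) = r * (1 - e)\<^sup>2 * (D * f\<^sup>2) / (1 - D * f)" by simp
  also have "\<dots> \<le> D' * f'\<^sup>2 / (1 - D' * f')"
    using 1 2 assms(5) f'D' by (intro frac_le) auto
  finally show ?thesis .
qed

context core begin

text \<open>Starting at the minimum of \<open>D\<close>, follow the orbit backwards for \<open>n\<close> steps until \<open>D\<close> has grown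
  to size \<open>\<eta>\<close>. A shift \<open>t\<close> of order \<open>sqrt \<delta>\<close> multiplies \<open>D\<close> by 9 at the start, hence by about 4
  after \<open>n\<close> steps unless \<open>f\<close> varies a lot; and the sign of \<open>t\<close> is chosen such that
  the left solution contributes only its quadratic term, which is negligible.\<close>

lemma lipschitz_lower_bound:
  assumes cr: "crit E \<theta>c" and \<rho>4: "\<rho> \<le> 1 / 4"
    and M: "\<And>x y. \<bar>ff V \<omega> E x - ff V \<omega> E y\<bar> \<le> M * \<bar>x - y\<bar>"
  defines "C \<equiv> B0 + 3" and "\<delta> \<equiv> DD V \<omega> E \<theta>c"
  assumes n0: "16 * C\<^sup>2 * B2 * (2/3) ^ n0 \<le> 1" and small: "4 * sqrt \<delta> < 1 / 4" "B1 * (4 * sqrt \<delta>) < 1"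
    "\<delta> * C ^ (2 * n0) < 1 / (2 * C)" "\<delta> \<le> exp (-1)"
  shows "1 / (80 * C) \<le> M * sqrt \<delta> * ln (1 / \<delta>)"
proof -
  have E1: "Es - 1 < E" and E: "E < Es" and min: "\<And>\<eta>. \<delta> \<le> DD V \<omega> E \<eta>" using cr by (auto simp: crit_def \<delta>_def)
  have E': "E < Estar V (-\<omega>)" using E by (simp add: Estar_neg)
  have C: "3 \<le> C" using B0 by (simp add: C_def)
  have CbC: "Cb E \<le> C" "0 < Cb E" using Es_ge E1 Cb_pos[OF E] by (auto simp: C_def)
  have \<delta>: "0 < \<delta>" unfolding \<delta>_def by (rule DD_pos[OF E])
  have M0: "0 \<le> M" using M[of 1 0] by (smt (verit) abs_ge_zero mult_cancel_left2 abs_one)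
  \<comment> \<open>With C \<eta> = 1/2, the product b f stays at least 1/2 as long as D is below
    \<eta>.\<close>
  define \<eta> where "\<eta> = 1 / (2 * C)"
  have \<eta>: "0 < \<eta>" "\<eta> \<le> 1" "C * \<eta> = 1 / 2" using C by (auto simp: \<eta>_def field_simps)
  have ln1: "1 \<le> ln (1 / \<delta>)"
  proof -
    have "ln \<delta> \<le> ln (exp (-1))" using small(4) \<delta> by (subst ln_le_cancel_iff) auto
    then show ?thesis using \<delta> by (simp add: ln_div)
  qed
  define D where "D t i = DD V \<omega> E (\<theta>c + t - \<omega> * real i)" for t i
  define b where "b t i = ff V (-\<omega>) E (\<theta>c + t - \<omega> * real i)" for t i
  define f where "f t i = ff V \<omega> E (\<theta>c + t - \<omega> * real (Suc i))" for t i
  have Dpos: "0 < D t i" for t i unfolding D_def by (rule DD_pos[OF E])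
  have bpos: "0 < b t i" and fpos: "0 < f t i" for t i unfolding b_def f_def by (rule ff_pos'[OF E], rule ff_pos[OF E])
  have inv: "1 / C \<le> 1 / Cb E" using CbC by (intro divide_left_mono) (auto intro: mult_pos_pos simp: C_def)
  have bC: "b t i \<le> C" "1 / C \<le> b t i" for t i
    using ff_le'[OF E, of "\<theta>c + t - \<omega> * real i"] ff_ge'[OF E, of "\<theta>c + t - \<omega> * real i"] CbC inv by (auto simp: b_def)
  have fC: "f t i \<le> C" "1 / C \<le> f t i" for t i
    using ff_le[OF E, of "\<theta>c + t - \<omega> * real (Suc i)"] ff_ge[OF E, of "\<theta>c + t - \<omega> * real (Suc i)"] CbC inv by (auto simp: f_def)
  have e: "\<theta>c + t - \<omega> * real (Suc i) + \<omega> = \<theta>c + t - \<omega> * real i" for t i by (simp add: algebra_simps)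
  have D1: "D t (Suc i) = 1 / b t i - f t i" for t i
    using DD_eq_left[OF E, of "\<theta>c + t - \<omega> * real (Suc i)"] unfolding D_def b_def f_def e .
  have D2: "D t i * f t i = D t (Suc i) * b t i" for t i
    using DD_step[OF E, of "\<theta>c + t - \<omega> * real (Suc i)"] unfolding D_def b_def f_def e .
  have D3: "1 - D t i * f t i = f t i * b t i" for t i
    unfolding D2 D1 using bpos[of t i] by (simp add: field_simps)
  have D4: "D t (Suc i) = D t i * (f t i)\<^sup>2 / (1 - D t i * f t i)" for t i
    unfolding D3 using D2[of t i] bpos[of t i] fpos[of t i] by (simp add: power2_eq_square field_simps)
  have D0: "D 0 0 = \<delta>" by (simp add: D_def \<delta>_def)
  define g where "g i = gg V (-\<omega>) E \<theta>c i" for i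
  have g0: "g 0 = 1" by (simp add: g_def gg_0)
  have gS: "g (Suc i) = g i * b 0 i" for i by (simp add: g_def b_def gg_Suc')
  have gpos: "0 < g i" for i unfolding g_def by (rule hill.gg_pos[OF hill_neg E'])
  have gw: "g i \<le> wt i" for i unfolding g_def by (rule crit_gg'[OF cr])
  have gsq: "(g i)\<^sup>2 \<le> (1/3) ^ i" for i
  proof -
    have "(g i)\<^sup>2 \<le> (wt i)\<^sup>2" using gw gpos[of i] by (intro power_mono) auto
    also have "\<dots> = \<kappa> powr (- 2 * wx i)" unfolding wt_def power2_eq_square by (simp flip: powr_add)
    also have "\<dots> \<le> \<kappa> powr (- real i)" using \<kappa>_pos by (intro powr_mono) (auto simp: wx_def)
    also have "\<dots> = (1 / \<kappa>) ^ i" using \<kappa>_pos unfolding powr_minus_divide by (simp add: powr_realpow power_one_over)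
    also have "\<dots> \<le> (1/3) ^ i" using \<kappa> by (intro power_mono divide_left_mono) auto
    finally show ?thesis .
  qed
  \<comment> \<open>From D_i (b f) = D_(i+1) b^2, the quantity D g^2 loses at most a factor 2 per
    step. As g^2 <= 3^-i, D grows at least like (3/2)^i, so \<open>n\<close> is at most logarithmic
    in 1 / \<delta>.\<close>
  have low: "\<delta> \<le> D 0 i * 2 ^ i * (g i)\<^sup>2" if "\<And>j. j \<le> i \<Longrightarrow> D 0 j < \<eta>" for i
    using that
  proof (induction i)
    case 0 then show ?case by (simp add: D0 g0)
  next
    case (Suc i)
    have "b 0 i * D 0 (Suc i) \<le> C * \<eta>" using Suc.prems[of "Suc i"] bC bpos[of 0 i] Dpos[of 0 "Suc i"] \<eta> C by (intro mult_mono) auto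
    then have "1 / 2 \<le> b 0 i * f 0 i" using D1[of 0 i] bpos[of 0 i] \<eta>(3) by (simp add: algebra_simps)
    then have "D 0 i * (1 / 2) \<le> D 0 i * (b 0 i * f 0 i)" using Dpos[of 0 i] by (intro mult_left_mono) auto
    also have "\<dots> = D 0 (Suc i) * (b 0 i)\<^sup>2" using D2[of 0 i] by (simp add: power2_eq_square algebra_simps)
    finally have s: "D 0 i \<le> 2 * D 0 (Suc i) * (b 0 i)\<^sup>2" by simp
    have "\<delta> \<le> D 0 i * (2 ^ i * (g i)\<^sup>2)" using Suc by (simp add: mult.assoc)
    also have "\<dots> \<le> 2 * D 0 (Suc i) * (b 0 i)\<^sup>2 * (2 ^ i * (g i)\<^sup>2)" using s by (intro mult_right_mono) auto
    also have "\<dots> = D 0 (Suc i) * 2 ^ Suc i * (g (Suc i))\<^sup>2" by (simp add: gS power_mult_distrib)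
    finally show ?case .
  qed
  have low2: "\<delta> \<le> \<eta> * (2/3) ^ i" if "\<And>j. j \<le> i \<Longrightarrow> D 0 j < \<eta>" for i
  proof -
    have "\<delta> \<le> D 0 i * 2 ^ i * (g i)\<^sup>2" using low[OF that] .
    also have "\<dots> \<le> \<eta> * 2 ^ i * (1/3) ^ i" using that[of i] gsq[of i] Dpos[of 0 i] by (intro mult_mono) auto
    also have "\<dots> = \<eta> * (2/3) ^ i" by (simp add: power_divide)
    finally show ?thesis .
  qed
  have ex: "\<exists>n. \<eta> \<le> D 0 n"
  proof (rule ccontr)
    assume no: "\<nexists>n. \<eta> \<le> D 0 n"
    then have "\<delta> \<le> \<eta> * (2/3) ^ i" for i by (intro low2) (auto simp: not_le)
    moreover have "(\<lambda>i. \<eta> * (2/3) ^ i) \<longlonglongrightarrow> \<eta> * 0" by (intro tendsto_intros LIMSEQ_power_zero) auto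
    ultimately have "\<delta> \<le> 0" by (intro LIMSEQ_le_const[of "\<lambda>i. \<eta> * (2/3) ^ i"]) auto
    then show False using \<delta> by simp
  qed
  define n where "n = (LEAST n. \<eta> \<le> D 0 n)"
  have n1: "\<eta> \<le> D 0 n" unfolding n_def using ex by (rule LeastI_ex)
  have n2: "D 0 j < \<eta>" if "j < n" for j using not_less_Least[of j "\<lambda>n. \<eta> \<le> D 0 n"] that by (auto simp: n_def)
  have up: "D 0 i \<le> \<delta> * C ^ (2 * i)" for i
  proof (induction i)
    case (Suc i)
    have "1 / b 0 i \<le> C" using bC(2)[of 0 i] bpos[of 0 i] C by (simp add: field_simps)
    then have "D 0 i * (f 0 i * (1 / b 0 i)) \<le> (\<delta> * C ^ (2 * i)) * (C * C)"
      using Suc Dpos[of 0 i] fC(1)[of 0 i] fpos[of 0 i] bpos[of 0 i] \<delta> C by (intro mult_mono) auto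
    moreover have "D 0 (Suc i) = D 0 i * (f 0 i * (1 / b 0 i))" using D2[of 0 i] bpos[of 0 i] by (simp add: field_simps)
    ultimately show ?case by (simp add: power2_eq_square mult_ac)
  qed (simp add: D0)
  \<comment> \<open>Conversely D gains at most C^2 per step, so for small \<delta> at least n0 steps
    are needed.\<close>
  have nn0: "n0 \<le> n"
  proof (rule ccontr)
    assume "\<not> n0 \<le> n"
    then have "\<delta> * C ^ (2 * n) \<le> \<delta> * C ^ (2 * n0)" using \<delta> C by (intro mult_left_mono power_increasing) auto
    then show False using up[of n] n1 small(3) by (simp add: \<eta>_def)
  qed
  have "\<delta> < \<eta>"
  proof -
    have "\<delta> * 1 \<le> \<delta> * C ^ (2 * n0)" using \<delta> C by (intro mult_left_mono one_le_power) auto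
    then show ?thesis using small(3) by (simp add: \<eta>_def)
  qed
  then obtain k where k: "n = Suc k" using n1 D0 by (cases n) auto
  have nlog: "real n \<le> 4 * ln (1 / \<delta>)"
  proof -
    have "\<delta> \<le> \<eta> * (2/3) ^ k" by (rule low2) (use n2 k in auto)
    also have "\<dots> \<le> 1 * (2/3) ^ k" using \<eta> by (intro mult_right_mono) auto
    finally have "ln \<delta> \<le> ln ((2/3) ^ k)" using \<delta> by (subst ln_le_cancel_iff) auto
    also have "\<dots> = real k * ln (2/3)" by (simp add: ln_realpow)
    also have "\<dots> \<le> real k * (- (1/3))" using ln_le_minus_one[of "2/3"] by (intro mult_left_mono) auto
    finally have "real k \<le> 3 * ln (1 / \<delta>)" using \<delta> by (simp add: ln_div)
    then show ?thesis using ln1 k by simp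
  qed
  define x where "x = \<theta>c - \<omega> * real k"
  define A where "A = (\<Sum>i. (gg V (-\<omega>) E x (Suc i))\<^sup>2 * V' (x + (-\<omega>) * real (Suc i)))"
  define \<Sigma> where "\<Sigma> = (\<Sum>i. (gg V (-\<omega>) E x (Suc i))\<^sup>2)"
  define t where "t = (if A \<le> 0 then 4 * sqrt \<delta> else - (4 * sqrt \<delta>))"
  have tabs: "\<bar>t\<bar> = 4 * sqrt \<delta>" using \<delta> by (simp add: t_def)
  have t2: "t\<^sup>2 = 16 * \<delta>" using \<delta> by (simp add: t_def power_mult_distrib)
  have tA: "t * A \<le> 0" using \<delta> by (auto simp: t_def mult_le_0_iff)
  \<comment> \<open>Multiplied by g k, the left solution at \<open>x\<close> continues that at
    \<theta>c from site n on; the sum is therefore a tail of order 3^-n.\<close>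
  have \<Sigma>g: "\<Sigma> * (g k)\<^sup>2 \<le> (1/3) ^ n"
  proof -
    have sm: "summable (\<lambda>i. (gg V (-\<omega>) E x (Suc i))\<^sup>2)" by (rule hill.gg_Suc_summable[OF hill_neg E'])
    have "\<Sigma> * (g k)\<^sup>2 = (\<Sum>i. (gg V (-\<omega>) E x (Suc i))\<^sup>2 * (g k)\<^sup>2)" unfolding \<Sigma>_def by (rule suminf_mult2[OF sm])
    also have "\<dots> \<le> (1/3) ^ n"
    proof (rule suminf_le_const[OF summable_mult2[OF sm]])
      fix j
      have "(\<Sum>i<j. (gg V (-\<omega>) E x (Suc i))\<^sup>2 * (g k)\<^sup>2) \<le> (\<Sum>i<j. (1/\<kappa>\<^sup>2 * (1/\<kappa>) ^ k) * (1/\<kappa>) ^ i)"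
      proof (rule sum_mono)
        fix i
        have "g (k + Suc i) = g k * gg V (-\<omega>) E x (Suc i)" unfolding g_def gg_add x_def by simp
        then have "(gg V (-\<omega>) E x (Suc i))\<^sup>2 * (g k)\<^sup>2 = (g (Suc (k + i)))\<^sup>2" by (simp add: power_mult_distrib)
        also have "\<dots> \<le> (wt (Suc (k + i)))\<^sup>2" using gw gpos by (intro power_mono) (auto intro: less_imp_le)
        also have "\<dots> \<le> 1/\<kappa>\<^sup>2 * (1/\<kappa>) ^ (k + i)" by (rule wt_sq)
        finally show "(gg V (-\<omega>) E x (Suc i))\<^sup>2 * (g k)\<^sup>2 \<le> (1/\<kappa>\<^sup>2 * (1/\<kappa>) ^ k) * (1/\<kappa>) ^ i" by (simp add: power_add)
      qed
      also have "\<dots> = (1/\<kappa>\<^sup>2 * (1/\<kappa>) ^ k) * (\<Sum>i<j. (1/\<kappa>) ^ i)" by (simp add: sum_distrib_left)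
      also have "\<dots> \<le> (1/\<kappa>\<^sup>2 * (1/\<kappa>) ^ k) * 2" using \<kappa> by (intro mult_left_mono sum_geometric_half) (auto simp: field_simps)
      also have "\<dots> = (1/\<kappa>) ^ n * (2 / \<kappa>)" using k by (simp add: power2_eq_square)
      also have "\<dots> \<le> (1/3) ^ n * 1" using \<kappa> by (intro mult_mono power_mono divide_left_mono) auto
      finally show "(\<Sum>i<j. (gg V (-\<omega>) E x (Suc i))\<^sup>2 * (g k)\<^sup>2) \<le> (1/3) ^ n" by simp
    qed
    finally show ?thesis .
  qed
  have \<Sigma>0: "0 \<le> \<Sigma>" unfolding \<Sigma>_def by (intro suminf_nonneg hill.gg_Suc_summable[OF hill_neg E']) auto
  have \<delta>\<Sigma>: "\<delta> * \<Sigma> \<le> \<eta> * (2/3) ^ n"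
  proof -
    have "\<delta> * \<Sigma> \<le> (D 0 k * 2 ^ k * (g k)\<^sup>2) * \<Sigma>" using \<Sigma>0 n2 k by (intro mult_right_mono low) auto
    also have "\<dots> = D 0 k * 2 ^ k * (\<Sigma> * (g k)\<^sup>2)" by simp
    also have "\<dots> \<le> \<eta> * 2 ^ n * (1/3) ^ n"
      using n2[of k] k \<Sigma>g \<Sigma>0 Dpos[of 0 k] by (intro mult_mono) auto
    also have "\<dots> = \<eta> * (2/3) ^ n" by (simp add: power_divide)
    finally show ?thesis .
  qed
  have bt: "b 0 k - b t k \<le> B2 * (16 * \<delta>) * \<Sigma>"
  proof -
    have bx: "b 0 k = ff V (-\<omega>) E x" "b t k = ff V (-\<omega>) E (x + t)" by (simp_all add: b_def x_def algebra_simps)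
    have "ff V (-\<omega>) E x - (\<Sum>i. (gg V (-\<omega>) E x (Suc i))\<^sup>2 * (ap V (-\<omega>) E (x + t) i - ap V (-\<omega>) E x i)) \<le> ff V (-\<omega>) E (x + t)"
      by (rule hill.tangent_inf[OF hill_neg E' E' hill.ap_diff_le[OF hill_neg]])
    moreover have "(\<Sum>i. (gg V (-\<omega>) E x (Suc i))\<^sup>2 * (ap V (-\<omega>) E (x + t) i - ap V (-\<omega>) E x i))
       \<le> (\<Sum>i. t * ((gg V (-\<omega>) E x (Suc i))\<^sup>2 * V' (x + (-\<omega>) * real (Suc i))) + B2 * t\<^sup>2 * (gg V (-\<omega>) E x (Suc i))\<^sup>2)"
    proof (rule suminf_le)
      have smV: "summable (\<lambda>i. (gg V (-\<omega>) E x (Suc i))\<^sup>2 * V' (x + (-\<omega>) * real (Suc i)))"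
        using V'_bound by (rule hill.gg_weighted(1)[OF hill_neg E'])
      show "summable (\<lambda>i. t * ((gg V (-\<omega>) E x (Suc i))\<^sup>2 * V' (x + (-\<omega>) * real (Suc i))) + B2 * t\<^sup>2 * (gg V (-\<omega>) E x (Suc i))\<^sup>2)"
        by (intro summable_add summable_mult smV hill.gg_Suc_summable[OF hill_neg E'])
      show "summable (\<lambda>i. (gg V (-\<omega>) E x (Suc i))\<^sup>2 * (ap V (-\<omega>) E (x + t) i - ap V (-\<omega>) E x i))"
        by (rule hill.gg_weighted(1)[OF hill_neg E' hill.ap_diff_le[OF hill_neg]])
      fix i
      have ei: "x + t + (-\<omega>) * real (Suc i) = x + (-\<omega>) * real (Suc i) + t" by simp
      have "ap V (-\<omega>) E (x + t) i - ap V (-\<omega>) E x i \<le> t * V' (x + (-\<omega>) * real (Suc i)) + B2 * t\<^sup>2"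
        using V_taylor[of "x + (-\<omega>) * real (Suc i)" t] unfolding ap_def ei by (simp add: abs_le_iff)
      then have "(gg V (-\<omega>) E x (Suc i))\<^sup>2 * (ap V (-\<omega>) E (x + t) i - ap V (-\<omega>) E x i)
        \<le> (gg V (-\<omega>) E x (Suc i))\<^sup>2 * (t * V' (x + (-\<omega>) * real (Suc i)) + B2 * t\<^sup>2)" by (intro mult_left_mono) auto
      then show "(gg V (-\<omega>) E x (Suc i))\<^sup>2 * (ap V (-\<omega>) E (x + t) i - ap V (-\<omega>) E x i)
        \<le> t * ((gg V (-\<omega>) E x (Suc i))\<^sup>2 * V' (x + (-\<omega>) * real (Suc i))) + B2 * t\<^sup>2 * (gg V (-\<omega>) E x (Suc i))\<^sup>2"
        by (simp add: algebra_simps)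
    qed
    moreover have "(\<Sum>i. t * ((gg V (-\<omega>) E x (Suc i))\<^sup>2 * V' (x + (-\<omega>) * real (Suc i))) + B2 * t\<^sup>2 * (gg V (-\<omega>) E x (Suc i))\<^sup>2)
       = t * A + B2 * t\<^sup>2 * \<Sigma>"
    proof -
      have smV: "summable (\<lambda>i. (gg V (-\<omega>) E x (Suc i))\<^sup>2 * V' (x + (-\<omega>) * real (Suc i)))"
        using V'_bound by (rule hill.gg_weighted(1)[OF hill_neg E'])
      have sm: "summable (\<lambda>i. (gg V (-\<omega>) E x (Suc i))\<^sup>2)" by (rule hill.gg_Suc_summable[OF hill_neg E'])
      show ?thesis unfolding A_def \<Sigma>_def
        using suminf_add[OF summable_mult[OF smV, of t] summable_mult[OF sm, of "B2 * t\<^sup>2"]]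
          suminf_mult[OF smV, of t] suminf_mult[OF sm, of "B2 * t\<^sup>2"] by simp
    qed
    ultimately show ?thesis unfolding bx using tA t2 by simp
  qed
  \<comment> \<open>The purpose of \<open>n0\<close>: the remaining quadratic term can raise 1 / b
    by at most \<eta>.\<close>
  have binv: "1 / b t k - 1 / b 0 k \<le> \<eta>"
  proof -
    have "1 / b t k - 1 / b 0 k = (b 0 k - b t k) * (1 / b t k * (1 / b 0 k))"
      using bpos[of t k] bpos[of 0 k] by (simp add: field_simps)
    also have "\<dots> \<le> (B2 * (16 * \<delta>) * \<Sigma>) * (1 / b t k * (1 / b 0 k))"
      using bt bpos[of t k] bpos[of 0 k] by (intro mult_right_mono) auto
    also have "\<dots> \<le> (B2 * (16 * \<delta>) * \<Sigma>) * (C * C)"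
    proof -
      have "1 / b s k \<le> C" for s using bC(2)[of s k] bpos[of s k] C by (simp add: field_simps)
      then show ?thesis using bpos[of t k] bpos[of 0 k] B2 \<delta> \<Sigma>0 C by (intro mult_left_mono mult_mono) auto
    qed
    also have "\<dots> = 16 * C\<^sup>2 * B2 * (\<delta> * \<Sigma>)" by (simp add: power2_eq_square)
    also have "\<dots> \<le> 16 * C\<^sup>2 * B2 * (\<eta> * (2/3) ^ n)" using \<delta>\<Sigma> B2 by (intro mult_left_mono) auto
    also have "\<dots> \<le> 16 * C\<^sup>2 * B2 * (\<eta> * (2/3) ^ n0)" using nn0 \<eta> B2 by (intro mult_left_mono power_decreasing) auto
    also have "\<dots> = \<eta> * (16 * C\<^sup>2 * B2 * (2/3) ^ n0)" by simp
    also have "\<dots> \<le> \<eta> * 1" using n0 \<eta> by (intro mult_left_mono) auto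
    finally show ?thesis by simp
  qed
  \<comment> \<open>Relative variation of f under the shift, as f >= 1 / C.\<close>
  define \<epsilon> where "\<epsilon> = C * (M * \<bar>t\<bar>)"
  have \<epsilon>0: "0 \<le> \<epsilon>" using C M0 by (simp add: \<epsilon>_def)
  \<comment> \<open>If the accumulated variation exceeds 1/5, the slope is large at once: 80
    collects this 5, the 4 in n <= 4 ln (1 / \<delta>) and the 4 in |t| = 4 sqrt \<delta>.\<close>
  show ?thesis
  proof (cases "real n * \<epsilon> \<le> 1 / 5")
    case False
    then have "1 / 5 < real n * (C * (M * (4 * sqrt \<delta>)))" by (simp add: \<epsilon>_def tabs)
    also have "\<dots> \<le> (4 * ln (1 / \<delta>)) * (C * (M * (4 * sqrt \<delta>)))" using nlog C M0 \<delta> by (intro mult_right_mono) auto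
    finally have "1 / 80 \<le> C * (M * sqrt \<delta> * ln (1 / \<delta>))" by (simp add: mult_ac)
    then show ?thesis using C by (simp add: field_simps)
  next
    case True
    have "\<epsilon> \<le> real n * \<epsilon>" using k \<epsilon>0 by (simp add: algebra_simps)
    then have \<epsilon>1: "\<epsilon> \<le> 1 / 5" using True by linarith
    have bern: "3 / 5 \<le> (1 - \<epsilon>) ^ j" if "j \<le> 2 * n" for j
    proof -
      have "real j * \<epsilon> \<le> real (2 * n) * \<epsilon>" using that \<epsilon>0 by (intro mult_right_mono) auto
      then have "3 / 5 \<le> 1 + real j * (- \<epsilon>)" using True by simp
      also have "\<dots> \<le> (1 + (- \<epsilon>)) ^ j" using \<epsilon>1 by (intro Bernoulli_inequality) auto
      finally show ?thesis by simp
    qed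
    have growth: "9 * (1 - \<epsilon>) ^ (2 * i) * D 0 i \<le> D t i" if "i \<le> n" for i
      using that
    proof (induction i)
      case 0
      have "\<theta>c + t \<in> well" using small(1,2) tabs by (intro crit_neighbourhood[OF cr \<rho>4]) auto
      then have "9 * DD V \<omega> E \<theta>c \<le> DD V \<omega> E (\<theta>c + t)"
        using t2 by (intro crit_growth[OF cr]) (auto simp: \<delta>_def)
      then show ?case by (simp add: D_def)
    next
      case (Suc i)
      have ff: "(1 - \<epsilon>) * f 0 i \<le> f t i"
      proof -
        have "f 0 i - f t i \<le> M * \<bar>t\<bar>"
          using M[of "\<theta>c + 0 - \<omega> * real (Suc i)" "\<theta>c + t - \<omega> * real (Suc i)"] unfolding f_def by simp
        also have "\<dots> = \<epsilon> * (1 / C)" using C by (simp add: \<epsilon>_def)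
        also have "\<dots> \<le> \<epsilon> * f 0 i" using fC(2)[of 0 i] \<epsilon>0 by (intro mult_left_mono)
        finally show ?thesis by (simp add: algebra_simps)
      qed
      have "3 / 5 \<le> (1 - \<epsilon>) ^ Suc (2 * i)" using Suc.prems by (intro bern) auto
      then have r: "1 \<le> 9 * (1 - \<epsilon>) ^ (2 * i) * (1 - \<epsilon>)" by (simp add: mult_ac)
      have "0 < f t i * b t i" using fpos bpos by simp
      then have lt: "D t i * f t i < 1" using D3[of t i] by linarith
      have "9 * (1 - \<epsilon>) ^ (2 * i) * (1 - \<epsilon>)\<^sup>2 * D 0 (Suc i) \<le> D t (Suc i)"
        unfolding D4 using Suc.IH Suc.prems r \<epsilon>0 \<epsilon>1 lt ff Dpos fpos by (intro riccati_growth) auto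
      then show ?case by (simp add: power2_eq_square mult_ac)
    qed
    \<comment> \<open>The ratio left by Bernoulli's inequality is 9 times 3/5, at least 4. Of the
      excess 3 D >= 3 \<eta>, the term 1 / b supplies at most \<eta>, so f varies by at least 2
      \<eta> over the distance |t|.\<close>
    have "4 * D 0 n \<le> 9 * (1 - \<epsilon>) ^ (2 * n) * D 0 n" using bern[of "2 * n"] Dpos[of 0 n] by (intro mult_right_mono) auto
    then have "3 * D 0 n \<le> D t n - D 0 n" using growth[of n] by simp
    also have "\<dots> = (1 / b t k - 1 / b 0 k) + (f 0 k - f t k)" unfolding k D1 by simp
    also have "\<dots> \<le> \<eta> + M * \<bar>t\<bar>"
      using binv M[of "\<theta>c + 0 - \<omega> * real (Suc k)" "\<theta>c + t - \<omega> * real (Suc k)"] unfolding f_def by simp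
    finally have "2 * \<eta> \<le> M * (4 * sqrt \<delta>)" using n1 by (simp add: tabs)
    then have "1 / (4 * C) \<le> M * sqrt \<delta>" using C by (simp add: \<eta>_def field_simps)
    also have "\<dots> \<le> M * sqrt \<delta> * ln (1 / \<delta>)" using ln1 M0 \<delta> mult_left_mono[of 1 "ln (1 / \<delta>)" "M * sqrt \<delta>"] by simp
    finally have "1 / (4 * C) \<le> M * sqrt \<delta> * ln (1 / \<delta>)" .
    moreover have "1 / (80 * C) \<le> 1 / (4 * C)" using C by (intro divide_left_mono) auto
    ultimately show ?thesis by linarith
  qed
qed

end

section \<open>The conclusions for a fixed coupling\<close>

lemma deriv_periodic:
  fixes f f' :: "real \<Rightarrow> real"
  assumes "\<And>x. f (x + c) = f x" "\<And>x. (f has_real_derivative f' x) (at x)"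
  shows "f' (x + c) = f' x"
proof (rule DERIV_unique)
  have "((\<lambda>y. f (y + c)) has_real_derivative f' (x + c)) (at x)"
    using assms(2)[of "x + c"] by (simp add: DERIV_shift)
  then show "(f has_real_derivative f' (x + c)) (at x)" by (simp add: assms(1))
  show "(f has_real_derivative f' x) (at x)" by (rule assms(2))
qed

lemma periodic_reduce:
  fixes f :: "real \<Rightarrow> real"
  assumes "\<And>x. f (x + 1) = f x" shows "\<exists>y\<in>{0..1}. f y = f x"
proof -
  have n: "f (x + real n) = f x" for x n
  proof (induction n)
    case (Suc n) then show ?case using assms[of "x + real n"] by (simp add: algebra_simps)
  qed auto
  have "f (x - of_int \<lfloor>x\<rfloor>) = f x"
  proof (cases "\<lfloor>x\<rfloor> \<ge> 0")
    case True then show ?thesis using n[of "x - of_int \<lfloor>x\<rfloor>" "nat \<lfloor>x\<rfloor>"] by simp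
  next
    case False then show ?thesis using n[of x "nat (- \<lfloor>x\<rfloor>)"] by simp
  qed
  moreover have "x - of_int \<lfloor>x\<rfloor> \<in> {0..1}" by (auto; linarith)
  ultimately show ?thesis by blast
qed

lemma C1_norm_upper:
  assumes "\<And>x. (f has_real_derivative f' x) (at x)" "\<And>x. \<bar>f x\<bar> \<le> A" "\<And>x. \<bar>f' x\<bar> \<le> B"
  shows "C1_norm f \<le> A + B"
proof -
  have "deriv f x = f' x" for x using assms(1) by (rule DERIV_imp_deriv)
  then show ?thesis unfolding C1_norm_def using assms(2,3) by (intro add_mono cSUP_least) auto
qed

lemma C1_norm_lower:
  assumes "\<And>x. (f has_real_derivative f' x) (at x)" "\<And>x. \<bar>f x\<bar> \<le> A" "\<And>x. \<bar>f' x\<bar> \<le> B" "\<And>x. f (x + 1) = f x"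
  shows "\<bar>f' x\<bar> \<le> C1_norm f"
proof -
  have d: "deriv f x = f' x" for x using assms(1) by (rule DERIV_imp_deriv)
  obtain y where y: "y \<in> {0..1}" "f' y = f' x"
    using periodic_reduce[of f' x] deriv_periodic[OF assms(4,1)] by auto
  have "\<bar>f 0\<bar> \<le> (SUP \<theta>\<in>{0..1}. \<bar>f \<theta>\<bar>)"
    using assms(2) by (intro cSUP_upper bdd_aboveI[of _ A]) auto
  then have "(SUP \<theta>\<in>{0..1}. \<bar>deriv f \<theta>\<bar>) \<le> C1_norm f" by (simp add: C1_norm_def)
  moreover have "\<bar>deriv f y\<bar> \<le> (SUP \<theta>\<in>{0..1}. \<bar>deriv f \<theta>\<bar>)"
    using y assms(3) d by (intro cSUP_upper bdd_aboveI[of _ B]) auto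
  ultimately show ?thesis using y d by simp
qed

text \<open>The exponent is tuned so that \<epsilon> accounts exactly for the logarithm lost in
  \<open>lipschitz_lower_bound\<close>.\<close>

lemma powr_loglog:
  fixes d :: real
  assumes "0 < d" "1 < ln (1 / d)"
  shows "(1 / sqrt d) powr (1 - 2 * ln (ln (1 / d)) / ln (1 / d)) = 1 / (sqrt d * ln (1 / d))"
proof -
  define L where "L = ln (1 / d)"
  have L: "L > 1" using assms by (simp add: L_def)
  have l: "ln (1 / sqrt d) = L / 2" using assms by (simp add: L_def ln_div ln_sqrt)
  have "(1 / sqrt d) powr (1 - 2 * ln L / L) = (1 / sqrt d) powr 1 * (1 / sqrt d) powr (- (2 * ln L / L))"
    unfolding powr_add[symmetric] by simp
  also have "(1 / sqrt d) powr 1 = 1 / sqrt d" using assms by simp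
  also have "(1 / sqrt d) powr (- (2 * ln L / L)) = exp (- (2 * ln L / L) * ln (1 / sqrt d))"
    using assms by (simp add: powr_def)
  also have "- (2 * ln L / L) * ln (1 / sqrt d) = - ln L" unfolding l using L by simp
  also have "exp (- ln L) = 1 / L" using L by (simp add: exp_minus inverse_eq_divide)
  finally show ?thesis by (simp add: L_def)
qed

context core begin

lemma ff_lipschitz_of_deriv:
  assumes "E < Es" "\<And>\<theta>. \<bar>Fd E \<theta>\<bar> \<le> M"
  shows "\<bar>ff V \<omega> E x - ff V \<omega> E y\<bar> \<le> M * \<bar>x - y\<bar>"
proof -
  have "norm (ff V \<omega> E x - ff V \<omega> E y) \<le> M * norm (x - y)"
    using assms(2) ff_deriv[OF assms(1)]
    by (intro field_differentiable_bound[where S=UNIV and f'="Fd E"])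
       (auto intro: has_field_derivative_at_within)
  then show ?thesis by simp
qed

section \<open>Gap, threshold and slopes for the coupling \<open>lam\<close>\<close>

context
  fixes lam :: real and v :: "real \<Rightarrow> real"
  assumes V_eq: "\<And>x. lam\<^sup>2 * v x = V x"
begin

lemma threshold_eq: "E0 \<omega> lam v = Es"
proof (rule E0_eq_Es[OF V_eq])
  fix E assume "Es - 1 < E" "E < Es"
  then show "\<exists>\<theta>. DD V \<omega> E \<theta> \<le> 2 * (Es - E)" using crit_exists crit_le by blast
qed

lemma psi_dist: "E < Es \<Longrightarrow> \<bar>psi_u \<omega> lam v E \<theta> - psi_s \<omega> lam v E \<theta>\<bar> = DD V \<omega> E (\<theta> - \<omega>)"
  using psi_diff_eq[OF V_eq, of E \<theta>] DD_pos[of E "\<theta> - \<omega>"] by simp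

text \<open>The gap at \<theta> is D at \<theta> - \<omega>, so it is smallest at \<theta>c +
  \<omega>, which is moved into the unit interval.\<close>

lemma delta_eq: assumes "crit E \<theta>c" shows "delta \<omega> lam v E = DD V \<omega> E \<theta>c"
proof -
  have E: "E < Es" and min: "\<And>\<eta>. DD V \<omega> E \<theta>c \<le> DD V \<omega> E \<eta>" using assms by (auto simp: crit_def)
  define \<theta> where "\<theta> = \<theta>c + \<omega> + of_int (- \<lfloor>\<theta>c + \<omega>\<rfloor>)"
  have \<theta>: "\<theta> \<in> {0..1}" unfolding \<theta>_def by (auto; linarith)
  have "\<theta> - \<omega> = \<theta>c + of_int (- \<lfloor>\<theta>c + \<omega>\<rfloor>)" by (simp add: \<theta>_def)
  then have e: "DD V \<omega> E (\<theta> - \<omega>) = DD V \<omega> E \<theta>c" by (simp only: DD_int)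
  show ?thesis unfolding delta_def psi_dist[OF E]
    by (rule cInf_eq_minimum) (use \<theta> e min in \<open>auto intro!: image_eqI[of _ _ \<theta>]\<close>)
qed

lemma gap_attained_uniquely:
  assumes "crit E \<theta>c"
  shows "\<bar>psi_u \<omega> lam v E (\<theta>c + \<omega>) - psi_s \<omega> lam v E (\<theta>c + \<omega>)\<bar> = delta \<omega> lam v E"
    and "\<bar>psi_u \<omega> lam v E \<theta> - psi_s \<omega> lam v E \<theta>\<bar> = delta \<omega> lam v E \<Longrightarrow> \<theta> - (\<theta>c + \<omega>) \<in> \<int>"
proof -
  have E: "E < Es" using assms by (simp add: crit_def)
  show "\<bar>psi_u \<omega> lam v E (\<theta>c + \<omega>) - psi_s \<omega> lam v E (\<theta>c + \<omega>)\<bar> = delta \<omega> lam v E"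
    by (simp add: psi_dist[OF E] delta_eq[OF assms])
  assume "\<bar>psi_u \<omega> lam v E \<theta> - psi_s \<omega> lam v E \<theta>\<bar> = delta \<omega> lam v E"
  then have "DD V \<omega> E (\<theta> - \<omega>) = DD V \<omega> E \<theta>c" by (simp add: psi_dist[OF E] delta_eq[OF assms])
  from minimizer_unique[OF assms this] show "\<theta> - (\<theta>c + \<omega>) \<in> \<int>" by (simp add: algebra_simps)
qed

lemma delta_bounds:
  assumes "Es - 1 < E" "E < Es"
  shows "Es - E \<le> delta \<omega> lam v E" "delta \<omega> lam v E \<le> 2 * (Es - E)"
proof -
  obtain \<theta>c where c: "crit E \<theta>c" using crit_exists[OF assms] by blast
  show "Es - E \<le> delta \<omega> lam v E" "delta \<omega> lam v E \<le> 2 * (Es - E)"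
    unfolding delta_eq[OF c] using DD_ge[OF assms(2)] crit_le[OF c] by auto
qed

text \<open>\<open>DD_ratio\<close> is applied at the minimum point of the higher energy, where D at
  \<open>E\<close> is at least its minimum.\<close>

lemma delta_ratio_mono:
  assumes "Es - 1 < E" "E \<le> E'" "E' < Es"
  shows "delta \<omega> lam v E / (Es - E) \<le> delta \<omega> lam v E' / (Es - E')"
proof (cases "E = E'")
  case False
  obtain \<theta> where c: "crit E \<theta>" using crit_exists[of E] assms by auto
  obtain \<theta>' where c': "crit E' \<theta>'" using crit_exists[of E'] assms by auto
  have "DD V \<omega> E \<theta> * (Es - E') \<le> DD V \<omega> E \<theta>' * (Es - E')"
    using c assms by (intro mult_right_mono) (auto simp: crit_def)
  also have "\<dots> \<le> DD V \<omega> E' \<theta>' * (Es - E)" using assms False by (intro DD_ratio) auto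
  finally show ?thesis unfolding delta_eq[OF c] delta_eq[OF c'] using assms by (simp add: field_simps)
qed auto

text \<open>The ratio delta / (Es - E) increases and lies in [1, 2], so it converges to its
  supremum.\<close>

lemma delta_asymptotics:
  "\<exists>C1>0. ((\<lambda>E. (delta \<omega> lam v E - C1 * (Es - E)) / (Es - E)) \<longlongrightarrow> 0) (at_left Es)"
proof -
  define q where "q E = delta \<omega> lam v E / (Es - E)" for E
  have q: "1 \<le> q E" "q E \<le> 2" if "Es - 1 < E" "E < Es" for E
    using delta_bounds[OF that] that by (auto simp: q_def field_simps)
  define C1 where "C1 = (SUP E\<in>{Es-1<..<Es}. q E)"
  have bdd: "bdd_above (q ` {Es-1<..<Es})" using q by (intro bdd_aboveI[of _ 2]) auto
  have le: "q E \<le> C1" if "Es - 1 < E" "E < Es" for E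
    unfolding C1_def using that by (intro cSUP_upper bdd) auto
  have C1: "0 < C1" using le[of "Es - 1/2"] q(1)[of "Es - 1/2"] by simp
  have "(q \<longlongrightarrow> C1) (at_left Es)"
  proof (rule tendstoI)
    fix e :: real assume e: "0 < e"
    have "\<exists>E1\<in>{Es-1<..<Es}. C1 - e < q E1"
      using less_cSUP_iff[of "{Es-1<..<Es}" q "C1 - e"] bdd e by (simp add: C1_def)
    then obtain E1 where E1: "Es - 1 < E1" "E1 < Es" "C1 - e < q E1" by auto
    show "\<forall>\<^sub>F E in at_left Es. dist (q E) C1 < e"
      using eventually_at_left_real[OF E1(2)]
    proof eventually_elim
      case (elim E)
      then have "q E1 \<le> q E" using delta_ratio_mono[of E1 E] E1 by (simp add: q_def)
      moreover have "q E \<le> C1" using elim E1 by (intro le) auto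
      ultimately show ?case using E1(3) by (simp add: dist_real_def)
    qed
  qed
  then have "((\<lambda>E. q E - C1) \<longlongrightarrow> C1 - C1) (at_left Es)" by (intro tendsto_intros)
  moreover have "\<forall>\<^sub>F E in at_left Es. q E - C1 = (delta \<omega> lam v E - C1 * (Es - E)) / (Es - E)"
  proof -
    have "\<forall>\<^sub>F E in at_left Es. E \<in> {Es-1<..<Es}" using eventually_at_left_real[of "Es - 1" Es] by simp
    then show ?thesis
    proof eventually_elim
      case (elim E)
      then show ?case by (simp add: q_def diff_divide_distrib)
    qed
  qed
  ultimately have "((\<lambda>E. (delta \<omega> lam v E - C1 * (Es - E)) / (Es - E)) \<longlongrightarrow> C1 - C1) (at_left Es)"
    by (rule Lim_transform_eventually)
  then show ?thesis using C1 by (intro exI[of _ C1]) simp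
qed

lemma delta_tendsto: "filterlim (\<lambda>E. delta \<omega> lam v E) (at_right 0) (at_left Es)"
proof -
  have ev: "\<forall>\<^sub>F E in at_left Es. Es - 1 < E \<and> E < Es"
    using eventually_at_left_real[of "Es - 1" Es] by (auto elim!: eventually_mono)
  have "((\<lambda>E. 2 * (Es - E)) \<longlongrightarrow> 2 * (Es - Es)) (at_left Es)" by (intro tendsto_intros)
  then have lim: "((\<lambda>E. 2 * (Es - E)) \<longlongrightarrow> 0) (at_left Es)" by simp
  have "((\<lambda>E. delta \<omega> lam v E) \<longlongrightarrow> 0) (at_left Es)"
  proof (rule tendsto_sandwich[OF _ _ tendsto_const lim])
    show "\<forall>\<^sub>F E in at_left Es. 0 \<le> delta \<omega> lam v E" using ev by eventually_elim (use delta_bounds in force)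
    show "\<forall>\<^sub>F E in at_left Es. delta \<omega> lam v E \<le> 2 * (Es - E)" using ev by eventually_elim (use delta_bounds in force)
  qed
  moreover have "\<forall>\<^sub>F E in at_left Es. delta \<omega> lam v E \<in> {0<..}"
    using ev by eventually_elim (use delta_bounds in force)
  ultimately show ?thesis by (simp add: filterlim_at eventually_conj_iff eventually_mono)
qed

lemma psi_s_C1:
  assumes "E < Es"
  shows "(psi_s \<omega> lam v E has_real_derivative Fd E (\<theta> - \<omega>)) (at \<theta>)" "C1_fun (psi_s \<omega> lam v E)"
    "psi_s \<omega> lam v E (\<theta> + 1) = psi_s \<omega> lam v E \<theta>"
proof -
  have e: "psi_s \<omega> lam v E = (\<lambda>\<theta>. ff V \<omega> E (\<theta> - \<omega>))" using psi_s_eq[OF V_eq assms] by auto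
  show d: "(psi_s \<omega> lam v E has_real_derivative Fd E (\<theta> - \<omega>)) (at \<theta>)" for \<theta>
    unfolding e using ff_deriv[OF assms, of "\<theta> - \<omega>"] DERIV_shift[of "ff V \<omega> E" "Fd E (\<theta> - \<omega>)" \<theta> "-\<omega>"] by simp
  show "C1_fun (psi_s \<omega> lam v E)"
    unfolding C1_fun_def using d
    by (intro exI[of _ "\<lambda>\<theta>. Fd E (\<theta> - \<omega>)"] conjI allI continuous_on_compose2[OF Fd_cont[OF assms]] continuous_intros) auto
  show "psi_s \<omega> lam v E (\<theta> + 1) = psi_s \<omega> lam v E \<theta>"
    unfolding e using ff_int[of E "\<theta> - \<omega>" 1] by (simp add: algebra_simps)
qed

lemma psi_u_C1:
  assumes "E < Es"
  defines "F \<equiv> hill.Fd V V' (-\<omega>)"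
  shows "(psi_u \<omega> lam v E has_real_derivative - (F E \<theta> / (ff V (-\<omega>) E \<theta>)\<^sup>2)) (at \<theta>)" "C1_fun (psi_u \<omega> lam v E)"
    "psi_u \<omega> lam v E (\<theta> + 1) = psi_u \<omega> lam v E \<theta>"
proof -
  have E': "E < Estar V (-\<omega>)" using assms by (simp add: Estar_neg)
  have e: "psi_u \<omega> lam v E = (\<lambda>\<theta>. 1 / ff V (-\<omega>) E \<theta>)" using psi_u_eq[OF V_eq assms(1)] by auto
  have nz: "ff V (-\<omega>) E \<theta> \<noteq> 0" for \<theta> using ff_pos'[OF assms(1), of \<theta>] by simp
  show d: "(psi_u \<omega> lam v E has_real_derivative - (F E \<theta> / (ff V (-\<omega>) E \<theta>)\<^sup>2)) (at \<theta>)" for \<theta>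
    unfolding e F_def using nz[of \<theta>]
    by (auto intro!: derivative_eq_intros hill.ff_deriv[OF hill_neg E'] simp: power2_eq_square)
  have "continuous_on UNIV (\<lambda>\<theta>. - (F E \<theta> / (ff V (-\<omega>) E \<theta>)\<^sup>2))"
    unfolding F_def using nz by (intro continuous_intros hill.Fd_cont[OF hill_neg E'] hill.ff_cont[OF hill_neg E']) auto
  then show "C1_fun (psi_u \<omega> lam v E)" unfolding C1_fun_def using d
    by (intro exI[of _ "\<lambda>\<theta>. - (F E \<theta> / (ff V (-\<omega>) E \<theta>)\<^sup>2)"]) auto
  show "psi_u \<omega> lam v E (\<theta> + 1) = psi_u \<omega> lam v E \<theta>"
    unfolding e using ff_int'[of E \<theta> 1] by simp
qed

end

lemma regularity_loss:
  assumes V_eq: "\<And>x. lam\<^sup>2 * v x = V x" and \<rho>4: "\<rho> \<le> 1 / 4"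
  shows "\<exists>\<epsilon>::real \<Rightarrow> real. \<exists>C2>0. (\<epsilon> \<longlongrightarrow> 0) (at_left Es)
        \<and> (\<forall>\<^sub>F E in at_left Es. \<epsilon> E > 0
            \<and> C1_fun (psi_u \<omega> lam v E) \<and> C1_fun (psi_s \<omega> lam v E)
            \<and> (\<forall>\<psi>\<in>{psi_u \<omega> lam v E, psi_s \<omega> lam v E}.
                 (1 / C2) * (1 / sqrt (delta \<omega> lam v E)) powr (1 - \<epsilon> E) \<le> C1_norm \<psi>
               \<and> C1_norm \<psi> \<le> C2 * (1 / sqrt (delta \<omega> lam v E))))"
proof -
  define d where "d = delta \<omega> lam v"
  define \<epsilon> where "\<epsilon> E = 2 * (ln (ln (1 / d E)) / ln (1 / d E))" for E
  define C where "C = B0 + 3"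
  have C: "3 \<le> C" using B0 by (simp add: C_def)
  \<comment> \<open>2 C / s absorbs the sup norm since s <= 2, the other term the slope; C2 adds the
    constant of the lower bound.\<close>
  define K where "K = 2 * C + 2 * C ^ 3 * sqrt B2"
  define C2 where "C2 = K + 80 * C ^ 3"
  have K0: "0 < K" using C B2 by (auto simp: K_def intro!: add_pos_nonneg)
  have C2: "0 < C2" "K \<le> C2" "80 * C ^ 3 \<le> C2" using C K0 by (auto simp: C2_def intro!: add_pos_nonneg)
  have dlim: "filterlim d (at_right 0) (at_left Es)" unfolding d_def by (rule delta_tendsto[OF V_eq])
  have "filterlim (\<lambda>E. ln (inverse (d E))) at_top (at_left Es)"
    by (intro filterlim_compose[OF ln_at_top] filterlim_compose[OF filterlim_inverse_at_top_right dlim])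
  then have Llim: "filterlim (\<lambda>E. ln (1 / d E)) at_top (at_left Es)" by (simp add: inverse_eq_divide)
  have "((\<lambda>E. 2 * (ln (ln (1 / d E)) / ln (1 / d E))) \<longlongrightarrow> 2 * 0) (at_left Es)"
    by (intro tendsto_intros filterlim_compose[OF ln_x_over_x_tendsto_0 Llim])
  then have \<epsilon>lim: "(\<epsilon> \<longlongrightarrow> 0) (at_left Es)" by (simp add: \<epsilon>_def[abs_def])
  have ev1: "\<forall>\<^sub>F E in at_left Es. Es - 1 < E \<and> E < Es"
    using eventually_at_left_real[of "Es - 1" Es] by (auto elim!: eventually_mono)
  have ev2: "\<forall>\<^sub>F E in at_left Es. 1 < ln (1 / d E)" using Llim by (rule filterlim_at_top_dense[THEN iffD1, rule_format])
  have "(\<lambda>n. 16 * C\<^sup>2 * B2 * (2/3) ^ n) \<longlonglongrightarrow> 16 * C\<^sup>2 * B2 * 0" by (intro tendsto_intros LIMSEQ_power_zero) auto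
  then have "\<forall>\<^sub>F n in sequentially. 16 * C\<^sup>2 * B2 * (2/3) ^ n < 1" by (rule order_tendstoD) simp
  then have "\<exists>n. 16 * C\<^sup>2 * B2 * (2/3) ^ n < 1" by (rule eventually_happens'[OF sequentially_bot])
  then obtain n0 where n0: "16 * C\<^sup>2 * B2 * (2/3) ^ n0 \<le> 1" using less_imp_le by blast
  have d0: "(d \<longlongrightarrow> 0) (at_left Es)" using dlim by (simp add: filterlim_at)
  have "((\<lambda>E. 4 * sqrt (d E)) \<longlongrightarrow> 4 * sqrt 0) (at_left Es)" by (intro tendsto_intros d0)
  then have ev3: "\<forall>\<^sub>F E in at_left Es. 4 * sqrt (d E) < 1 / 4" by (rule order_tendstoD) simp
  have "((\<lambda>E. B1 * (4 * sqrt (d E))) \<longlongrightarrow> B1 * (4 * sqrt 0)) (at_left Es)" by (intro tendsto_intros d0)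
  then have ev4: "\<forall>\<^sub>F E in at_left Es. B1 * (4 * sqrt (d E)) < 1" by (rule order_tendstoD) simp
  have "((\<lambda>E. d E * C ^ (2 * n0)) \<longlongrightarrow> 0 * C ^ (2 * n0)) (at_left Es)" by (intro tendsto_intros d0)
  then have ev5: "\<forall>\<^sub>F E in at_left Es. d E * C ^ (2 * n0) < 1 / (2 * C)" by (rule order_tendstoD) (use C in simp)
  have ev6: "\<forall>\<^sub>F E in at_left Es. d E < exp (-1)" using d0 by (rule order_tendstoD) simp
  have main: "\<forall>\<^sub>F E in at_left Es. \<epsilon> E > 0
            \<and> C1_fun (psi_u \<omega> lam v E) \<and> C1_fun (psi_s \<omega> lam v E)
            \<and> (\<forall>\<psi>\<in>{psi_u \<omega> lam v E, psi_s \<omega> lam v E}.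
                 (1 / C2) * (1 / sqrt (d E)) powr (1 - \<epsilon> E) \<le> C1_norm \<psi>
               \<and> C1_norm \<psi> \<le> C2 * (1 / sqrt (d E)))"
    using ev1 ev2 ev3 ev4 ev5 ev6
  proof eventually_elim
    case (elim E)
    then have E: "Es - 1 < E" "E < Es" by auto
    have E': "E < Estar V (-\<omega>)" using E by (simp add: Estar_neg)
    obtain \<theta>c where cr: "crit E \<theta>c" using crit_exists[OF E] by blast
    have dE: "d E = DD V \<omega> E \<theta>c" unfolding d_def by (rule delta_eq[OF V_eq cr])
    have db: "Es - E \<le> d E" "d E \<le> 2 * (Es - E)" using delta_bounds[OF V_eq E] by (auto simp: d_def)
    have dp: "0 < d E" using db E by linarith
    define s where "s = sqrt (d E)"
    have s: "0 < s" using dp by (simp add: s_def)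
    define L where "L = ln (1 / d E)"
    have L: "1 < L" using elim by (simp add: L_def)
    have pw: "(1 / s) powr (1 - \<epsilon> E) = 1 / (s * L)"
      using powr_loglog[OF dp] elim by (simp add: s_def L_def \<epsilon>_def)
    have CbC: "Cb E \<le> C" "0 < Cb E" using Es_ge E Cb_pos[OF E(2)] by (auto simp: C_def)
    have inv: "1 / C \<le> 1 / Cb E" using CbC by (intro divide_left_mono) auto
    have sE: "1 / sqrt (Es - E) \<le> sqrt 2 / s"
    proof -
      have "s \<le> sqrt (2 * (Es - E))" unfolding s_def using db by (intro real_sqrt_le_mono)
      then have "s \<le> sqrt 2 * sqrt (Es - E)" by (simp only: real_sqrt_mult)
      moreover have "0 < sqrt (Es - E)" using E by simp
      ultimately show ?thesis using s by (simp add: field_simps)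
    qed
    have Cs: "C \<le> 2 * C / s"
    proof -
      have "2 * (Es - E) \<le> 2 * 1" using E by (intro mult_left_mono) auto
      then have "d E \<le> 4" using db(2) by linarith
      then have "s \<le> sqrt 4" unfolding s_def by (rule real_sqrt_le_mono)
      then have "C * s \<le> C * 2" using C by (intro mult_left_mono) auto
      then show ?thesis using s by (simp add: field_simps)
    qed
    have Fbound: "Cb E * sqrt (2 * B2) / sqrt (Es - E) \<le> 2 * C * sqrt B2 / s"
    proof -
      have "Cb E * sqrt (2 * B2) * (1 / sqrt (Es - E)) \<le> C * sqrt (2 * B2) * (sqrt 2 / s)"
        using CbC sE s B2 C E by (intro mult_mono) auto
      also have "\<dots> = (sqrt 2 * sqrt 2) * C * sqrt B2 / s" by (simp add: real_sqrt_mult)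
      finally show ?thesis by simp
    qed
    have Fs: "\<bar>Fd E \<theta>\<bar> \<le> 2 * C * sqrt B2 / s" for \<theta>
      using Fd_bound[OF E(2), of \<theta>] Fbound by linarith
    have Fu: "\<bar>hill.Fd V V' (-\<omega>) E \<theta>\<bar> \<le> 2 * C * sqrt B2 / s" for \<theta>
      using hill.Fd_bound[OF hill_neg E', of \<theta>] Fbound by (simp add: Estar_neg)
    note ps = psi_s_C1[OF V_eq E(2)] and pu = psi_u_C1[OF V_eq E(2)]
    have ps_b: "\<bar>psi_s \<omega> lam v E \<theta>\<bar> \<le> C" for \<theta>
      unfolding psi_s_eq[OF V_eq E(2)] using ff_le[OF E(2), of "\<theta> - \<omega>"] ff_pos[OF E(2), of "\<theta> - \<omega>"] CbC by simp
    have finv: "1 / ff V (-\<omega>) E \<theta> \<le> C" "0 < ff V (-\<omega>) E \<theta>" "ff V (-\<omega>) E \<theta> \<le> C" for \<theta>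
    proof -
      show p: "0 < ff V (-\<omega>) E \<theta>" by (rule ff_pos'[OF E(2)])
      have "1 / C \<le> ff V (-\<omega>) E \<theta>" using ff_ge'[OF E(2), of \<theta>] inv by linarith
      then show "1 / ff V (-\<omega>) E \<theta> \<le> C" using p C by (simp add: field_simps)
      show "ff V (-\<omega>) E \<theta> \<le> C" using ff_le'[OF E(2), of \<theta>] CbC by linarith
    qed
    have pu_b: "\<bar>psi_u \<omega> lam v E \<theta>\<bar> \<le> C" for \<theta>
      unfolding psi_u_eq[OF V_eq E(2)] using finv[of \<theta>] by simp
    have pu_d: "\<bar>- (hill.Fd V V' (-\<omega>) E \<theta> / (ff V (-\<omega>) E \<theta>)\<^sup>2)\<bar> \<le> 2 * C ^ 3 * sqrt B2 / s" for \<theta>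
    proof -
      have "\<bar>- (hill.Fd V V' (-\<omega>) E \<theta> / (ff V (-\<omega>) E \<theta>)\<^sup>2)\<bar> = \<bar>hill.Fd V V' (-\<omega>) E \<theta>\<bar> * (1 / ff V (-\<omega>) E \<theta>)\<^sup>2"
        by (simp add: abs_divide power_divide)
      also have "\<dots> \<le> (2 * C * sqrt B2 / s) * C\<^sup>2"
        using finv[of \<theta>] by (intro mult_mono power_mono order_trans[OF abs_ge_zero Fu] Fu) auto
      finally show ?thesis by (simp add: power2_eq_square power3_eq_cube mult_ac)
    qed
    have low: "1 / (80 * C) \<le> M * s * L" if "\<And>\<theta>. \<bar>Fd E \<theta>\<bar> \<le> M" for M
      unfolding s_def L_def dE C_def
      by (rule lipschitz_lower_bound[OF cr \<rho>4 ff_lipschitz_of_deriv[OF E(2) that]])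
         (use n0 elim in \<open>auto simp: C_def dE\<close>)
    have low': "1 / (80 * C) \<le> M * s * L" if "\<And>\<theta>. \<bar>hill.Fd V V' (-\<omega>) E \<theta>\<bar> \<le> M" for M
      unfolding s_def L_def dE C_def
      by (rule core.lipschitz_lower_bound[OF core_neg _ \<rho>4 core.ff_lipschitz_of_deriv[OF core_neg _ that], unfolded crit_neg DD_neg Estar_neg, OF cr E(2)])
         (use n0 elim in \<open>auto simp: C_def dE\<close>)
    have C3: "C \<le> C ^ 3" using C power_increasing[of 1 3 C] by simp
    have up_s: "C1_norm (psi_s \<omega> lam v E) \<le> C2 * (1 / s)"
    proof -
      have "C1_norm (psi_s \<omega> lam v E) \<le> C + 2 * C * sqrt B2 / s"
        by (rule C1_norm_upper[OF ps(1) ps_b Fs])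
      also have "\<dots> \<le> 2 * C / s + 2 * C ^ 3 * sqrt B2 / s"
        using Cs C3 B2 s by (intro add_mono divide_right_mono mult_right_mono) auto
      also have "\<dots> = K * (1 / s)" by (simp add: K_def add_divide_distrib)
      also have "\<dots> \<le> C2 * (1 / s)" using C2 s by (intro mult_right_mono) auto
      finally show ?thesis .
    qed
    have up_u: "C1_norm (psi_u \<omega> lam v E) \<le> C2 * (1 / s)"
    proof -
      have "C1_norm (psi_u \<omega> lam v E) \<le> C + 2 * C ^ 3 * sqrt B2 / s"
        by (rule C1_norm_upper[OF pu(1) pu_b pu_d])
      also have "\<dots> \<le> 2 * C / s + 2 * C ^ 3 * sqrt B2 / s" using Cs by simp
      also have "\<dots> = K * (1 / s)" by (simp add: K_def add_divide_distrib)
      also have "\<dots> \<le> C2 * (1 / s)" using C2 s by (intro mult_right_mono) auto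
      finally show ?thesis .
    qed
    \<comment> \<open>The factor C^2 makes this fit \<open>psi_u\<close>, whose slope is that of the
      left fraction divided by its square; 80 C then becomes 80 C^3.\<close>
    have fin: "(1 / C2) * (1 / (s * L)) \<le> N" if "1 / (80 * C) \<le> (C\<^sup>2 * N) * s * L" for N
    proof -
      have "1 \<le> 80 * C ^ 3 * (N * s * L)"
        using that C by (simp add: field_simps power2_eq_square power3_eq_cube)
      moreover have N0: "0 \<le> N * s * L"
      proof (rule ccontr)
        assume "\<not> 0 \<le> N * s * L"
        then have "80 * C ^ 3 * (N * s * L) \<le> 0" using C mult_nonneg_nonpos[of "80 * C ^ 3" "N * s * L"] by simp
        then show False using calculation by linarith
      qed
      ultimately have "1 \<le> C2 * (N * s * L)" using mult_right_mono[OF C2(3) N0] by linarith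
      then show ?thesis using C2 s L by (simp add: field_simps)
    qed
    have low_s: "(1 / C2) * (1 / (s * L)) \<le> C1_norm (psi_s \<omega> lam v E)"
    proof (rule fin)
      have Fdb: "\<bar>Fd E \<theta>\<bar> \<le> C1_norm (psi_s \<omega> lam v E)" for \<theta>
        using C1_norm_lower[OF ps(1) ps_b Fs ps(3), of "\<theta> + \<omega>"] by simp
      have N0: "0 \<le> C1_norm (psi_s \<omega> lam v E)" using Fdb[of 0] by linarith
      have "1 * C1_norm (psi_s \<omega> lam v E) * s * L \<le> (C\<^sup>2 * C1_norm (psi_s \<omega> lam v E)) * s * L"
        using s L C N0 by (intro mult_right_mono one_le_power) auto
      then show "1 / (80 * C) \<le> (C\<^sup>2 * C1_norm (psi_s \<omega> lam v E)) * s * L" using low[OF Fdb] by simp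
    qed
    have low_u: "(1 / C2) * (1 / (s * L)) \<le> C1_norm (psi_u \<omega> lam v E)"
    proof (rule fin, rule low')
      fix \<theta>
      have "\<bar>- (hill.Fd V V' (-\<omega>) E \<theta> / (ff V (-\<omega>) E \<theta>)\<^sup>2)\<bar> \<le> C1_norm (psi_u \<omega> lam v E)"
        by (rule C1_norm_lower[OF pu(1) pu_b pu_d pu(3)])
      then have "\<bar>hill.Fd V V' (-\<omega>) E \<theta>\<bar> \<le> (ff V (-\<omega>) E \<theta>)\<^sup>2 * C1_norm (psi_u \<omega> lam v E)"
        using finv(2)[of \<theta>] by (simp add: abs_divide field_simps)
      also have "\<dots> \<le> C\<^sup>2 * C1_norm (psi_u \<omega> lam v E)"
        using finv[of \<theta>] order_trans[OF abs_ge_zero C1_norm_lower[OF pu(1) pu_b pu_d pu(3), of \<theta>]]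
        by (intro mult_right_mono power_mono) auto
      finally show "\<bar>hill.Fd V V' (-\<omega>) E \<theta>\<bar> \<le> C\<^sup>2 * C1_norm (psi_u \<omega> lam v E)" .
    qed
    have "0 < \<epsilon> E" using L by (simp add: \<epsilon>_def L_def[symmetric])
    then show ?case
      unfolding s_def[symmetric] pw using ps(2) pu(2) low_s low_u up_s up_u by simp
  qed
  then show ?thesis using \<epsilon>lim C2(1) unfolding d_def by blast
qed

end

section \<open>Large coupling\<close>

lemma diophantine_nat:
  assumes "diophantine \<omega>"
  obtains k \<tau> where "0 < k" "1 \<le> \<tau>" "\<And>(l::nat) (j::int). 1 \<le> l \<Longrightarrow> k * real l powr (-\<tau>) < \<bar>\<omega> * real l - of_int j\<bar>"
proof -
  obtain k \<tau> where k: "0 < k" "1 \<le> \<tau>"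
    "\<And>n::int. n \<noteq> 0 \<Longrightarrow> k * \<bar>of_int n\<bar> powr (-\<tau>) < (INF p::int. \<bar>of_int n * \<omega> - of_int p\<bar>)"
    using assms by (auto simp: diophantine_def)
  have "k * real l powr (-\<tau>) < \<bar>\<omega> * real l - of_int j\<bar>" if "1 \<le> l" for l :: nat and j :: int
  proof -
    have "k * \<bar>of_int (int l)\<bar> powr (-\<tau>) < (INF p::int. \<bar>of_int (int l) * \<omega> - of_int p\<bar>)"
      using that by (intro k(3)) auto
    also have "\<dots> \<le> \<bar>of_int (int l) * \<omega> - of_int j\<bar>"
      by (intro cINF_lower bdd_belowI[of _ 0]) auto
    finally show ?thesis by (simp add: mult.commute)
  qed
  then show ?thesis using that k by blast
qed

text \<open>The power 4 \<tau> is the price of t^-2 in terms of a radius of order t^(-1/(2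
  \<tau>)).\<close>

lemma subexponential_window:
  fixes \<tau> :: real assumes "1 \<le> \<tau>"
  obtains R where "\<And>r. R \<le> r \<Longrightarrow> 4 * (2 * real r + 1) * (real r + 1) powr (4 * \<tau>) \<le> exp (sqrt (real r) / 4 - 1 / 2)" "1 \<le> R"
proof -
  have "\<forall>\<^sub>F r::nat in at_top. 4 * (2 * real r + 1) * (real r + 1) powr (4 * \<tau>) \<le> exp (sqrt (real r) / 4 - 1 / 2)"
    using assms by real_asymp
  then obtain R where "\<And>r. R \<le> r \<Longrightarrow> 4 * (2 * real r + 1) * (real r + 1) powr (4 * \<tau>) \<le> exp (sqrt (real r) / 4 - 1 / 2)"
    by (auto simp: eventually_at_top_linorder)
  then show ?thesis by (intro that[of "max R 1"]) auto
qed

text \<open>Half the exponent that the Diophantine condition allows: up to time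
  \<open>radius\<close> the rotation moves by at least k sqrt t, which dominates t itself.\<close>

definition radius :: "real \<Rightarrow> real \<Rightarrow> nat" where
  "radius \<tau> t = nat \<lfloor>t powr (- (1 / (2 * \<tau>)))\<rfloor>"

lemma radius_le: "real (radius \<tau> t) \<le> t powr (- (1 / (2 * \<tau>)))"
  by (simp add: radius_def)

lemma radius_gt: "t powr (- (1 / (2 * \<tau>))) < real (radius \<tau> t) + 1"
  by (simp add: radius_def)

lemma radius_large:
  fixes \<kappa> \<tau> :: real
  assumes R: "\<And>r. R \<le> r \<Longrightarrow> 4 * (2 * real r + 1) * (real r + 1) powr (4 * \<tau>) \<le> exp (sqrt (real r) / 4 - 1 / 2)" "1 \<le> R"
    and \<tau>: "1 \<le> \<tau>" and \<kappa>: "3 \<le> \<kappa>" and t: "0 < t" "t \<le> (real R + 1) powr (- (2 * \<tau>))"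
  shows "1 \<le> radius \<tau> t \<and> 4 * (2 * real (radius \<tau> t) + 1) \<le> t\<^sup>2 * \<kappa> powr (sqrt (real (radius \<tau> t)) / 4 - 1 / 2)"
proof -
  define y where "y = t powr (- (1 / (2 * \<tau>)))"
  define r where "r = radius \<tau> t"
  have "((real R + 1) powr (- (2 * \<tau>))) powr (- (1 / (2 * \<tau>))) \<le> y"
    unfolding y_def using t \<tau> by (intro powr_mono2') auto
  then have "real R + 1 \<le> y" using \<tau> by (simp add: powr_powr)
  then have Rr: "R \<le> r" using radius_gt[of t \<tau>] by (simp add: y_def r_def)
  have "y powr (4 * \<tau>) = t powr (-2)" unfolding y_def powr_powr using \<tau> by simp
  also have "\<dots> = 1 / t\<^sup>2" using t by (simp add: powr_minus_divide powr_numeral)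
  finally have "1 / t\<^sup>2 \<le> (real r + 1) powr (4 * \<tau>)"
    using radius_gt[of t \<tau>] \<tau> powr_mono2[of "4 * \<tau>" y "real r + 1"] by (simp add: y_def r_def)
  then have one: "1 \<le> t\<^sup>2 * (real r + 1) powr (4 * \<tau>)" using t by (simp add: field_simps)
  define e where "e = sqrt (real r) / 4 - 1 / 2"
  have Rr': "4 * (2 * real r + 1) * (real r + 1) powr (4 * \<tau>) \<le> exp e" unfolding e_def by (rule R(1)[OF Rr])
  have "1 * 1 \<le> (4 * (2 * real r + 1)) * (real r + 1) powr (4 * \<tau>)" using \<tau> by (intro mult_mono ge_one_powr_ge_zero) auto
  then have "1 \<le> exp e" using Rr' by linarith
  then have e0: "0 \<le> e" by simp
  have "exp e \<le> \<kappa> powr e"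
  proof -
    have "(1::real) = ln (exp 1)" by simp
    also have "\<dots> \<le> ln \<kappa>" using exp_le \<kappa> by (subst ln_le_cancel_iff) auto
    finally have "e * 1 \<le> e * ln \<kappa>" using e0 by (intro mult_left_mono)
    then show ?thesis using \<kappa> by (simp add: powr_def)
  qed
  have "4 * (2 * real r + 1) * 1 \<le> 4 * (2 * real r + 1) * (t\<^sup>2 * (real r + 1) powr (4 * \<tau>))" using one by (intro mult_left_mono) auto
  also have "\<dots> = t\<^sup>2 * (4 * (2 * real r + 1) * (real r + 1) powr (4 * \<tau>))" by simp
  also have "\<dots> \<le> t\<^sup>2 * \<kappa> powr e" using Rr' \<open>exp e \<le> \<kappa> powr e\<close> by (intro mult_left_mono) auto
  finally show ?thesis using Rr R(2) by (simp add: r_def e_def)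
qed

text \<open>Within the window of \<open>s\<close> a return moves the phase by z >= k sqrt s >= 3 s,
  so t > z - s is at least 2 s and 2 z / 3. The latter gives radius t <= K sqrt l, and t <= 2 \<rho>
  forces \<open>l\<close> to be so large that 16 K <= sqrt l.\<close>

lemma radius_dioph:
  fixes k \<tau> \<omega> :: real
  assumes k: "0 < k" and \<tau>: "1 \<le> \<tau>" and D: "\<And>(l::nat) (j::int). 1 \<le> l \<Longrightarrow> k * real l powr (-\<tau>) < \<bar>\<omega> * real l - of_int j\<bar>"
  defines "K \<equiv> (2 / 3 * k) powr (- (1 / (2 * \<tau>)))"
  assumes \<rho>: "2 * \<rho> \<le> k\<^sup>2 / 9" "\<rho> \<le> k / 3 * (16 * K) powr (- (2 * \<tau>))"
    and l: "1 \<le> l" and s: "0 \<le> s" "s \<le> 2 * \<rho>" "s = 0 \<or> l \<le> radius \<tau> s"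
    and t: "\<bar>\<omega> * real l - of_int j\<bar> - s \<le> t" "t \<le> 2 * \<rho>"
  shows "0 < t \<and> 2 * s \<le> t \<and> 16 * radius \<tau> t \<le> l"
proof -
  have K: "0 < K" using k by (simp add: K_def)
  define z where "z = k * real l powr (-\<tau>)"
  have z: "0 < z" "z - s < t" using k l D[OF l, of j] t(1) by (auto simp: z_def)
  have zs: "3 * s \<le> z"
  proof (cases "s = 0")
    case False
    then have s0: "0 < s" and lr: "l \<le> radius \<tau> s" using s by auto
    have "real l \<le> s powr (- (1 / (2 * \<tau>)))" using radius_le[of \<tau> s] lr by linarith
    then have "(s powr (- (1 / (2 * \<tau>)))) powr (-\<tau>) \<le> real l powr (-\<tau>)" using l \<tau> by (intro powr_mono2') auto
    moreover have "(s powr (- (1 / (2 * \<tau>)))) powr (-\<tau>) = sqrt s"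
      unfolding powr_powr using \<tau> s0 by (simp add: powr_half_sqrt)
    ultimately have "k * sqrt s \<le> z" unfolding z_def using k by (intro mult_left_mono) auto
    moreover have "3 * s \<le> k * sqrt s"
    proof -
      have "sqrt s \<le> sqrt (k\<^sup>2 / 9)" using s(2) \<rho>(1) by (intro real_sqrt_le_mono) linarith
      then have "3 * sqrt s \<le> k" using k by (simp add: real_sqrt_divide)
      then have "3 * sqrt s * sqrt s \<le> k * sqrt s" using s0 by (intro mult_right_mono) auto
      moreover have "3 * sqrt s * sqrt s = 3 * s" using s0 by simp
      ultimately show ?thesis by linarith
    qed
    ultimately show ?thesis by linarith
  qed (use z in auto)
  have t1: "2 / 3 * z < t" "2 * s \<le> t" using z zs by linarith+
  have t0: "0 < t" using t1(1) z(1) by linarith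
  have e: "2 / 3 * z = 2 / 3 * k * real l powr (-\<tau>)" by (simp add: z_def)
  have l16: "(16 * K)\<^sup>2 \<le> real l"
  proof (rule ccontr)
    assume "\<not> (16 * K)\<^sup>2 \<le> real l"
    then have "real l < (16 * K) powr 2" using K by (simp add: powr_numeral)
    then have "((16 * K) powr 2) powr (-\<tau>) < real l powr (-\<tau>)" using l \<tau> by (intro powr_less_mono2_neg) auto
    then have "(16 * K) powr (- (2 * \<tau>)) < real l powr (-\<tau>)" by (simp add: powr_powr)
    then have "k / 3 * (16 * K) powr (- (2 * \<tau>)) < k / 3 * real l powr (-\<tau>)" using k by simp
    then have "2 * \<rho> < 2 / 3 * z" using \<rho>(2) by (simp add: z_def)
    then show False using t1 t(2) by linarith
  qed
  have "real (radius \<tau> t) \<le> t powr (- (1 / (2 * \<tau>)))" by (rule radius_le)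
  also have "\<dots> \<le> (2 / 3 * z) powr (- (1 / (2 * \<tau>)))" using t1 z \<tau> by (intro powr_mono2') auto
  also have "\<dots> = K * (real l powr (-\<tau>)) powr (- (1 / (2 * \<tau>)))"
    unfolding e K_def by (rule powr_mult)
  also have "(real l powr (-\<tau>)) powr (- (1 / (2 * \<tau>))) = sqrt (real l)"
    unfolding powr_powr using \<tau> l by (simp add: powr_half_sqrt)
  finally have "16 * real (radius \<tau> t) \<le> 16 * K * sqrt (real l)" by simp
  also have "\<dots> \<le> sqrt (real l) * sqrt (real l)"
    using l16 K by (intro mult_right_mono real_le_rsqrt) auto
  finally have "real (16 * radius \<tau> t) \<le> real l" by simp
  then have "16 * radius \<tau> t \<le> l" by (simp only: of_nat_le_iff)
  then show ?thesis using t0 t1 by blast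
qed

section \<open>Convexity and growth of the potential near its minimum\<close>

lemma strong_midpoint_convex:
  fixes v v' v'' :: "real \<Rightarrow> real"
  assumes "\<And>x. (v has_real_derivative v' x) (at x)" "\<And>x. (v' has_real_derivative v'' x) (at x)"
    and ge: "\<And>z. z \<in> {l..u} \<Longrightarrow> 8 * a \<le> v'' z" and xy: "x \<in> {l..u}" "y \<in> {l..u}"
  shows "v ((x + y) / 2) \<le> (v x + v y) / 2 - a * (x - y)\<^sup>2"
proof -
  \<comment> \<open>The subtracted term has second derivative 8 a and midpoint gap a (x -
    y)^2.\<close>
  define \<phi> where "\<phi> z = v z - 4 * a * z\<^sup>2" for z
  have "convex_on {l..u} \<phi>"
  proof (rule f''_ge0_imp_convex)
    show "(\<phi> has_real_derivative (v' z - 8 * a * z)) (at z)" for z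
      unfolding \<phi>_def by (auto intro!: derivative_eq_intros assms)
    show "((\<lambda>z. v' z - 8 * a * z) has_real_derivative (v'' z - 8 * a)) (at z)" for z
      by (auto intro!: derivative_eq_intros assms)
  qed (use ge in auto)
  from convex_onD[OF this, of "1/2" x y] have "\<phi> ((x + y) / 2) \<le> (\<phi> x + \<phi> y) / 2"
    using xy by (simp add: field_simps)
  then show ?thesis unfolding \<phi>_def by (simp add: power2_eq_square field_simps)
qed

lemma continuous_periodic_bounded:
  fixes f :: "real \<Rightarrow> real"
  assumes "continuous_on UNIV f" "\<And>x. f (x + 1) = f x"
  obtains B where "0 < B" "\<And>x. \<bar>f x\<bar> \<le> B"
proof -
  have "compact (f ` {0..1})" using assms(1) by (intro compact_continuous_image) (auto intro: continuous_on_subset)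
  then have "bounded (f ` {0..1})" by (rule compact_imp_bounded)
  then obtain B where B: "\<forall>y\<in>f ` {0..1}. \<bar>y\<bar> \<le> B" unfolding bounded_iff by auto
  have "\<bar>f x\<bar> \<le> \<bar>B\<bar> + 1" for x
    using periodic_reduce[of f x] assms(2) B by force
  then show ?thesis by (intro that[of "\<bar>B\<bar> + 1"]) auto
qed

text \<open>One constant \<open>a\<close> has to serve all \<rho> <= \<rho>0, as the wells will
  shrink with the coupling. Near \<open>m\<close> the growth is strong convexity; elsewhere v stays
  above its minimum by a fixed \<mu>, which \<rho>0 keeps above 2 a \<rho>^2.\<close>

lemma C2_periodic_min:
  assumes "periodic1 v" "C2_fun v" "unique_nondeg_min v"
  obtains v' m b0 b1 b2 a \<rho>0 where
    "\<And>x. v (x + 1) = v x" "\<And>x. (v has_real_derivative v' x) (at x)" "continuous_on UNIV v'"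
    "\<And>x. \<bar>v' x\<bar> \<le> b1" "\<And>x h. \<bar>v (x + h) - v x - h * v' x\<bar> \<le> b2 * h\<^sup>2"
    "\<And>x. v m \<le> v x" "\<And>x. v x \<le> v m + b0" "0 < b0" "0 < b1" "0 < b2" "0 < a" "0 < \<rho>0" "\<rho>0 \<le> 1 / 4"
    "\<And>x y. x \<in> {m-\<rho>0..m+\<rho>0} \<Longrightarrow> y \<in> {m-\<rho>0..m+\<rho>0} \<Longrightarrow> v ((x + y) / 2) \<le> (v x + v y) / 2 - a * (x - y)\<^sup>2"
    "\<And>x \<rho>. 0 < \<rho> \<Longrightarrow> \<rho> \<le> \<rho>0 \<Longrightarrow> (\<And>j::int. \<rho> < \<bar>x - m - of_int j\<bar>) \<Longrightarrow> v m + 2 * a * \<rho>\<^sup>2 \<le> v x"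
proof -
  have per: "v (x + 1) = v x" for x using assms(1) by (simp add: periodic1_def)
  obtain v' v'' where d1: "\<And>x. (v has_real_derivative v' x) (at x)" and d2: "\<And>x. (v' has_real_derivative v'' x) (at x)"
    and c2: "continuous_on UNIV v''" using assms(2) by (auto simp: C2_fun_def)
  obtain m where m: "\<And>x. v m \<le> v x" "\<And>x. v x = v m \<Longrightarrow> x - m \<in> \<int>" "deriv (deriv v) m > 0"
    using assms(3) by (auto simp: unique_nondeg_min_def)
  have dv: "deriv v = v'" using d1 DERIV_imp_deriv by blast
  have "deriv v' m = v'' m" using d2 DERIV_imp_deriv by blast
  then have v''m: "0 < v'' m" using m(3) dv by simp
  have per': "v' (x + 1) = v' x" for x by (rule deriv_periodic[OF per d1])
  have per'': "v'' (x + 1) = v'' x" for x by (rule deriv_periodic[OF per' d2])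
  have c0: "continuous_on UNIV v" using d1 by (meson DERIV_isCont continuous_at_imp_continuous_on)
  have c1: "continuous_on UNIV v'" using d2 by (meson DERIV_isCont continuous_at_imp_continuous_on)
  obtain B where B: "0 < B" "\<And>x. \<bar>v x\<bar> \<le> B" using continuous_periodic_bounded[OF c0 per] by blast
  obtain b1 where b1: "0 < b1" "\<And>x. \<bar>v' x\<bar> \<le> b1" using continuous_periodic_bounded[OF c1 per'] by blast
  obtain b2 where b2: "0 < b2" "\<And>x. \<bar>v'' x\<bar> \<le> b2" using continuous_periodic_bounded[OF c2 per''] by blast
  have lip: "\<bar>v' x - v' y\<bar> \<le> b2 * \<bar>x - y\<bar>" for x y
  proof -
    have "norm (v' x - v' y) \<le> b2 * norm (x - y)"
      using d2 b2(2) by (intro field_differentiable_bound[where S=UNIV and f'=v'']) (auto intro: has_field_derivative_at_within)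
    then show ?thesis by simp
  qed
  have taylor: "\<bar>v (x + h) - v x - h * v' x\<bar> \<le> b2 * h\<^sup>2" for x h
  proof -
    define g where "g y = v y - y * v' x" for y
    have gd: "(g has_real_derivative v' y - v' x) (at y within S)" for y S
      unfolding g_def by (auto intro!: derivative_eq_intros has_field_derivative_at_within[OF d1])
    have "norm (g (x + h) - g x) \<le> (b2 * \<bar>h\<bar>) * norm (x + h - x)"
    proof (rule field_differentiable_bound[where S="closed_segment x (x + h)" and f'="\<lambda>y. v' y - v' x"])
      fix y assume "y \<in> closed_segment x (x + h)"
      then have "\<bar>y - x\<bar> \<le> \<bar>h\<bar>" by (auto simp: closed_segment_eq_real_ivl split: if_splits)
      then have "b2 * \<bar>y - x\<bar> \<le> b2 * \<bar>h\<bar>" using b2 by (intro mult_left_mono) auto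
      then show "norm (v' y - v' x) \<le> b2 * \<bar>h\<bar>" using lip[of y x] by simp
    qed (use gd in auto)
    then have "\<bar>g (x + h) - g x\<bar> \<le> b2 * h\<^sup>2" by (simp add: power2_eq_square mult.assoc)
    then show ?thesis by (simp add: g_def algebra_simps)
  qed
  \<comment> \<open>At \<open>m\<close> this gives v'' = 16 a, which leaves room for v'' > 8 a in a
    neighbourhood.\<close>
  define a where "a = v'' m / 16"
  have a: "0 < a" using v''m by (simp add: a_def)
  have "isCont v'' m" using c2 by (simp add: continuous_on_eq_continuous_at)
  then have "\<forall>\<^sub>F z in nhds m. 8 * a < v'' z"
    using v''m by (intro order_tendstoD(1)[of v'' "v'' m"]) (auto simp: a_def isCont_def tendsto_at_iff_tendsto_nhds)
  then obtain r where r: "0 < r" "\<And>z. \<bar>z - m\<bar> < r \<Longrightarrow> 8 * a < v'' z"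
    by (auto simp: eventually_nhds_metric dist_real_def)
  define \<rho>1 where "\<rho>1 = min (r / 2) (1 / 4)"
  have \<rho>1: "0 < \<rho>1" "\<rho>1 \<le> 1 / 4" "\<rho>1 < r" using r by (auto simp: \<rho>1_def)
  have conv: "v ((x + y) / 2) \<le> (v x + v y) / 2 - a * (x - y)\<^sup>2" if "x \<in> {m-\<rho>1..m+\<rho>1}" "y \<in> {m-\<rho>1..m+\<rho>1}" for x y
  proof (rule strong_midpoint_convex[OF d1 d2 _ that])
    fix z assume "z \<in> {m-\<rho>1..m+\<rho>1}"
    then have "\<bar>z - m\<bar> < r" using \<rho>1 by auto
    then show "8 * a \<le> v'' z" using r(2) by (simp add: less_imp_le)
  qed
  have near: "v m + 2 * a * (y - m)\<^sup>2 \<le> v y" if "\<bar>y - m\<bar> \<le> \<rho>1" for y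
  proof -
    have "v ((y + m) / 2) \<le> (v y + v m) / 2 - a * (y - m)\<^sup>2" using that \<rho>1 by (intro conv) (auto simp: abs_le_iff)
    then have "v m \<le> (v y + v m) / 2 - a * (y - m)\<^sup>2" using m(1) by (rule order_trans[rotated])
    then show ?thesis by (simp add: field_simps)
  qed
  obtain z where z: "z \<in> {m+\<rho>1..m+1-\<rho>1}" "\<And>y. y \<in> {m+\<rho>1..m+1-\<rho>1} \<Longrightarrow> v z \<le> v y"
    using continuous_attains_inf[of "{m+\<rho>1..m+1-\<rho>1}" v] continuous_on_subset[OF c0] \<rho>1 by auto
  define \<mu> where "\<mu> = v z - v m"
  have \<mu>: "0 < \<mu>"
  proof (rule ccontr)
    assume "\<not> 0 < \<mu>"
    then have "v z = v m" using m(1)[of z] by (simp add: \<mu>_def)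
    then have "z - m \<in> \<int>" by (rule m(2))
    then obtain i :: int where i: "z - m = of_int i" by (auto elim: Ints_cases)
    then have "0 < real_of_int i" "real_of_int i < 1" using z(1) \<rho>1 by auto
    then have "0 < i" "i < 1" by simp_all
    then show False by simp
  qed
  define \<rho>0 where "\<rho>0 = min \<rho>1 (sqrt (\<mu> / (2 * a)))"
  have \<rho>0: "0 < \<rho>0" "\<rho>0 \<le> \<rho>1" "\<rho>0 \<le> sqrt (\<mu> / (2 * a))" using \<rho>1 \<mu> a by (auto simp: \<rho>0_def)
  have perj: "v (x - of_int j) = v x" for x and j :: int
  proof -
    have n: "v (y + real k) = v y" for y k
    proof (induction k)
      case (Suc k) then show ?case using per[of "y + real k"] by (simp add: algebra_simps)
    qed auto
    show ?thesis
    proof (cases "j \<ge> 0")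
      case True then show ?thesis using n[of "x - of_int j" "nat j"] by simp
    next
      case False then show ?thesis using n[of x "nat (-j)"] by simp
    qed
  qed
  have growth: "v m + 2 * a * \<rho>\<^sup>2 \<le> v x" if \<rho>: "0 < \<rho>" "\<rho> \<le> \<rho>0" and far: "\<And>j::int. \<rho> < \<bar>x - m - of_int j\<bar>" for x \<rho>
  proof -
    define y where "y = x - of_int \<lfloor>x - m\<rfloor>"
    have y: "0 \<le> y - m" "y - m < 1" unfolding y_def by linarith+
    have far1: "\<rho> < \<bar>y - m\<bar>" using far[of "\<lfloor>x - m\<rfloor>"] by (simp add: y_def algebra_simps)
    have far2: "\<rho> < \<bar>(y - 1) - m\<bar>" using far[of "\<lfloor>x - m\<rfloor> + 1"] by (simp add: y_def algebra_simps)
    have sq: "2 * a * \<rho>\<^sup>2 \<le> 2 * a * w\<^sup>2" if "\<rho> < \<bar>w\<bar>" for w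
    proof -
      have "\<rho>\<^sup>2 \<le> w\<^sup>2" using that \<rho> abs_le_square_iff[of \<rho> w] by simp
      then show ?thesis using a by (intro mult_left_mono) auto
    qed
    have vy: "v x = v y" "v x = v (y - 1)" using perj[of x "\<lfloor>x - m\<rfloor>"] perj[of y 1] by (auto simp: y_def)
    consider "\<bar>y - m\<bar> \<le> \<rho>1" | "\<bar>(y - 1) - m\<bar> \<le> \<rho>1" | "y \<in> {m+\<rho>1..m+1-\<rho>1}" using y by fastforce
    then show ?thesis
    proof cases
      case 1 then show ?thesis using near[OF 1] sq[OF far1] vy by linarith
    next
      case 2 then show ?thesis using near[OF 2] sq[OF far2] vy by linarith
    next
      case 3
      have "\<rho>\<^sup>2 \<le> (sqrt (\<mu> / (2 * a)))\<^sup>2" using \<rho> \<rho>0 by (intro power_mono) auto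
      then have "2 * a * \<rho>\<^sup>2 \<le> \<mu>" using \<mu> a by (simp add: field_simps)
      then show ?thesis using z(2)[OF 3] vy(1) by (simp add: \<mu>_def)
    qed
  qed
  show ?thesis
  proof (rule that[of v' b1 b2 m "2 * B" a \<rho>0])
    show "v x \<le> v m + 2 * B" for x using B(2)[of x] B(2)[of m] by (simp add: abs_le_iff)
    show "v ((x + y) / 2) \<le> (v x + v y) / 2 - a * (x - y)\<^sup>2" if "x \<in> {m-\<rho>0..m+\<rho>0}" "y \<in> {m-\<rho>0..m+\<rho>0}" for x y
      using that \<rho>0 by (intro conv) auto
  qed (use per d1 c1 b1 b2 taylor m(1) B a \<rho>0 \<rho>1 growth in auto)
qed

theorem theorem2p1:
  fixes \<omega> :: real and v :: "real \<Rightarrow> real"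
  assumes "diophantine \<omega>"
    and "periodic1 v" and "C2_fun v" and "unique_nondeg_min v"
  shows "\<exists>lam0>0. \<forall>lam>lam0.
    (\<forall>\<^sub>F E in at_left (E0 \<omega> lam v).
        \<exists>\<theta>c. \<bar>psi_u \<omega> lam v E \<theta>c - psi_s \<omega> lam v E \<theta>c\<bar> = delta \<omega> lam v E
          \<and> (\<forall>\<theta>. \<bar>psi_u \<omega> lam v E \<theta> - psi_s \<omega> lam v E \<theta>\<bar> = delta \<omega> lam v E \<longrightarrow> \<theta> - \<theta>c \<in> \<int>))
    \<and> (\<exists>C1>0. ((\<lambda>E. (delta \<omega> lam v E - C1 * (E0 \<omega> lam v - E)) / (E0 \<omega> lam v - E))
                  \<longlongrightarrow> 0) (at_left (E0 \<omega> lam v)))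
    \<and> (\<exists>\<epsilon>::real \<Rightarrow> real. \<exists>C2>0. (\<epsilon> \<longlongrightarrow> 0) (at_left (E0 \<omega> lam v))
        \<and> (\<forall>\<^sub>F E in at_left (E0 \<omega> lam v). \<epsilon> E > 0
            \<and> C1_fun (psi_u \<omega> lam v E) \<and> C1_fun (psi_s \<omega> lam v E)
            \<and> (\<forall>\<psi>\<in>{psi_u \<omega> lam v E, psi_s \<omega> lam v E}.
                 (1 / C2) * (1 / sqrt (delta \<omega> lam v E)) powr (1 - \<epsilon> E) \<le> C1_norm \<psi>
               \<and> C1_norm \<psi> \<le> C2 * (1 / sqrt (delta \<omega> lam v E)))))"
proof -
  obtain k \<tau> where k: "0 < k" "1 \<le> \<tau>"
    and D: "\<And>(l::nat) (j::int). 1 \<le> l \<Longrightarrow> k * real l powr (-\<tau>) < \<bar>\<omega> * real l - of_int j\<bar>"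
    by (rule diophantine_nat[OF assms(1)]) (rule that; assumption)
  have \<omega>: "\<omega> \<noteq> 0" using D[of 1 0] k by auto
  show ?thesis
  proof (rule C2_periodic_min[OF assms(2-4)])
    fix v' m b0 b1 b2 a \<rho>1 assume v:
      "\<And>x. v (x + 1) = v x" "\<And>x. (v has_real_derivative v' x) (at x)" "continuous_on UNIV v'"
      "\<And>x. \<bar>v' x\<bar> \<le> b1" "\<And>x h. \<bar>v (x + h) - v x - h * v' x\<bar> \<le> b2 * h\<^sup>2"
      "\<And>x. v m \<le> v x" "\<And>x. v x \<le> v m + b0" "0 < b0" "0 < b1" "0 < b2" "0 < a" "0 < \<rho>1" "\<rho>1 \<le> 1 / 4"
      "\<And>x y. x \<in> {m-\<rho>1..m+\<rho>1} \<Longrightarrow> y \<in> {m-\<rho>1..m+\<rho>1} \<Longrightarrow> v ((x + y) / 2) \<le> (v x + v y) / 2 - a * (x - y)\<^sup>2"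
      "\<And>x \<rho>. 0 < \<rho> \<Longrightarrow> \<rho> \<le> \<rho>1 \<Longrightarrow> (\<And>j::int. \<rho> < \<bar>x - m - of_int j\<bar>) \<Longrightarrow> v m + 2 * a * \<rho>\<^sup>2 \<le> v x"
    obtain R where R: "\<And>r. R \<le> r \<Longrightarrow> 4 * (2 * real r + 1) * (real r + 1) powr (4 * \<tau>) \<le> exp (sqrt (real r) / 4 - 1 / 2)" "1 \<le> R"
      by (rule subexponential_window[OF k(2)]) (rule that; assumption)
    define K where "K = (2 / 3 * k) powr (- (1 / (2 * \<tau>)))"
    have K: "0 < K" using k by (simp add: K_def)
    \<comment> \<open>The entries: validity of convexity and growth, the range of
      \<open>radius_large\<close> for t <= 2 \<rho>, and the two conditions of
      \<open>radius_dioph\<close>.\<close>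
    define \<rho>0 where "\<rho>0 = Min {\<rho>1, (real R + 1) powr (- (2 * \<tau>)) / 2, k\<^sup>2 / 18, k / 3 * (16 * K) powr (- (2 * \<tau>))}"
    have \<rho>0: "0 < \<rho>0" "\<rho>0 \<le> \<rho>1" "\<rho>0 \<le> (real R + 1) powr (- (2 * \<tau>)) / 2" "\<rho>0 \<le> k\<^sup>2 / 18" "\<rho>0 \<le> k / 3 * (16 * K) powr (- (2 * \<tau>))"
      using v(12) k K by (auto simp: \<rho>0_def)
    \<comment> \<open>Bounds the left side of \<open>small_coupling\<close> for every coupling: B1^2
      grows like x^16 against \<kappa>^3 like x^18, and B2 like x^8 against \<kappa>^2 like x^12,
      where x^4 = lam.\<close>
    define Q where "Q = 2 * b1\<^sup>2 * (2 / a) ^ 3 + b2 * (2 / a)\<^sup>2"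
    have Q: "0 < Q" using v by (auto simp: Q_def intro!: add_pos_pos mult_pos_pos)
    define X where "X = 1 + 1 / \<rho>0 + 6 / a + 2 * Q / a"
    have X: "1 \<le> X" "1 / \<rho>0 \<le> X" "6 / a \<le> X" "2 * Q / a \<le> X"
      using \<rho>0(1) v(11) Q by (auto simp: X_def intro!: add_nonneg_nonneg)
    show ?thesis (is "\<exists>lam0>0. \<forall>lam>lam0. ?P lam")
    proof (rule exI[of _ "X ^ 4"], intro conjI[of "0 < X ^ 4"] allI impI)
      show "0 < X ^ 4" using X(1) by simp
      fix lam assume lam: "X ^ 4 < lam"
      define x where "x = sqrt (sqrt lam)"
      have lam0: "0 < lam" using lam X(1) by (smt (verit) zero_less_power)
      have x4: "x ^ 4 = lam"
      proof -
        have "x ^ 4 = (x\<^sup>2)\<^sup>2" by simp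
        then show ?thesis unfolding x_def using lam0 by simp
      qed
      have xX: "X < x" by (rule power_less_imp_less_base[of _ 4]) (use lam x4 lam0 in \<open>auto simp: x_def\<close>)
      have x: "1 \<le> x" "1 / \<rho>0 \<le> x" "6 / a \<le> x" "2 * Q / a \<le> x" using xX X by linarith+
      have x8: "lam\<^sup>2 = x ^ 8" unfolding x4[symmetric] by simp
      define V where "V = (\<lambda>y. lam\<^sup>2 * v y)"
      \<comment> \<open>The growth 2 a \<rho>^2 of v, multiplied by lam^2 = x^8, is to equal 4
        \<kappa>; this gives \<kappa> = a x^6 / 2. A single large x then makes \<rho> small and
        \<kappa>, \<gamma> large at the same time.\<close>
      define \<rho> where "\<rho> = 1 / x"
      define \<kappa> where "\<kappa> = a / 2 * x ^ 6"
      define \<gamma> where "\<gamma> = a * x ^ 8"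
      have \<rho>: "0 < \<rho>" "\<rho> \<le> \<rho>0" using x \<rho>0(1) by (auto simp: \<rho>_def field_simps)
      have ax: "6 \<le> a * x" using x(3) v(11) by (simp add: field_simps)
      have pw: "x \<le> x ^ 6" "x \<le> x ^ 8" using power_increasing[of 1 6 x] power_increasing[of 1 8 x] x(1) by auto
      have \<kappa>3: "3 \<le> \<kappa>"
      proof -
        have "a * x \<le> a * x ^ 6" using pw v(11) by (intro mult_left_mono) auto
        then show ?thesis using ax by (simp add: \<kappa>_def)
      qed
      have \<gamma>2: "2 \<le> \<gamma>"
      proof -
        have "a * x \<le> a * x ^ 8" using pw v(11) by (intro mult_left_mono) auto
        then show ?thesis using ax by (simp add: \<gamma>_def)
      qed
      have \<rho>4: "\<rho> \<le> 1 / 4" using \<rho> \<rho>0 v(13) by linarith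
      interpret core V "\<lambda>y. lam\<^sup>2 * v' y" \<omega> m "lam\<^sup>2 * b0" "lam\<^sup>2 * b1" "lam\<^sup>2 * b2" \<kappa> \<gamma> \<rho> "radius \<tau>"
      proof
        show "V (y + 1) = V y" for y by (simp add: V_def v(1))
        show "(V has_real_derivative lam\<^sup>2 * v' y) (at y)" for y unfolding V_def by (intro DERIV_cmult v(2))
        show "continuous_on UNIV (\<lambda>y. lam\<^sup>2 * v' y)" by (intro continuous_intros v(3))
        show "\<bar>lam\<^sup>2 * v' y\<bar> \<le> lam\<^sup>2 * b1" for y using v(4)[of y] by (simp add: abs_mult mult_left_mono)
        show "\<bar>V (y + h) - V y - h * (lam\<^sup>2 * v' y)\<bar> \<le> lam\<^sup>2 * b2 * h\<^sup>2" for y h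
        proof -
          have "V (y + h) - V y - h * (lam\<^sup>2 * v' y) = lam\<^sup>2 * (v (y + h) - v y - h * v' y)" by (simp add: V_def algebra_simps)
          then show ?thesis using mult_left_mono[OF v(5)[of y h], of "lam\<^sup>2"] by (simp add: abs_mult mult.assoc)
        qed
        show "V m \<le> V y" for y using v(6) by (simp add: V_def mult_left_mono)
        show "V y \<le> V m + lam\<^sup>2 * b0" for y
          using mult_left_mono[OF v(7)[of y], of "lam\<^sup>2"] by (simp add: V_def algebra_simps)
        show "0 < lam\<^sup>2 * b0" "0 < lam\<^sup>2 * b1" "0 < lam\<^sup>2 * b2" using lam0 v by auto
        show "\<omega> \<noteq> 0" "3 \<le> \<kappa>" "2 \<le> \<gamma>" "0 < \<rho>" by fact+
        show "2 * (lam\<^sup>2 * b1)\<^sup>2 / \<kappa> ^ 3 + lam\<^sup>2 * b2 / \<kappa>\<^sup>2 \<le> \<gamma> / 2"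
        proof -
          have x0: "0 < x" using x(1) by simp
          have "2 * (lam\<^sup>2 * b1)\<^sup>2 / \<kappa> ^ 3 = 2 * b1\<^sup>2 * (2 / a) ^ 3 * (x ^ 16 / x ^ 18)"
            unfolding x8 \<kappa>_def by (simp add: power_mult_distrib power_divide flip: power_mult)
          also have "x ^ 16 / x ^ 18 \<le> 1" using x x0 power_increasing[of 16 18 x] by (simp add: field_simps)
          then have "2 * b1\<^sup>2 * (2 / a) ^ 3 * (x ^ 16 / x ^ 18) \<le> 2 * b1\<^sup>2 * (2 / a) ^ 3 * 1" using v(11) by (intro mult_left_mono) auto
          finally have 1: "2 * (lam\<^sup>2 * b1)\<^sup>2 / \<kappa> ^ 3 \<le> 2 * b1\<^sup>2 * (2 / a) ^ 3" by simp
          have "lam\<^sup>2 * b2 / \<kappa>\<^sup>2 = b2 * (2 / a)\<^sup>2 * (x ^ 8 / x ^ 12)"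
            unfolding x8 \<kappa>_def by (simp add: power_mult_distrib power_divide flip: power_mult)
          also have "x ^ 8 / x ^ 12 \<le> 1" using x x0 power_increasing[of 8 12 x] by (simp add: field_simps)
          then have "b2 * (2 / a)\<^sup>2 * (x ^ 8 / x ^ 12) \<le> b2 * (2 / a)\<^sup>2 * 1" using v(10,11) by (intro mult_left_mono) auto
          finally have 2: "lam\<^sup>2 * b2 / \<kappa>\<^sup>2 \<le> b2 * (2 / a)\<^sup>2" by simp
          have "2 * Q \<le> a * x" using x(4) v(11) by (simp add: field_simps)
          also have "\<dots> \<le> \<gamma>" unfolding \<gamma>_def using pw v(11) by (intro mult_left_mono) auto
          finally have "Q \<le> \<gamma> / 2" by simp
          then show ?thesis using add_mono[OF 1 2] unfolding Q_def by (rule order_trans[rotated])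
        qed
        show "V m + 4 * \<kappa> \<le> V y" if "\<And>j::int. \<rho> < \<bar>y - m - of_int j\<bar>" for y
        proof -
          have "v m + 2 * a * \<rho>\<^sup>2 \<le> v y" using \<rho> \<rho>0 that by (intro v(15)) auto
          then have "lam\<^sup>2 * (v m + 2 * a * \<rho>\<^sup>2) \<le> V y" unfolding V_def by (intro mult_left_mono) auto
          moreover have "lam\<^sup>2 * (2 * a * \<rho>\<^sup>2) = 4 * \<kappa>"
          proof -
            have e: "x ^ 8 = x ^ 6 * x\<^sup>2" by (simp flip: power_add)
            have "x ^ 8 / x\<^sup>2 = x ^ 6" unfolding e using x(1) by (intro nonzero_mult_div_cancel_right) auto
            moreover have "x ^ 8 * (2 * a * (1 / x)\<^sup>2) = 2 * a * (x ^ 8 / x\<^sup>2)" by (simp add: power_divide)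
            ultimately show ?thesis unfolding x8 \<rho>_def \<kappa>_def by simp
          qed
          ultimately show ?thesis by (simp add: V_def distrib_left)
        qed
        show "V ((y + z) / 2) \<le> (V y + V z) / 2 - \<gamma> * (y - z)\<^sup>2" if "y \<in> {m-\<rho>..m+\<rho>}" "z \<in> {m-\<rho>..m+\<rho>}" for y z
        proof -
          have "v ((y + z) / 2) \<le> (v y + v z) / 2 - a * (y - z)\<^sup>2" using that \<rho> \<rho>0 by (intro v(14)) auto
          then have "lam\<^sup>2 * v ((y + z) / 2) \<le> lam\<^sup>2 * ((v y + v z) / 2 - a * (y - z)\<^sup>2)" by (intro mult_left_mono) auto
          also have "\<dots> = (V y + V z) / 2 - (a * lam\<^sup>2) * (y - z)\<^sup>2" by (simp add: V_def algebra_simps add_divide_distrib)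
          finally show ?thesis unfolding \<gamma>_def x8[symmetric] V_def .
        qed
        show "1 \<le> radius \<tau> t \<and> 4 * (2 * real (radius \<tau> t) + 1) \<le> t\<^sup>2 * \<kappa> powr (sqrt (real (radius \<tau> t)) / 4 - 1 / 2)"
          if "0 < t" "t \<le> 2 * \<rho>" for t
          using that \<rho> \<rho>0 by (intro radius_large[OF R k(2) \<kappa>3]) auto
        show "0 < t \<and> 2 * s \<le> t \<and> 16 * radius \<tau> t \<le> l"
          if "1 \<le> l" "0 \<le> s" "s \<le> 2 * \<rho>" "s = 0 \<or> l \<le> radius \<tau> s" "\<bar>\<omega> * real l - of_int j\<bar> - s \<le> t" "t \<le> 2 * \<rho>" for l s j t
          using that \<rho> \<rho>0 by (intro radius_dioph[OF k D, of \<rho> l s j t]) (auto simp: K_def)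
      qed
      have V_eq: "lam\<^sup>2 * v y = V y" for y by (simp add: V_def)
      note E0 = threshold_eq[OF V_eq]
      have "\<forall>\<^sub>F E in at_left Es. E \<in> {Es-1<..<Es}" using eventually_at_left_real[of "Es - 1" Es] by simp
      then have unique: "\<forall>\<^sub>F E in at_left (E0 \<omega> lam v).
          \<exists>\<theta>c. \<bar>psi_u \<omega> lam v E \<theta>c - psi_s \<omega> lam v E \<theta>c\<bar> = delta \<omega> lam v E
            \<and> (\<forall>\<theta>. \<bar>psi_u \<omega> lam v E \<theta> - psi_s \<omega> lam v E \<theta>\<bar> = delta \<omega> lam v E \<longrightarrow> \<theta> - \<theta>c \<in> \<int>)"
        unfolding E0
      proof eventually_elim
        case (elim E)
        then obtain \<theta>c where "crit E \<theta>c" using crit_exists[of E] by auto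
        from gap_attained_uniquely[OF V_eq this] show ?case by blast
      qed
      have asymp: "\<exists>C1>0. ((\<lambda>E. (delta \<omega> lam v E - C1 * (E0 \<omega> lam v - E)) / (E0 \<omega> lam v - E)) \<longlongrightarrow> 0) (at_left (E0 \<omega> lam v))"
        unfolding E0 by (rule delta_asymptotics[OF V_eq])
      have loss: "\<exists>\<epsilon>::real \<Rightarrow> real. \<exists>C2>0. (\<epsilon> \<longlongrightarrow> 0) (at_left (E0 \<omega> lam v))
          \<and> (\<forall>\<^sub>F E in at_left (E0 \<omega> lam v). \<epsilon> E > 0
              \<and> C1_fun (psi_u \<omega> lam v E) \<and> C1_fun (psi_s \<omega> lam v E)
              \<and> (\<forall>\<psi>\<in>{psi_u \<omega> lam v E, psi_s \<omega> lam v E}.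
                   (1 / C2) * (1 / sqrt (delta \<omega> lam v E)) powr (1 - \<epsilon> E) \<le> C1_norm \<psi>
                 \<and> C1_norm \<psi> \<le> C2 * (1 / sqrt (delta \<omega> lam v E))))"
        unfolding E0 by (rule regularity_loss[OF V_eq \<rho>4])
      show "?P lam" by (intro conjI unique asymp loss)
    qed
  qed
qed

end
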